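(* Algorithm PLSviaCTSNF is correct: for every PLS problem $(\mathbf{A},\mathbf{b},N,Z)$ over $F[Y,x]$, with parameter list $Y$ and distinguished variable $x$, the set $S$ returned by PLSviaCTSNF is a PLS solution of $(\mathbf{A},\mathbf{b},N,Z)$, i.e. every element of $S$ is a valid solution regime or inconsistency regime and the regimes in $S$ cover $V(Z)\cap D(N)$.
   Context: Let $F$ be a field with fixed algebraic closure $\overline{F}$, $Y=(y_1,\dots,y_s)$ parameters and $x$ a further parameter. For finite $S,N\subseteq F[Y,x]$, $V(S)\subseteq\overline{F}^s\times\overline{F}$ is the set of $(a,\xi)$ at which all elements of $S$ vanish and $D(N)$ the set at which no element of $N$ vanishes; for subsets of $F[Y]$ the same notation is used for subsets of $\overline{F}^s$. $\mathbf{A}(a)$ is partial evaluation $Y=a$ (leaving $x$), and $\mathbf{A}(a,\xi)$ full evaluation. Parameterized extension. $F_Y$ is the top of a tower obtained by adjoining the parameters of $Y$ in some order, each as a rational function parameter or as algebraic over the field so far; an algebraic step is $F_{j-1}[y_i]/\langle f_i\rangle$ with $f_i$ irreducible over $F_{j-1}$. When a regime is over $F_Y$, the polynomials defining the algebraic steps are included in its vanishing set $Z'$. Elements of $F_Y(x)$ are evaluated at points of $V(Z')\cap D(N')$ where their denominators do not vanish. Convention for constraints: for $q=\mathrm{num}(q)/\mathrm{den}(q)$ in lowest terms, $q$ in a vanishing set means $\mathrm{num}(q)=0$ and $\mathrm{den}(q)\ne0$; $q$ in a nonvanishing set means $\mathrm{num}(q)\neq0$ and $\mathrm{den}(q)\ne0$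 (over an algebraic parameterized extension, interpreted in the quotient coordinate ring). Whenever regime data contain rational function coefficients, the relevant denominator factors are adjoined to the nonvanishing set so that everything is well defined on the constructible set. $\mathrm{den}$ of a vector or matrix is the lcm of the denominators of its entries. PLS problem $(\mathbf{A},\mathbf{b},N,Z)$: $\mathbf{A}$ an $m\times n$ matrix and $\mathbf{b}$ an $m$-vector over $F[Y,x]$, finite $N,Z\subseteq F[Y,x]$. A solution regime is $(\mathbf{u},\mathbf{B},N',Z')$ with entries of $\mathbf{u},\mathbf{B}$ in some $F_Y(x)$, all denominator factors in $N'$, such that for all $(a,\xi)\in V(Z')\cap D(N')$, $\mathbf{A}(a,\xi)\mathbf{u}(a,\xi)=\mathbf{b}(a,\xi)$ and the columns of $\mathbf{B}(a,\xi)$ form a nullspace basis for $\mathbf{A}(a,\xi)$. An inconsistency regime is $(\bot,N',Z')$ such that for all $(a,\xi)\in V(Z')\cap D(N')$ the system $\mathbf{A}(a,\xi)\mathbf{u}=\mathbf{b}(a,\xi)$ has no solution. A PLS solution is a set of regimes whose constructible sets $V(Z_i)\cap D(N_i)$ cover $V(Z)\cap D(N)$. Triangular Smith form over $K[x]$ ($K$ a field): upper triangular; (nonzero) diagonal entries monic; in each column with nonzero diagonal entry, off-diagonal entries have lower degree than the diagonal entry; each diagonal entry exactly divides all entries below and to the right. CTSNF problem $(\mathbf{A},N,Z)$: $\mathbf{A}$ over $F[Y,x]$, finite $N,Z\subseteq F[Y]$. A triangular Smith regime is $(\mathbf{U},\mathbf{H},\mathbf{R},N',Z')$ with $\mathbf{U},\mathbf{H}$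 over $F_Y[x]$, $N',Z'\subseteq F[Y]$, all denominator factors of $\mathbf{U},\mathbf{H}$ in $N'$, such that for all $a\in V(Z')\cap D(N')$: $\mathbf{H}(a)$ is in triangular Smith form over $F(a)[x]$, $\mathbf{U}(a)$ is unimodular, $\mathbf{R}$ is nonsingular over $F$, and $\mathbf{U}(a)\mathbf{A}(a)\mathbf{R}=\mathbf{H}(a)$. As part of the setting, $\mathbf{H}$ is itself a triangular Smith form over $F_Y[x]$ with $\mathbf{U}\mathbf{A}\mathbf{R}=\mathbf{H}$. A CTSNF solution is a finite list of such regimes with $V(Z)\cap D(N)\subseteq\bigcup_i V(Z_i)\cap D(N_i)$. Algorithm TriangularSmithPLS. Input: $(\mathbf{H},\mathbf{b},N,Z)$ with $\mathbf{H}\in F_Y[x]^{m\times n}$ in triangular Smith form, $\mathbf{b}\in F_Y[x]^m$. Let $s_i$ be the $i$-th diagonal entry, $s_0=1$, $r_0=\max\{i: s_i\ne0\}$, $s_{r_0+1}=0$; $\mathrm{sqfr}$ is the square-free part in $x$. Set $f_i=\mathrm{sqfr}(s_{i+1})/\mathrm{sqfr}(s_i)$ for $0\le i\le r_0-1$ and $f_{r_0}=0$; let $\mathcal{I}$ be the set of $i\in\{0,\dots,r_0\}$ such that $f_i$ has positive degree in $x$ or is zero. For each $r\in\mathcal{I}$: let $\mathbf{H}_r$ be the leading $r\times r$ block, $\mathbf{H}_{12}$ the block of the first $r$ rows and last $n-r$ columns, $\mathbf{b}_r=(b_1,\dots,b_r)^T$, $\mathbf{u}=(\mathbf{H}_r^{-1}\mathbf{b}_r,0_{n-r})$,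 $\mathbf{B}=\begin{bmatrix}-\mathbf{H}_r^{-1}\mathbf{H}_{12}\\ \mathbf{I}_{n-r}\end{bmatrix}$; output the solution regime $(\mathbf{u},\mathbf{B},N\cup\{s_r,\mathrm{den}(\mathbf{u}),\mathrm{den}(\mathbf{B})\},Z\cup\{f_r,b_{r+1},\dots,b_m\})$, and for each $j=r+1,\dots,m$ output the inconsistency regime $(\bot,N\cup\{s_r,b_j\},Z\cup\{f_r\})$. Algorithm PLSviaCTSNF. Input: a PLS problem $(\mathbf{A},\mathbf{b},N,Z)$ over $F[Y,x]$. 1. Let $N_Y=N\cap F[Y]$, $Z_Y=Z\cap F[Y]$, $N_x=N\setminus N_Y$, $Z_x=Z\setminus Z_Y$. 2. Let $T$ be a CTSNF solution of the CTSNF problem $(\mathbf{A},N_Y,Z_Y)$; let $S=\emptyset$. 3. For each $(\mathbf{U},\mathbf{H},\mathbf{R},N',Z')\in T$, apply TriangularSmithPLS to the PLS problem $(\mathbf{H},\mathbf{U}\mathbf{b},N'\cup N_x,Z'\cup Z_x)$. For each returned solution regime $(\mathbf{w},\mathbf{C},N'',Z'')$ adjoin $(\mathbf{R}\mathbf{w},\mathbf{R}\mathbf{C},N'',Z'')$ to $S$; adjoin each returned inconsistency regime to $S$ unchanged. 4. Return $S$.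
   Formalization: For regimes of T over an F_Y with an algebraic step, the denominators of the quotients f_i must also lie in N'. Without this the claim fails: A=[x^3-3tx+2y], b=0, Z={y^2-t^3}, T={(1,A,1,{},Z)} misses t=y=x=0, where the denominator of f_0=x^2+(y/t)x-2t vanishes. *)

theory Defs
  imports
    "Jordan_Normal_Form.Matrix_Kernel"
    "Jordan_Normal_Form.Gauss_Jordan_Elimination"
    "HOL-Library.Poly_Mapping"
    "HOL-Algebra.Algebraic_Closure_Type"
begin

text \<open>
  The parameters are indexed by a finite type \<open>'y\<close>; its order only serves to make
  \<open>('y \<Rightarrow>\<^sub>0 nat) \<Rightarrow>\<^sub>0 'a\<close> an integral domain.  Elements of \<open>F[Y,x]\<close> are polynomials in \<open>x\<close>
  over \<open>F[Y]\<close>.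
\<close>

type_synonym ('y, 'a) ypoly = "('y \<Rightarrow>\<^sub>0 nat) \<Rightarrow>\<^sub>0 'a"
type_synonym ('y, 'a) yxpoly = "('y, 'a) ypoly poly"

text \<open>
  All parameterized extensions are realised inside one universal field, the algebraic closure of
  the rational function field \<open>F(Y)\<close>.  It is algebraically closed and of transcendence degree
  \<open>s\<close> over \<open>F\<close>, so every tower over \<open>F\<close> obtained by adjoining \<open>s\<close> elements embeds into it.
\<close>

type_synonym ('y, 'a) univ = "('y, 'a) ypoly fract alg_closure"

definition const_univ :: "'a::field \<Rightarrow> ('y::linorder, 'a) univ" where
  "const_univ c = to_ac (to_fract (Poly_Mapping.single 0 c))"

definition param_var :: "'y \<Rightarrow> ('y::linorder, 'a::field) ypoly" where
  "param_var i = Poly_Mapping.single (Poly_Mapping.single i 1) 1"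

definition params :: "('y, 'a::zero) ypoly \<Rightarrow> 'y set" where
  "params p = (\<Union>m \<in> Poly_Mapping.keys p. Poly_Mapping.keys m)"

definition ypoly_eval :: "('a::zero \<Rightarrow> 'k::comm_semiring_1) \<Rightarrow> ('y \<Rightarrow> 'k) \<Rightarrow> ('y, 'a) ypoly \<Rightarrow> 'k" where
  "ypoly_eval h a p = (\<Sum>m \<in> Poly_Mapping.keys p.
     h (Poly_Mapping.lookup p m) * (\<Prod>i \<in> Poly_Mapping.keys m. a i ^ Poly_Mapping.lookup m i))"

abbreviation at_param :: "('y \<Rightarrow> 'a::field alg_closure) \<Rightarrow> ('y, 'a) ypoly \<Rightarrow> 'a alg_closure" where
  "at_param a \<equiv> ypoly_eval to_ac a"

definition at_params_x :: "('y \<Rightarrow> 'a::field alg_closure) \<Rightarrow> ('y, 'a) yxpoly \<Rightarrow> 'a alg_closure poly" where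
  "at_params_x a p = map_poly (at_param a) p"

definition at_point :: "('y \<Rightarrow> 'a::field alg_closure) \<Rightarrow> 'a alg_closure \<Rightarrow> ('y, 'a) yxpoly \<Rightarrow> 'a alg_closure" where
  "at_point a \<xi> p = poly (at_params_x a p) \<xi>"

definition constructible_Y :: "('y, 'a::field) ypoly set \<Rightarrow> ('y, 'a) ypoly set \<Rightarrow> ('y \<Rightarrow> 'a alg_closure) set" where
  "constructible_Y N Z = {a. (\<forall>p\<in>Z. at_param a p = 0) \<and> (\<forall>p\<in>N. at_param a p \<noteq> 0)}"

definition constructible ::
    "('y, 'a::field) yxpoly set \<Rightarrow> ('y, 'a) yxpoly set \<Rightarrow> (('y \<Rightarrow> 'a alg_closure) \<times> 'a alg_closure) set" where
  "constructible N Z =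
     {(a, \<xi>). (\<forall>p\<in>Z. at_point a \<xi> p = 0) \<and> (\<forall>p\<in>N. at_point a \<xi> p \<noteq> 0)}"


section \<open>Polynomials over subfields\<close>

definition is_subfield :: "'k::field set \<Rightarrow> bool" where
  "is_subfield K \<longleftrightarrow> 0 \<in> K \<and> 1 \<in> K \<and>
     (\<forall>x\<in>K. \<forall>y\<in>K. x + y \<in> K \<and> x * y \<in> K) \<and> (\<forall>x\<in>K. - x \<in> K \<and> inverse x \<in> K)"

definition adjoin :: "('a \<Rightarrow> 'k::field) \<Rightarrow> 'k set \<Rightarrow> 'k set" where
  "adjoin h S = \<Inter>{K. is_subfield K \<and> range h \<subseteq> K \<and> S \<subseteq> K}"

definition poly_over :: "'k::field set \<Rightarrow> 'k poly \<Rightarrow> bool" where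
  "poly_over K p \<longleftrightarrow> (\<forall>i. Polynomial.coeff p i \<in> K)"

definition dvd_over :: "'k::field set \<Rightarrow> 'k poly \<Rightarrow> 'k poly \<Rightarrow> bool" where
  "dvd_over K p q \<longleftrightarrow> (\<exists>c. poly_over K c \<and> q = p * c)"

definition irreducible_over :: "'k::field set \<Rightarrow> 'k poly \<Rightarrow> bool" where
  "irreducible_over K p \<longleftrightarrow> poly_over K p \<and> Polynomial.degree p > 0 \<and>
     (\<forall>g h. poly_over K g \<and> poly_over K h \<and> p = g * h \<longrightarrow>
        Polynomial.degree g = 0 \<or> Polynomial.degree h = 0)"

text \<open>
  The product of the distinct monic irreducible factors.  Irreducibility refers to \<open>K\<close> and not to the ambient field: for
  inseparable polynomials the two square-free parts differ.
\<close>

definition sqfr :: "'k::field set \<Rightarrow> 'k poly \<Rightarrow> 'k poly" where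
  "sqfr K p = \<Prod>{g. Polynomial.lead_coeff g = 1 \<and> irreducible_over K g \<and> dvd_over K g p}"

text \<open>
  ``Below and to the right'' of position \<open>(i,i)\<close> is the whole trailing block, including row \<open>i\<close>
  and column \<open>i\<close>; in particular the trailing block of a zero diagonal entry is zero.
\<close>

definition triangular_smith_form :: "'k::field set \<Rightarrow> 'k poly mat \<Rightarrow> bool" where
  "triangular_smith_form K H \<longleftrightarrow>
     (\<forall>i<dim_row H. \<forall>j<dim_col H. poly_over K (H $$ (i, j))) \<and>
     (\<forall>i<dim_row H. \<forall>j<dim_col H. j < i \<longrightarrow> H $$ (i, j) = 0) \<and>
     (\<forall>i<min (dim_row H) (dim_col H). H $$ (i, i) \<noteq> 0 \<longrightarrow>
        Polynomial.lead_coeff (H $$ (i, i)) = 1 \<and>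
        (\<forall>k<dim_row H. k \<noteq> i \<longrightarrow>
           H $$ (k, i) = 0 \<or> Polynomial.degree (H $$ (k, i)) < Polynomial.degree (H $$ (i, i)))) \<and>
     (\<forall>i<min (dim_row H) (dim_col H). \<forall>k<dim_row H. \<forall>l<dim_col H.
        i \<le> k \<and> i \<le> l \<longrightarrow> dvd_over K (H $$ (i, i)) (H $$ (k, l)))"

definition unimodular_over :: "'k::field set \<Rightarrow> 'k poly mat \<Rightarrow> bool" where
  "unimodular_over K U \<longleftrightarrow> square_mat U \<and>
     (\<forall>i<dim_row U. \<forall>j<dim_col U. poly_over K (U $$ (i, j))) \<and> det U dvd 1"


section \<open>Parameterized extensions\<close>

text \<open>
  \<open>ext_steps\<close> lists the parameters in the order of adjunction.  A step \<open>(i, None)\<close> adjoins \<open>y\<^sub>i\<close> as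
  a rational function parameter.  A step \<open>(i, Some f)\<close> adjoins it as a root of \<open>f\<close>, where the
  coefficients of \<open>f\<close> are polynomials in the earlier parameters; a polynomial over the field so far
  takes this form after scaling by a nonzero element of that field, which does not change the ideal
  it generates.  \<open>ext_gen\<close> gives the images of the parameters in the universal field.
\<close>

record (overloaded) ('y, 'a) param_ext =
  ext_steps :: "('y \<times> ('y, 'a) ypoly poly option) list"
  ext_gen :: "'y \<Rightarrow> ('y, 'a) univ"

definition gen_eval :: "('y::linorder, 'a::field) param_ext \<Rightarrow> ('y, 'a) ypoly \<Rightarrow> ('y, 'a) univ" where
  "gen_eval E p = ypoly_eval const_univ (ext_gen E) p"

definition gen_poly :: "('y::linorder, 'a::field) param_ext \<Rightarrow> ('y, 'a) yxpoly \<Rightarrow> ('y, 'a) univ poly" where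
  "gen_poly E p = map_poly (gen_eval E) p"

definition ext_field :: "('y::linorder, 'a::field) param_ext \<Rightarrow> ('y, 'a) univ set" where
  "ext_field E = adjoin const_univ (range (ext_gen E))"

definition parameterized_extension :: "('y::linorder, 'a::field) param_ext \<Rightarrow> bool" where
  "parameterized_extension E \<longleftrightarrow>
     distinct (map fst (ext_steps E)) \<and> set (map fst (ext_steps E)) = UNIV \<and>
     (\<forall>j<length (ext_steps E).
        let i = fst (ext_steps E ! j);
            V = set (map fst (take j (ext_steps E)));
            K = adjoin const_univ (ext_gen E ` V)
        in case snd (ext_steps E ! j) of
             None \<Rightarrow> (\<forall>p. poly_over K p \<and> poly p (ext_gen E i) = 0 \<longrightarrow> p = 0)
           | Some f \<Rightarrow> (\<forall>k. params (Polynomial.coeff f k) \<subseteq> V) \<and>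
               irreducible_over K (gen_poly E f) \<and> poly (gen_poly E f) (ext_gen E i) = 0)"

definition purely_transcendental :: "('y::linorder, 'a::field) param_ext \<Rightarrow> bool" where
  "purely_transcendental E \<longleftrightarrow> (\<forall>(i, f) \<in> set (ext_steps E). f = None)"

definition tower_polys :: "('y::linorder, 'a::field) param_ext \<Rightarrow> ('y, 'a) ypoly set" where
  "tower_polys E = {poly f (param_var i) |i f. (i, Some f) \<in> set (ext_steps E)}"

text \<open>
  Well-definedness of evaluation at \<open>a\<close>: polynomials representing the same element of the
  extension take the same value.
\<close>

definition compatible_point :: "('y::linorder, 'a::field) param_ext \<Rightarrow> ('y \<Rightarrow> 'a alg_closure) \<Rightarrow> bool" where
  "compatible_point E a \<longleftrightarrow> (\<forall>p. gen_eval E p = 0 \<longrightarrow> at_param a p = 0)"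

definition coeff_fraction ::
    "('y::linorder, 'a::field) param_ext \<Rightarrow> ('y, 'a) univ \<Rightarrow> ('y, 'a) ypoly \<Rightarrow> ('y, 'a) ypoly \<Rightarrow> bool" where
  "coeff_fraction E c n d \<longleftrightarrow> gen_eval E d \<noteq> 0 \<and> c = gen_eval E n / gen_eval E d"

definition is_fraction ::
    "('y::linorder, 'a::field) param_ext \<Rightarrow> ('y, 'a) univ poly fract \<Rightarrow> ('y, 'a) yxpoly \<Rightarrow> ('y, 'a) yxpoly \<Rightarrow> bool" where
  "is_fraction E q n d \<longleftrightarrow> gen_poly E d \<noteq> 0 \<and> q = Fract (gen_poly E n) (gen_poly E d)"

text \<open>
  ``All denominator factors lie in \<open>N\<close>'': the denominator divides a product of elements of \<open>N\<close>,
  where divisibility is understood in the coordinate ring, the image of \<open>F[Y]\<close> (resp. \<open>F[Y,x]\<close>)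
  in the extension.
\<close>

definition coeff_regular ::
    "('y::linorder, 'a::field) param_ext \<Rightarrow> ('y, 'a) ypoly set \<Rightarrow> ('y, 'a) univ \<Rightarrow> bool" where
  "coeff_regular E N c \<longleftrightarrow>
     (\<exists>n d e k. coeff_fraction E c n d \<and> gen_eval E (d * e) = gen_eval E ((\<Prod>N) ^ k))"

definition denominator_from ::
    "('y::linorder, 'a::field) param_ext \<Rightarrow> ('y, 'a) yxpoly set \<Rightarrow> ('y, 'a) yxpoly \<Rightarrow> bool" where
  "denominator_from E N d \<longleftrightarrow> (\<exists>e k. gen_poly E (d * e) = gen_poly E ((\<Prod>N) ^ k))"

definition eval_coeff ::
    "('y::linorder, 'a::field) param_ext \<Rightarrow> ('y \<Rightarrow> 'a alg_closure) \<Rightarrow> ('y, 'a) univ \<Rightarrow> 'a alg_closure" where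
  "eval_coeff E a c = (THE v. \<exists>n d. coeff_fraction E c n d \<and> at_param a d \<noteq> 0 \<and>
     v = at_param a n / at_param a d)"

definition eval_poly_Y ::
    "('y::linorder, 'a::field) param_ext \<Rightarrow> ('y \<Rightarrow> 'a alg_closure) \<Rightarrow> ('y, 'a) univ poly \<Rightarrow> 'a alg_closure poly" where
  "eval_poly_Y E a p = map_poly (eval_coeff E a) p"

definition eval_fract ::
    "('y::linorder, 'a::field) param_ext \<Rightarrow> ('y \<Rightarrow> 'a alg_closure) \<Rightarrow> 'a alg_closure \<Rightarrow>
     ('y, 'a) univ poly fract \<Rightarrow> 'a alg_closure" where
  "eval_fract E a \<xi> q = (THE v. \<exists>n d. is_fraction E q n d \<and> at_point a \<xi> d \<noteq> 0 \<and>
     v = at_point a \<xi> n / at_point a \<xi> d)"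


section \<open>Numerators and denominators\<close>

text \<open>
  Over a purely transcendental extension numerator and denominator are coprime in \<open>F[Y,x]\<close>, which
  determines them up to units.  Over an algebraic extension the coordinate ring need not be
  factorial and lowest terms are not determined; any representative is admitted whose denominator
  is invertible once the nonvanishing set \<open>N\<close> at hand is inverted.
\<close>

definition admissible_fraction ::
    "('y::linorder, 'a::field) param_ext \<Rightarrow> ('y, 'a) yxpoly set \<Rightarrow> ('y, 'a) univ poly fract \<Rightarrow>
     ('y, 'a) yxpoly \<times> ('y, 'a) yxpoly \<Rightarrow> bool" where
  "admissible_fraction E N q = (\<lambda>(n, d). is_fraction E q n d \<and>
     (if purely_transcendental E then \<forall>c. c dvd n \<and> c dvd d \<longrightarrow> c dvd 1
      else denominator_from E N d))"

type_synonym ('y, 'a) fraction_choice =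
  "('y, 'a) param_ext \<Rightarrow> ('y, 'a) yxpoly set \<Rightarrow> ('y, 'a) univ poly fract \<Rightarrow> ('y, 'a) yxpoly \<times> ('y, 'a) yxpoly"

definition fraction_choice :: "('y::linorder, 'a::field) fraction_choice \<Rightarrow> bool" where
  "fraction_choice \<rho> \<longleftrightarrow>
     (\<forall>E N q. (\<exists>nd. admissible_fraction E N q nd) \<longrightarrow> admissible_fraction E N q (\<rho> E N q))"

text \<open>The least common multiple in \<open>F[Y,x]\<close>, unique up to units.\<close>

definition yx_lcm :: "('y::linorder, 'a::field) yxpoly set \<Rightarrow> ('y, 'a) yxpoly" where
  "yx_lcm D = (SOME l. (\<forall>d\<in>D. d dvd l) \<and> (\<forall>k. (\<forall>d\<in>D. d dvd k) \<longrightarrow> l dvd k))"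


section \<open>Parametric linear systems\<close>

declare [[typedef_overloaded]]

datatype ('y, 'a) pls_regime =
    Solution "('y, 'a) param_ext" "('y, 'a) univ poly fract vec" "('y, 'a) univ poly fract mat"
      "('y, 'a) yxpoly set" "('y, 'a) yxpoly set"
  | Inconsistent "('y, 'a) yxpoly set" "('y, 'a) yxpoly set"

primrec regime_set ::
    "('y, 'a::field) pls_regime \<Rightarrow> (('y \<Rightarrow> 'a alg_closure) \<times> 'a alg_closure) set" where
  "regime_set (Solution E u B N Z) = constructible N Z"
| "regime_set (Inconsistent N Z) = constructible N Z"

definition nullspace_basis :: "'k::field mat \<Rightarrow> 'k mat \<Rightarrow> bool" where
  "nullspace_basis A B \<longleftrightarrow> dim_row B = dim_col A \<and> distinct (cols B) \<and>
     Matrix_Kernel.kernel.basis (dim_col A) A (set (cols B))"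

definition entry_over ::
    "('y::linorder, 'a::field) param_ext \<Rightarrow> ('y, 'a) yxpoly set \<Rightarrow> ('y, 'a) univ poly fract \<Rightarrow> bool" where
  "entry_over E N q \<longleftrightarrow>
     (\<exists>n d. poly_over (ext_field E) n \<and> poly_over (ext_field E) d \<and> d \<noteq> 0 \<and> q = Fract n d) \<and>
     (\<exists>n d. is_fraction E q n d \<and> denominator_from E N d)"

primrec valid_pls_regime ::
    "('y::linorder, 'a::field) yxpoly mat \<Rightarrow> ('y, 'a) yxpoly vec \<Rightarrow> ('y, 'a) pls_regime \<Rightarrow> bool" where
  "valid_pls_regime A b (Solution E u B N Z) \<longleftrightarrow>
     finite N \<and> finite Z \<and>
     parameterized_extension E \<and> (\<lambda>p. [:p:]) ` tower_polys E \<subseteq> Z \<and>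
     (\<forall>(a, \<xi>) \<in> constructible N Z. compatible_point E a) \<and>
     dim_vec u = dim_col A \<and> dim_row B = dim_col A \<and>
     (\<forall>i<dim_vec u. entry_over E N (u $ i)) \<and>
     (\<forall>i<dim_row B. \<forall>j<dim_col B. entry_over E N (B $$ (i, j))) \<and>
     (\<forall>(a, \<xi>) \<in> constructible N Z.
        map_mat (at_point a \<xi>) A *\<^sub>v map_vec (eval_fract E a \<xi>) u = map_vec (at_point a \<xi>) b \<and>
        nullspace_basis (map_mat (at_point a \<xi>) A) (map_mat (eval_fract E a \<xi>) B))"
| "valid_pls_regime A b (Inconsistent N Z) \<longleftrightarrow>
     finite N \<and> finite Z \<and>
     (\<forall>(a, \<xi>) \<in> constructible N Z. \<not> (\<exists>u \<in> carrier_vec (dim_col A).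
        map_mat (at_point a \<xi>) A *\<^sub>v u = map_vec (at_point a \<xi>) b))"

definition pls_solution ::
    "('y::linorder, 'a::field) yxpoly mat \<Rightarrow> ('y, 'a) yxpoly vec \<Rightarrow>
     ('y, 'a) yxpoly set \<Rightarrow> ('y, 'a) yxpoly set \<Rightarrow> ('y, 'a) pls_regime set \<Rightarrow> bool" where
  "pls_solution A b N Z S \<longleftrightarrow>
     (\<forall>\<sigma>\<in>S. valid_pls_regime A b \<sigma>) \<and> constructible N Z \<subseteq> (\<Union>\<sigma>\<in>S. regime_set \<sigma>)"


section \<open>Comprehensive triangular Smith normal forms\<close>

record (overloaded) ('y, 'a) ts_regime =
  ts_ext :: "('y, 'a) param_ext"
  ts_U :: "('y, 'a) univ poly mat"
  ts_H :: "('y, 'a) univ poly mat"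
  ts_R :: "'a mat"
  ts_N :: "('y, 'a) ypoly set"
  ts_Z :: "('y, 'a) ypoly set"

definition valid_ts_regime ::
    "('y::linorder, 'a::field) yxpoly mat \<Rightarrow> ('y, 'a) ts_regime \<Rightarrow> bool" where
  "valid_ts_regime A t \<longleftrightarrow>
     (let E = ts_ext t; U = ts_U t; H = ts_H t; R = ts_R t; N = ts_N t; Z = ts_Z t;
          m = dim_row A; n = dim_col A in
      finite N \<and> finite Z \<and>
      parameterized_extension E \<and> tower_polys E \<subseteq> Z \<and>
      (\<forall>a \<in> constructible_Y N Z. compatible_point E a) \<and>
      U \<in> carrier_mat m m \<and> H \<in> carrier_mat m n \<and> R \<in> carrier_mat n n \<and> det R \<noteq> 0 \<and>
      (\<forall>i<m. \<forall>j<m. poly_over (ext_field E) (U $$ (i, j)) \<and>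
         (\<forall>k. coeff_regular E N (Polynomial.coeff (U $$ (i, j)) k))) \<and>
      (\<forall>i<m. \<forall>j<n. \<forall>k. coeff_regular E N (Polynomial.coeff (H $$ (i, j)) k)) \<and>
      triangular_smith_form (ext_field E) H \<and>
      U * map_mat (gen_poly E) A * map_mat (\<lambda>c. [:const_univ c:]) R = H \<and>
      (\<forall>a \<in> constructible_Y N Z.
         triangular_smith_form (adjoin to_ac (range a)) (map_mat (eval_poly_Y E a) H) \<and>
         unimodular_over (adjoin to_ac (range a)) (map_mat (eval_poly_Y E a) U) \<and>
         map_mat (eval_poly_Y E a) U * map_mat (at_params_x a) A * map_mat (\<lambda>c. [:to_ac c:]) R
           = map_mat (eval_poly_Y E a) H))"

definition ctsnf_solution ::
    "('y::linorder, 'a::field) yxpoly mat \<Rightarrow> ('y, 'a) ypoly set \<Rightarrow> ('y, 'a) ypoly set \<Rightarrow>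
     ('y, 'a) ts_regime list \<Rightarrow> bool" where
  "ctsnf_solution A N Z T \<longleftrightarrow>
     (\<forall>t \<in> set T. valid_ts_regime A t) \<and>
     constructible_Y N Z \<subseteq> (\<Union>t \<in> set T. constructible_Y (ts_N t) (ts_Z t))"


section \<open>The algorithms\<close>

definition smith_diag :: "'k::field poly mat \<Rightarrow> nat \<Rightarrow> 'k poly" where
  "smith_diag H i = (if i = 0 then 1
     else if i \<le> min (dim_row H) (dim_col H) then H $$ (i - 1, i - 1) else 0)"

definition smith_rank :: "'k::field poly mat \<Rightarrow> nat" where
  "smith_rank H = Max {i. i \<le> min (dim_row H) (dim_col H) \<and> smith_diag H i \<noteq> 0}"

definition sqfr_quotient :: "'k::field set \<Rightarrow> 'k poly mat \<Rightarrow> nat \<Rightarrow> 'k poly" where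
  "sqfr_quotient K H i = (if i < smith_rank H
     then sqfr K (smith_diag H (i + 1)) div sqfr K (smith_diag H i) else 0)"

definition smith_index_set :: "'k::field set \<Rightarrow> 'k poly mat \<Rightarrow> nat set" where
  "smith_index_set K H =
     {i. i \<le> smith_rank H \<and> (sqfr_quotient K H i = 0 \<or> Polynomial.degree (sqfr_quotient K H i) > 0)}"

definition leading_inverse :: "'k::field poly mat \<Rightarrow> nat \<Rightarrow> 'k poly fract mat" where
  "leading_inverse H r = the (mat_inverse (mat r r (\<lambda>(i, j). to_fract (H $$ (i, j)))))"

definition particular_solution :: "'k::field poly mat \<Rightarrow> 'k poly vec \<Rightarrow> nat \<Rightarrow> 'k poly fract vec" where
  "particular_solution H b r =
     (leading_inverse H r *\<^sub>v vec r (\<lambda>i. to_fract (b $ i))) @\<^sub>v 0\<^sub>v (dim_col H - r)"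

definition kernel_matrix :: "'k::field poly mat \<Rightarrow> nat \<Rightarrow> 'k poly fract mat" where
  "kernel_matrix H r =
     (- (leading_inverse H r * mat r (dim_col H - r) (\<lambda>(i, j). to_fract (H $$ (i, j + r)))))
       @\<^sub>r 1\<^sub>m (dim_col H - r)"

definition triangular_smith_pls ::
    "('y::linorder, 'a::field) fraction_choice \<Rightarrow> ('y, 'a) param_ext \<Rightarrow>
     ('y, 'a) univ poly mat \<Rightarrow> ('y, 'a) univ poly vec \<Rightarrow>
     ('y, 'a) yxpoly set \<Rightarrow> ('y, 'a) yxpoly set \<Rightarrow> ('y, 'a) pls_regime set" where
  "triangular_smith_pls \<rho> E H b N Z =
     (\<Union>r \<in> smith_index_set (ext_field E) H.
        let m = dim_row H;
            s = smith_diag H r;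
            f = sqfr_quotient (ext_field E) H r;
            num = (\<lambda>q. fst (\<rho> E N (to_fract q)));
            den = (\<lambda>q. snd (\<rho> E N (to_fract q)));
            u = particular_solution H b r;
            B = kernel_matrix H r;
            N\<^sub>s = N \<union> {num s, den s};
            den_u = yx_lcm ((\<lambda>q. snd (\<rho> E N\<^sub>s q)) ` set\<^sub>v u);
            den_B = yx_lcm ((\<lambda>q. snd (\<rho> E N\<^sub>s q)) ` elements_mat B);
            J = {r..<m}
        in insert
             (Solution E u B
                (N\<^sub>s \<union> {den_u, den_B, den f} \<union> (\<lambda>j. den (b $ j)) ` J)
                (Z \<union> {num f} \<union> (\<lambda>j. num (b $ j)) ` J))
             ((\<lambda>j. Inconsistent
                (N\<^sub>s \<union> {num (b $ j), den (b $ j), den f})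
                (Z \<union> {num f})) ` J))"

primrec change_coordinates :: "'a mat \<Rightarrow> ('y::linorder, 'a::field) pls_regime \<Rightarrow> ('y, 'a) pls_regime" where
  "change_coordinates R (Solution E w C N Z) =
     (let R' = map_mat (\<lambda>c. to_fract [:const_univ c:]) R in Solution E (R' *\<^sub>v w) (R' * C) N Z)"
| "change_coordinates R (Inconsistent N Z) = Inconsistent N Z"

definition Y_part :: "('y, 'a::zero) yxpoly set \<Rightarrow> ('y, 'a) ypoly set" where
  "Y_part S = {p. [:p:] \<in> S}"

definition x_part :: "('y, 'a::zero) yxpoly set \<Rightarrow> ('y, 'a) yxpoly set" where
  "x_part S = S - range (\<lambda>p. [:p:])"

text \<open>\<open>T\<close> is the triangular Smith decomposition of \<open>(A, Y_part N, Y_part Z)\<close> obtained in step 2.\<close>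

definition pls_via_ctsnf ::
    "('y::linorder, 'a::field) fraction_choice \<Rightarrow> ('y, 'a) ts_regime list \<Rightarrow> ('y, 'a) yxpoly vec \<Rightarrow>
     ('y, 'a) yxpoly set \<Rightarrow> ('y, 'a) yxpoly set \<Rightarrow> ('y, 'a) pls_regime set" where
  "pls_via_ctsnf \<rho> T b N Z =
     (\<Union>t \<in> set T. change_coordinates (ts_R t) `
        triangular_smith_pls \<rho> (ts_ext t) (ts_H t)
          (ts_U t *\<^sub>v map_vec (gen_poly (ts_ext t)) b)
          ((\<lambda>p. [:p:]) ` ts_N t \<union> x_part N) ((\<lambda>p. [:p:]) ` ts_Z t \<union> x_part Z))"

text \<open>
  The denominators of the quotients \<open>f\<^sub>i\<close> belong to the nonvanishing set.  Over a purely transcendental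
  extension this follows from the denominators of \<open>H\<close> being there, since a monic factor of a monic
  polynomial over an integrally closed domain has its coefficients in that domain.  Over an
  algebraic extension the coordinate ring need not be integrally closed: with \<open>y\<^sup>2 = t\<^sup>3\<close>,
  the polynomial \<open>x\<^sup>3 - 3tx + 2y\<close> has the square-free part \<open>x\<^sup>2 + (y/t)x - 2t\<close>, which cannot be
  evaluated at \<open>t = y = 0\<close>, so that the regimes computed from the matrix with this single entry do not
  cover the point with all coordinates zero.  There the condition is a genuine requirement.
\<close>

definition quotient_denominators_adjoined :: "('y::linorder, 'a::field) ts_regime \<Rightarrow> bool" where
  "quotient_denominators_adjoined t \<longleftrightarrow>
     (\<forall>i<smith_rank (ts_H t). \<forall>k. coeff_regular (ts_ext t) (ts_N t)
        (Polynomial.coeff (sqfr_quotient (ext_field (ts_ext t)) (ts_H t) i) k))"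

end

theory Submission
  imports Defs "Jordan_Normal_Form.Char_Poly" "Jordan_Normal_Form.DL_Rank"
begin

text \<open>
  Let \<open>s\<^sub>1, s\<^sub>2, \<dots>\<close> be the diagonal of \<open>H\<close>.  At a point, take the largest \<open>r\<close> with \<open>s\<^sub>r \<noteq> 0\<close>.  Since
  \<open>s\<^sub>r\<^sub>+\<^sub>1\<close> divides the whole trailing block, \<open>H\<close> specialises to an invertible triangular block \<open>H\<^sub>r\<close>
  above zero rows, so that the solutions and the obstructions can be read off.  The stratum \<open>s\<^sub>r \<noteq> 0 = s\<^sub>r\<^sub>+\<^sub>1\<close> is cut out
  by \<open>s\<^sub>r \<noteq> 0\<close> and \<open>f\<^sub>r = 0\<close>, because a polynomial and its square-free part have the same zeros.

  All this happens in the ring of fractions whose denominators divide a power of the product of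
  the nonvanishing set; evaluation is a ring homomorphism there, and \<open>1/s\<^sub>r\<close>, hence \<open>H\<^sub>r\<^sup>-\<^sup>1\<close>, belongs to it.
  Adjoining denominators therefore loses no point, provided that fractions in lowest terms have
  no further denominator factors, which over a purely transcendental extension follows from unique
  factorisation in \<open>F[Y,x]\<close>.
\<close>


hide_const (open) Polynomials.lead_coeff Polynomials.degree up_ring.coeff up_ring.monom

section \<open>Factorial subrings\<close>

text \<open>All divisibilities among the diagonal entries, their square-free parts and the quotients
  \<open>f i\<close> are statements over the extension field, whose elements need not have a value
  at a given point. They survive specialisation because the divisors are monic: dividing by a monic
  polynomial inverts nothing, so the cofactor keeps its coefficients in the subring that can be
  evaluated. Two facts escape this argument: that the \<open>f i\<close> themselves have
  coefficients in this subring, and that numerators and denominators bring in no new denominators.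
  In the purely transcendental case both rest on unique factorisation; in the algebraic case the
  first is a hypothesis and the second is part of \<open>admissible_fraction\<close>. The rings in
  question (\<open>F[V]\<close> for a set \<open>V\<close> of parameters, \<open>K[x]\<close> for a
  subfield \<open>K\<close>) are subsets of fixed types. Divisibility, irreducibility and
  factoriality are therefore taken relative to a carrier set, and one theorem,
  \<open>factorial_polys_over\<close>, serves both for adding a parameter or \<open>x\<close> and
  for polynomials over \<open>K\<close>.\<close>

definition is_subring :: "'b::comm_ring_1 set \<Rightarrow> bool" where
  "is_subring S \<longleftrightarrow> 0 \<in> S \<and> 1 \<in> S \<and> (\<forall>x\<in>S. - x \<in> S) \<and> (\<forall>x\<in>S. \<forall>y\<in>S. x + y \<in> S \<and> x * y \<in> S)"

definition polys_over :: "'b::comm_ring_1 set \<Rightarrow> 'b poly set" where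
  "polys_over S = {p. \<forall>i. coeff p i \<in> S}"

definition dvd_in :: "'b::comm_ring_1 set \<Rightarrow> 'b \<Rightarrow> 'b \<Rightarrow> bool" where
  "dvd_in S a b \<longleftrightarrow> (\<exists>c\<in>S. b = a * c)"

definition irreducible_in :: "'b::comm_ring_1 set \<Rightarrow> 'b \<Rightarrow> bool" where
  "irreducible_in S p \<longleftrightarrow> p \<in> S \<and> p \<noteq> 0 \<and> \<not> dvd_in S p 1 \<and>
     (\<forall>a\<in>S. \<forall>b\<in>S. p = a * b \<longrightarrow> dvd_in S a 1 \<or> dvd_in S b 1)"

text \<open>
  The additive norm \<open>\<delta>\<close> (for instance the number of irreducible factors) replaces the chain
  condition: it makes factorisation into irreducibles terminate.
\<close>

definition factorial_subring :: "'b::idom set \<Rightarrow> bool" where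
  "factorial_subring S \<longleftrightarrow> is_subring S \<and>
     (\<exists>\<delta>::'b \<Rightarrow> nat. (\<forall>a\<in>S - {0}. \<forall>b\<in>S - {0}. \<delta> (a * b) = \<delta> a + \<delta> b) \<and>
        (\<forall>a\<in>S - {0}. \<delta> a = 0 \<longrightarrow> dvd_in S a 1)) \<and>
     (\<forall>p a b. irreducible_in S p \<longrightarrow> a \<in> S \<longrightarrow> b \<in> S \<longrightarrow> dvd_in S p (a * b) \<longrightarrow>
        dvd_in S p a \<or> dvd_in S p b)"

lemma is_subringD:
  assumes "is_subring S"
  shows "0 \<in> S" "1 \<in> S" "x \<in> S \<Longrightarrow> - x \<in> S" "x \<in> S \<Longrightarrow> y \<in> S \<Longrightarrow> x + y \<in> S"
    "x \<in> S \<Longrightarrow> y \<in> S \<Longrightarrow> x - y \<in> S" "x \<in> S \<Longrightarrow> y \<in> S \<Longrightarrow> x * y \<in> S"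
    "x \<in> S \<Longrightarrow> x ^ n \<in> S"
proof -
  show "x \<in> S \<Longrightarrow> y \<in> S \<Longrightarrow> x - y \<in> S"
    using assms unfolding is_subring_def by (metis diff_conv_add_uminus)
  show "x \<in> S \<Longrightarrow> x ^ n \<in> S"
    using assms unfolding is_subring_def by (induction n) auto
qed (use assms in \<open>auto simp: is_subring_def\<close>)

lemma is_subring_sum:
  assumes "is_subring S" and "\<And>i. i \<in> I \<Longrightarrow> f i \<in> S"
  shows "sum f I \<in> S"
  using assms(2) by (induction I rule: infinite_finite_induct) (auto simp: is_subringD[OF assms(1)])

lemma is_subring_prod:
  assumes "is_subring S" and "\<And>i. i \<in> I \<Longrightarrow> f i \<in> S"
  shows "prod f I \<in> S"
  using assms(2) by (induction I rule: infinite_finite_induct) (auto simp: is_subringD[OF assms(1)])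

lemma polys_over_const_iff [simp]: "is_subring S \<Longrightarrow> [:c:] \<in> polys_over S \<longleftrightarrow> c \<in> S"
  by (auto simp: polys_over_def coeff_pCons is_subringD split: nat.splits)

lemma polys_over_monom: "is_subring S \<Longrightarrow> c \<in> S \<Longrightarrow> monom c n \<in> polys_over S"
  by (auto simp: polys_over_def is_subringD)

lemma polys_over_smult:
  "is_subring S \<Longrightarrow> c \<in> S \<Longrightarrow> p \<in> polys_over S \<Longrightarrow> smult c p \<in> polys_over S"
  by (auto simp: polys_over_def is_subringD)

lemma polys_over_coeff: "p \<in> polys_over S \<Longrightarrow> coeff p i \<in> S"
  by (auto simp: polys_over_def)

lemma is_subring_polys_over:
  assumes S: "is_subring S"
  shows "is_subring (polys_over S)"
  unfolding is_subring_def
proof (intro conjI ballI)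
  have "[:1:] \<in> polys_over S" using S is_subringD(2) polys_over_const_iff by blast
  then show "1 \<in> polys_over S" by (simp add: one_pCons)
qed (auto simp: polys_over_def coeff_mult is_subringD[OF S] intro!: is_subring_sum[OF S])

lemma dvd_in_add:
  assumes "is_subring S" "dvd_in S a b" "dvd_in S a c"
  shows "dvd_in S a (b + c)"
  using assms unfolding dvd_in_def by (metis distrib_left is_subringD(4))

lemma dvd_in_mult:
  assumes "is_subring S" "dvd_in S a b" "c \<in> S"
  shows "dvd_in S a (b * c)"
  using assms unfolding dvd_in_def by (metis mult.assoc is_subringD(6))

lemma dvd_in_UNIV: "dvd_in UNIV a b \<longleftrightarrow> a dvd b"
  by (auto simp: dvd_in_def dvd_def)

text \<open>An element that is neither a unit nor irreducible splits into two nonunits; these have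
  positive norm, so by additivity both have smaller norm than their product. The rule takes the
  place of an explicit list of prime factors, and its irreducible case delivers primality along with
  irreducibility.\<close>

lemma factorial_subring_induct [consumes 3, case_names unit irreducible mult]:
  assumes S: "factorial_subring S" and "c \<in> S" "c \<noteq> 0"
    and unit: "\<And>u v. u \<in> S \<Longrightarrow> v \<in> S \<Longrightarrow> u * v = 1 \<Longrightarrow> P u"
    and irred: "\<And>p. irreducible_in S p \<Longrightarrow>
      (\<And>a b. a \<in> S \<Longrightarrow> b \<in> S \<Longrightarrow> dvd_in S p (a * b) \<Longrightarrow> dvd_in S p a \<or> dvd_in S p b) \<Longrightarrow> P p"
    and mult: "\<And>a b. a \<in> S \<Longrightarrow> b \<in> S \<Longrightarrow> a \<noteq> 0 \<Longrightarrow> b \<noteq> 0 \<Longrightarrow> P a \<Longrightarrow> P b \<Longrightarrow> P (a * b)"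
  shows "P c"
proof -
  obtain \<delta> :: "'a \<Rightarrow> nat" where add: "\<And>a b. a \<in> S - {0} \<Longrightarrow> b \<in> S - {0} \<Longrightarrow> \<delta> (a * b) = \<delta> a + \<delta> b"
    and zero: "\<And>a. a \<in> S - {0} \<Longrightarrow> \<delta> a = 0 \<Longrightarrow> dvd_in S a 1"
    using S unfolding factorial_subring_def by blast
  show ?thesis
    using \<open>c \<in> S\<close> \<open>c \<noteq> 0\<close>
  proof (induction "\<delta> c" arbitrary: c rule: less_induct)
    case less
    consider "dvd_in S c 1" | "irreducible_in S c"
      | a b where "a \<in> S" "b \<in> S" "c = a * b" "\<not> dvd_in S a 1" "\<not> dvd_in S b 1"
      using less.prems unfolding irreducible_in_def by blast
    then show ?case
    proof cases
      case 1
      then show ?thesis using unit less.prems unfolding dvd_in_def by metis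
    next
      case 2
      then show ?thesis using irred S unfolding factorial_subring_def by blast
    next
      case 3
      then have nz: "a \<in> S - {0}" "b \<in> S - {0}" using less.prems by auto
      then have "\<delta> a \<noteq> 0" "\<delta> b \<noteq> 0" using zero 3 by blast+
      then have "\<delta> a < \<delta> c" "\<delta> b < \<delta> c" using add[OF nz] 3 by auto
      then show ?thesis using less.hyps mult nz 3 by auto
    qed
  qed
qed

text \<open>Every nonzero element is a unit, so there are no irreducibles, primality holds vacuously
  and the zero norm is additive.\<close>

lemma factorial_subring_field:
  assumes "is_subring S" and "\<And>x. x \<in> S \<Longrightarrow> x \<noteq> 0 \<Longrightarrow> dvd_in S x 1"
  shows "factorial_subring S"
proof -
  have "\<not> irreducible_in S p" for p using assms(2) by (auto simp: irreducible_in_def)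
  then show ?thesis unfolding factorial_subring_def
    using assms by (intro conjI exI[of _ "\<lambda>_. 0"]) auto
qed

text \<open>The map only has to respect the operations on the carrier. It will identify polynomials
  in one variable over \<open>F[V]\<close> with \<open>F[insert i V]\<close>; the norm is carried
  over by composing with the inverse \<open>\<psi>\<close>.\<close>

lemma factorial_subring_iso:
  fixes \<phi> :: "'b::idom \<Rightarrow> 'c::idom"
  assumes S: "factorial_subring S" and bij: "bij_betw \<phi> S S'"
    and one: "\<phi> 1 = 1"
    and plus: "\<And>x y. x \<in> S \<Longrightarrow> y \<in> S \<Longrightarrow> \<phi> (x + y) = \<phi> x + \<phi> y"
    and times: "\<And>x y. x \<in> S \<Longrightarrow> y \<in> S \<Longrightarrow> \<phi> (x * y) = \<phi> x * \<phi> y"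
  shows "factorial_subring S'"
proof -
  define \<psi> where "\<psi> = inv_into S \<phi>"
  have sub: "is_subring S" using S by (simp add: factorial_subring_def)
  note subD = is_subringD[OF sub]
  have zero: "\<phi> 0 = 0"
    using plus[OF subD(1) subD(1)] by (simp only: add_0_left add_cancel_right_right)
  have minus: "\<phi> (- x) = - \<phi> x" if "x \<in> S" for x
    using plus[OF that subD(3)[OF that]] zero by (simp add: eq_neg_iff_add_eq_0 add.commute)
  have img: "S' = \<phi> ` S" and inj: "inj_on \<phi> S" using bij by (auto simp: bij_betw_def)
  have \<psi>: "\<psi> (\<phi> x) = x" if "x \<in> S" for x using inj that by (simp add: \<psi>_def)
  have dvd: "dvd_in S' (\<phi> x) (\<phi> y) \<longleftrightarrow> dvd_in S x y" if "x \<in> S" "y \<in> S" for x y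
  proof
    assume "dvd_in S' (\<phi> x) (\<phi> y)"
    then obtain c where "c \<in> S" "\<phi> y = \<phi> x * \<phi> c"
      unfolding dvd_in_def img by blast
    then have "c \<in> S" "\<phi> y = \<phi> (x * c)" using times that by simp_all
    then show "dvd_in S x y" unfolding dvd_in_def
      using inj that subD by (metis inj_onD)
  qed (use times that in \<open>auto simp: dvd_in_def img\<close>)
  have sub': "is_subring S'"
    unfolding is_subring_def img
    using subD zero one minus plus times
    by (auto simp: image_iff) metis+
  obtain \<delta> :: "'b \<Rightarrow> nat" where add: "\<And>a b. a \<in> S - {0} \<Longrightarrow> b \<in> S - {0} \<Longrightarrow> \<delta> (a * b) = \<delta> a + \<delta> b"
    and unit: "\<And>a. a \<in> S - {0} \<Longrightarrow> \<delta> a = 0 \<Longrightarrow> dvd_in S a 1"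
    using S unfolding factorial_subring_def by blast
  have nz: "\<phi> x \<noteq> 0" if "x \<in> S" "x \<noteq> 0" for x using that inj zero subD(1) by (metis inj_onD)
  have irr: "irreducible_in S x" if "x \<in> S" "irreducible_in S' (\<phi> x)" for x
    unfolding irreducible_in_def
  proof (intro conjI ballI impI)
    show "x \<noteq> 0" using that zero by (auto simp: irreducible_in_def)
    show "\<not> dvd_in S x 1" using that dvd[OF that(1) subD(2)] one by (auto simp: irreducible_in_def)
    fix a b assume ab: "a \<in> S" "b \<in> S" "x = a * b"
    then have "dvd_in S' (\<phi> a) (\<phi> 1) \<or> dvd_in S' (\<phi> b) (\<phi> 1)"
      using that(2) times[of a b] one unfolding irreducible_in_def img by auto
    then show "dvd_in S a 1 \<or> dvd_in S b 1" using dvd ab subD by blast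
  qed (use that in auto)
  have prime: "dvd_in S' p a \<or> dvd_in S' p b"
    if h: "irreducible_in S' p" "a \<in> S'" "b \<in> S'" "dvd_in S' p (a * b)" for p a b
  proof -
    have "p \<in> S'" using h by (auto simp: irreducible_in_def)
    then obtain p0 a0 b0 where 0: "p0 \<in> S" "a0 \<in> S" "b0 \<in> S" "p = \<phi> p0" "a = \<phi> a0" "b = \<phi> b0"
      using h(2,3) unfolding img by auto
    then have "dvd_in S p0 (a0 * b0)" using h(4) dvd[of p0 "a0 * b0"] times subD by metis
    then have "dvd_in S p0 a0 \<or> dvd_in S p0 b0"
      using S irr[of p0] h(1) 0 unfolding factorial_subring_def by blast
    then show ?thesis using dvd 0 by blast
  qed
  show ?thesis unfolding factorial_subring_def
  proof (intro conjI exI[of _ "\<lambda>x. \<delta> (\<psi> x)"] ballI impI allI)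
    fix a b assume "a \<in> S' - {0}" "b \<in> S' - {0}"
    then obtain a0 b0 where 0: "a0 \<in> S - {0}" "b0 \<in> S - {0}" "a = \<phi> a0" "b = \<phi> b0"
      using zero unfolding img by auto
    then have "a * b = \<phi> (a0 * b0)" using times by auto
    then show "\<delta> (\<psi> (a * b)) = \<delta> (\<psi> a) + \<delta> (\<psi> b)"
      using add[OF 0(1,2)] 0 \<psi> subD by auto
  next
    fix a assume "a \<in> S' - {0}" "\<delta> (\<psi> a) = 0"
    moreover from this obtain a0 where 0: "a0 \<in> S - {0}" "a = \<phi> a0"
      using zero unfolding img by auto
    ultimately have "\<delta> a0 = 0" using \<psi> by auto
    then show "dvd_in S' a 1" using 0 unit dvd[of a0 1] one subD by auto
  qed (use sub' prime in auto)
qed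

text \<open>The length of the coefficient list is 0 for the zero polynomial and degree plus one
  otherwise. As a measure it decreases even when a constant is reduced to zero, where the degree
  does not.\<close>

lemma length_coeffs_diff_monom:
  fixes f :: "'b::ab_group_add poly"
  assumes "f \<noteq> 0"
  shows "length (coeffs (f - monom (lead_coeff f) (degree f))) < length (coeffs f)"
proof -
  let ?g = "f - monom (lead_coeff f) (degree f)"
  have "?g = 0 \<or> degree ?g < degree f"
    by (rule eq_zero_or_degree_less[OF Polynomial.degree_diff_le[OF order_refl degree_monom_le]]) simp
  then show ?thesis using assms by (cases "?g = 0") (auto simp: length_coeffs_degree)
qed

section \<open>Gauss: polynomials over a factorial ring form a factorial ring\<close>

context
  fixes S :: "'b::idom set"
  assumes S: "factorial_subring S"
begin

private abbreviation "P \<equiv> polys_over S"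

private lemma subS: "is_subring S"
  using S by (simp add: factorial_subring_def)

private lemma subP: "is_subring P"
  by (rule is_subring_polys_over[OF subS])

private lemmas SD = is_subringD[OF subS]
private lemmas PD = is_subringD[OF subP]

text \<open>If the constant divides \<open>f * g\<close>, it divides the product of the leading
  coefficients and hence one of them. The corresponding leading term is then divisible and can be
  subtracted from its factor; the induction is on the joint length of both factors.\<close>

lemma irreducible_const_prime:
  assumes p: "irreducible_in S \<pi>"
  shows "f \<in> P \<Longrightarrow> g \<in> P \<Longrightarrow> dvd_in P [:\<pi>:] (f * g) \<Longrightarrow>
    dvd_in P [:\<pi>:] f \<or> dvd_in P [:\<pi>:] g"
proof (induction "length (coeffs f) + length (coeffs g)" arbitrary: f g rule: less_induct)
  case less
  \<comment> \<open>Stated for arbitrary \<open>f\<close> and \<open>g\<close>, so that it applies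
    with the roles exchanged when the leading coefficient of the second factor is the divisible
    one.\<close>
  have step: "dvd_in P [:\<pi>:] f \<or> dvd_in P [:\<pi>:] g"
    if fg: "f \<in> P" "g \<in> P" "f \<noteq> 0" "dvd_in P [:\<pi>:] (f * g)"
      and d: "dvd_in S \<pi> (lead_coeff f)"
      and IH: "\<And>f'. f' \<in> P \<Longrightarrow> length (coeffs f') < length (coeffs f) \<Longrightarrow>
        dvd_in P [:\<pi>:] (f' * g) \<Longrightarrow>
        dvd_in P [:\<pi>:] f' \<or> dvd_in P [:\<pi>:] g" for f g
  proof -
    let ?m = "monom (lead_coeff f) (degree f)"
    have mP: "?m \<in> P"
      using fg(1) by (intro polys_over_monom subS polys_over_coeff)
    obtain e where e: "e \<in> S" "lead_coeff f = \<pi> * e" using d by (auto simp: dvd_in_def)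
    have m: "dvd_in P [:\<pi>:] ?m"
      unfolding dvd_in_def e
      by (intro bexI[of _ "monom e (degree f)"])
        (auto simp: smult_monom e intro: polys_over_monom subS)
    have "dvd_in P [:\<pi>:] (f * g + ?m * (- g))"
      using dvd_in_add[OF subP fg(4)] dvd_in_mult[OF subP m] PD(3) fg(2) by blast
    then have "dvd_in P [:\<pi>:] ((f - ?m) * g)" by (simp add: algebra_simps)
    then have "dvd_in P [:\<pi>:] (f - ?m) \<or> dvd_in P [:\<pi>:] g"
      using IH[of "f - ?m"] length_coeffs_diff_monom[OF fg(3)] PD(5)[OF fg(1) mP] by blast
    then show ?thesis
      using dvd_in_add[OF subP _ m, of "f - ?m"] by auto
  qed
  show ?case
  proof (cases "f = 0 \<or> g = 0")
    case True
    then show ?thesis using PD(1) unfolding dvd_in_def by force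
  next
    case False
    obtain k where k: "k \<in> P" "f * g = [:\<pi>:] * k" using less.prems by (auto simp: dvd_in_def)
    have "lead_coeff f * lead_coeff g = \<pi> * coeff k (degree (f * g))"
      using k(2) by (metis lead_coeff_mult coeff_smult mult_pCons_left mult_zero_left add.right_neutral pCons_0_0)
    then have "dvd_in S \<pi> (lead_coeff f * lead_coeff g)"
      using polys_over_coeff[OF k(1)] by (auto simp: dvd_in_def)
    then have "dvd_in S \<pi> (lead_coeff f) \<or> dvd_in S \<pi> (lead_coeff g)"
      using S p less.prems polys_over_coeff unfolding factorial_subring_def by blast
    then show ?thesis
    proof
      assume "dvd_in S \<pi> (lead_coeff f)"
      then show ?thesis using step[of f g] less False by auto
    next
      assume "dvd_in S \<pi> (lead_coeff g)"
      moreover have "dvd_in P [:\<pi>:] (g * f)" using less.prems by (simp add: mult.commute)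
      moreover have "dvd_in P [:\<pi>:] f' \<or> dvd_in P [:\<pi>:] f"
        if "f' \<in> P" "length (coeffs f') < length (coeffs g)"
          "dvd_in P [:\<pi>:] (f' * f)" for f'
        using less.hyps[of f f'] that less.prems by (auto simp: mult.commute)
      ultimately show ?thesis using step[of g f] less.prems False by blast
    qed
  qed
qed

private abbreviation "distributes f q d \<equiv>
  \<exists>a\<in>S. \<exists>b\<in>S. \<exists>q'\<in>P. \<exists>d'\<in>P. q = [:a:] * q' \<and> d = [:b:] * d' \<and> f = q' * d'"

text \<open>Each irreducible factor of \<open>c\<close> divides \<open>q\<close> or \<open>d\<close>
  by \<open>irreducible_const_prime\<close> and is cancelled there; the constants \<open>a\<close>
  and \<open>b\<close> collect what was taken out on either side. This does the work of contents and
  primitive parts.\<close>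

lemma distribute_const_factor:
  assumes "c \<in> S" "c \<noteq> 0"
  shows "\<forall>f\<in>P. \<forall>q\<in>P. \<forall>d\<in>P. [:c:] * f = q * d \<longrightarrow>
    distributes f q d"
  using S assms
proof (induction rule: factorial_subring_induct)
  case (unit u v)
  show ?case
  proof (intro ballI impI)
    fix f q d assume P: "f \<in> P" "q \<in> P" "d \<in> P" and eq: "[:u:] * f = q * d"
    have uv: "[:u:] * [:v:] = 1" using unit by (simp add: one_pCons mult.commute)
    have "f = [:u:] * [:v:] * f" unfolding uv by simp
    also have "\<dots> = [:v:] * ([:u:] * f)" by (simp only: mult_ac)
    finally have "f = ([:v:] * q) * d" unfolding eq by (simp only: mult_ac)
    moreover have "q = [:u:] * ([:v:] * q)" unfolding mult.assoc[symmetric] uv by simp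
    moreover have "[:v:] * q \<in> P"
      using polys_over_smult[OF subS] P unit by simp
    moreover have "d = [:1:] * d" by simp
    ultimately show "distributes f q d"
      using unit(1) SD(2) P by blast
  qed
next
  case (irreducible p)
  show ?case
  proof (intro ballI impI)
    fix f q d assume P: "f \<in> P" "q \<in> P" "d \<in> P" and eq: "[:p:] * f = q * d"
    have p: "p \<in> S" "p \<noteq> 0" using irreducible(1) by (auto simp: irreducible_in_def)
    have "dvd_in P [:p:] (q * d)" using eq[symmetric] P unfolding dvd_in_def by blast
    then consider "dvd_in P [:p:] q" | "dvd_in P [:p:] d"
      using irreducible_const_prime[OF irreducible(1)] P by blast
    then show "distributes f q d"
    proof cases
      case 1
      then obtain k where k: "k \<in> P" "q = [:p:] * k" by (auto simp: dvd_in_def)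
      then have "[:p:] * f = [:p:] * (k * d)" using eq by (simp only: mult_ac)
      then have "f = k * d" using p by (metis mult_cancel_left pCons_eq_0_iff)
      moreover have "d = [:1:] * d" by simp
      ultimately show ?thesis using k p SD(2) P by blast
    next
      case 2
      then obtain k where k: "k \<in> P" "d = [:p:] * k" by (auto simp: dvd_in_def)
      then have "[:p:] * f = [:p:] * (q * k)" using eq by (simp only: mult_ac)
      then have "f = q * k" using p by (metis mult_cancel_left pCons_eq_0_iff)
      moreover have "q = [:1:] * q" by simp
      ultimately show ?thesis using k p SD(2) P by blast
    qed
  qed
next
  case (mult x y)
  show ?case
  proof (intro ballI impI)
    fix f q d assume P: "f \<in> P" "q \<in> P" "d \<in> P" and eq: "[:x * y:] * f = q * d"
    have "[:x:] * ([:y:] * f) = q * d" using eq by (simp add: mult.commute)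
    moreover have "[:y:] * f \<in> P"
      using polys_over_smult[OF subS] P mult by simp
    ultimately obtain a b q1 d1 where 1: "a \<in> S" "b \<in> S" "q1 \<in> P" "d1 \<in> P"
      "q = [:a:] * q1" "d = [:b:] * d1" "[:y:] * f = q1 * d1"
      using mult.IH(1) P by blast
    then obtain a' b' q2 d2 where 2: "a' \<in> S" "b' \<in> S" "q2 \<in> P" "d2 \<in> P"
      "q1 = [:a':] * q2" "d1 = [:b':] * d2" "f = q2 * d2"
      using mult.IH(2) P by blast
    have "q = [:a * a':] * q2" "d = [:b * b':] * d2" using 1 2 by (simp_all add: mult.commute)
    then show "distributes f q d"
      using 1 2 SD(6) by blast
  qed
qed

text \<open>The leading coefficient of \<open>d\<close> cannot be inverted in \<open>S\<close>, so
  each division step multiplies by it instead; \<open>c\<close> is the accumulated power. Comparing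
  lengths rather than degrees forces the remainder to be zero when the divisor is constant.\<close>

lemma pseudo_division_in:
  assumes d: "d \<in> P" "d \<noteq> 0"
  shows "f \<in> P \<Longrightarrow> \<exists>c\<in>S - {0}. \<exists>q\<in>P. \<exists>r\<in>P.
    [:c:] * f = q * d + r \<and> length (coeffs r) < length (coeffs d)"
proof (induction "length (coeffs f)" arbitrary: f rule: less_induct)
  case less
  show ?case
  proof (cases "length (coeffs f) < length (coeffs d)")
    case True
    have "[:1:] * f = 0 * d + f" by simp
    then show ?thesis using True less.prems PD(1) SD(2) by (metis Diff_iff singletonD zero_neq_one)
  next
    case False
    then have f0: "f \<noteq> 0" using d by (auto simp: length_coeffs)
    let ?m = "monom (lead_coeff f) (degree f - degree d)"
    let ?l = "lead_coeff d"
    define f' where "f' = [:?l:] * f - ?m * d"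
    have le: "degree d \<le> degree f" using False f0 d by (auto simp: length_coeffs split: if_splits)
    have mP: "?m \<in> P" and lS: "?l \<in> S"
      using less.prems d by (auto intro!: polys_over_monom subS polys_over_coeff)
    then have lP: "[:?l:] \<in> P" using subS by simp
    have f'P: "f' \<in> P" unfolding f'_def using PD(5,6) mP lP less.prems d by blast
    have deg: "degree (?m * d) = degree f" 
      using f0 d le by (simp add: degree_mult_eq degree_monom_eq monom_eq_0_iff)
    have lc: "lead_coeff (?m * d) = lead_coeff f * ?l"
      by (simp add: lead_coeff_mult degree_monom_eq f0)
    have "f' = 0 \<or> degree f' < degree f"
    proof (rule eq_zero_or_degree_less)
      show "degree f' \<le> degree f"
        unfolding f'_def using deg by (intro degree_diff_le) auto
      show "coeff f' (degree f) = 0"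
        using lc deg unfolding f'_def by (simp add: mult.commute)
    qed
    then have "length (coeffs f') < length (coeffs f)"
      using f0 by (cases "f' = 0") (auto simp: length_coeffs_degree)
    then obtain c q r where IH: "c \<in> S - {0}" "q \<in> P" "r \<in> P"
      "[:c:] * f' = q * d + r" "length (coeffs r) < length (coeffs d)"
      using less.hyps f'P by blast
    have "[:c * ?l:] * f = [:c:] * f' + [:c:] * ?m * d" unfolding f'_def by (simp add: algebra_simps)
    also have "\<dots> = (q + [:c:] * ?m) * d + r" unfolding IH by (simp add: algebra_simps)
    finally have "[:c * ?l:] * f = (q + [:c:] * ?m) * d + r" .
    moreover have "q + [:c:] * ?m \<in> P"
      using IH mP PD(4) polys_over_smult[OF subS] by simp
    moreover have "c * ?l \<in> S - {0}" using IH(1) lS SD(6) d by auto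
    ultimately show ?thesis using IH by blast
  qed
qed

lemma unit_in_polys_over_degree:
  assumes "dvd_in P a 1"
  shows "degree a = 0"
  using assms unfolding dvd_in_def 
  by (metis add_is_0 degree_1 degree_mult_eq mult_zero_left mult_zero_right zero_neq_one)

text \<open>Distributing \<open>c\<close> over \<open>f * w\<close> removes from \<open>f\<close> a
  constant \<open>a\<close> and leaves a factor of positive degree, which is not a unit.
  Irreducibility makes \<open>a\<close> a unit, so that \<open>f\<close> itself divides
  \<open>h\<close>.\<close>

lemma irreducible_cancel_const:
  assumes f: "irreducible_in P f" "degree f > 0"
    and c: "c \<in> S" "c \<noteq> 0" and h: "h \<in> P" and dvd: "dvd_in P f ([:c:] * h)"
  shows "dvd_in P f h"
proof -
  obtain w where w: "w \<in> P" "[:c:] * h = f * w" using dvd by (auto simp: dvd_in_def)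
  have fP: "f \<in> P" using f by (simp add: irreducible_in_def)
  obtain a b f1 w1 where 1: "a \<in> S" "f1 \<in> P" "w1 \<in> P" "f = [:a:] * f1" "h = f1 * w1"
    using distribute_const_factor[OF c] h fP w by blast
  have "\<not> dvd_in P f1 1"
  proof
    assume "dvd_in P f1 1"
    then have "degree f1 = 0" by (rule unit_in_polys_over_degree)
    then have "degree f = 0" using 1 by (metis add_0 degree_mult_le degree_pCons_0 le_zero_eq)
    then show False using f by simp
  qed
  moreover have "[:a:] \<in> P" using 1 subS by simp
  ultimately have "dvd_in P [:a:] 1" using f(1) 1 unfolding irreducible_in_def by blast
  then obtain v where v: "v \<in> P" "[:a:] * v = 1" unfolding dvd_in_def by metis
  have "h = ([:a:] * v) * f1 * w1" unfolding v using 1 by simp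
  also have "\<dots> = f * (v * w1)" unfolding 1(4) by (simp only: mult_ac)
  finally show ?thesis unfolding dvd_in_def using PD(6) v 1 by blast
qed

text \<open>Bezout up to constants: a nonzero element \<open>d\<close> of least length in the ideal
  of \<open>f\<close> and \<open>g\<close> divides every element of that ideal after multiplication
  by a nonzero constant. Removing a constant from \<open>d\<close> leaves a true factor
  \<open>d1\<close> of \<open>f\<close>. By irreducibility \<open>d1\<close> is either associated
  with \<open>f\<close>, and then \<open>f\<close> divides a constant multiple of \<open>g\<close>,
  or a unit, and then the Bezout identity times \<open>h\<close> shows that \<open>f\<close> divides
  a constant multiple of \<open>h\<close>.\<close>

lemma irreducible_polys_over_prime:
  assumes f: "irreducible_in P f" "degree f > 0"
    and g: "g \<in> P" and h: "h \<in> P" and dvd: "dvd_in P f (g * h)"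
  shows "dvd_in P f g \<or> dvd_in P f h"
proof -
  have fP: "f \<in> P" and f0: "f \<noteq> 0" using f by (auto simp: irreducible_in_def)
  obtain k where k: "k \<in> P" "g * h = f * k" using dvd by (auto simp: dvd_in_def)
  define I where "I = {u * f + v * g |u v. u \<in> P \<and> v \<in> P}"
  have IP: "I \<subseteq> P" unfolding I_def using PD(4,6) fP g by auto
  have "f = 1 * f + 0 * g" "g = 0 * f + 1 * g" by simp_all
  then have fI: "f \<in> I" and gI: "g \<in> I" unfolding I_def using PD(1,2) by blast+
  define d where "d = arg_min (\<lambda>p. length (coeffs p)) (\<lambda>p. p \<in> I - {0})"
  have d: "d \<in> I - {0}" and dmin: "\<And>e. e \<in> I - {0} \<Longrightarrow> length (coeffs d) \<le> length (coeffs e)"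
    using arg_min_nat_lemma[of "\<lambda>p. p \<in> I - {0}" f "\<lambda>p. length (coeffs p)"] fI f0 unfolding d_def by blast+
  obtain u v where uv: "u \<in> P" "v \<in> P" "d = u * f + v * g" using d unfolding I_def by blast
  have dP: "d \<in> P" using d IP by blast
  \<comment> \<open>The pseudo-remainder of an ideal element lies in the ideal again and is shorter
    than \<open>d\<close>, hence zero by minimality.\<close>
  have div: "\<exists>c\<in>S - {0}. \<exists>q\<in>P. [:c:] * e = q * d" if eI: "e \<in> I" for e
  proof -
    obtain c q r where r: "c \<in> S - {0}" "q \<in> P" "r \<in> P"
      "[:c:] * e = q * d + r" "length (coeffs r) < length (coeffs d)"
      using pseudo_division_in[OF dP] d eI IP by blast
    obtain u' v' where e: "u' \<in> P" "v' \<in> P" "e = u' * f + v' * g"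
      using eI unfolding I_def by blast
    have "r = [:c:] * e - q * d" using r(4) by simp
    also have "\<dots> = ([:c:] * u' - q * u) * f + ([:c:] * v' - q * v) * g"
      unfolding e uv by (simp add: algebra_simps)
    finally have "r \<in> I" unfolding I_def using PD(5,6) r(1,2) e uv subS
      by (smt (verit, best) DiffD1 mem_Collect_eq polys_over_const_iff)
    then have "r = 0" using dmin r(5) by fastforce
    then show ?thesis using r by auto
  qed
  obtain c q where c: "c \<in> S - {0}" "q \<in> P" "[:c:] * f = q * d" using div[OF fI] by blast
  obtain c' q' where c': "c' \<in> S - {0}" "q' \<in> P" "[:c':] * g = q' * d" using div[OF gI] by blast
  obtain b q1 d1 where 1: "b \<in> S" "q1 \<in> P" "d1 \<in> P" "d = [:b:] * d1" "f = q1 * d1"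
    using distribute_const_factor[of c] c fP dP by blast
  have b0: "b \<noteq> 0" using 1 d by auto
  have bP: "[:b:] \<in> P" using 1 subS by simp
  consider "dvd_in P q1 1" | "dvd_in P d1 1"
    using f(1) 1 unfolding irreducible_in_def by blast
  then show ?thesis
  proof cases
    case 1
    then obtain w where w: "w \<in> P" "q1 * w = 1" unfolding dvd_in_def by metis
    have "[:c':] * g = q' * ([:b:] * ((q1 * w) * d1))"
      unfolding w(2) c'(3) \<open>d = [:b:] * d1\<close> by simp
    also have "\<dots> = f * (q' * [:b:] * w)" unfolding \<open>f = q1 * d1\<close> by (simp only: mult_ac)
    finally have "dvd_in P f ([:c':] * g)"
      unfolding dvd_in_def using PD(6) c'(2) bP w(1) by blast
    then show ?thesis using irreducible_cancel_const[OF f] c'(1) g by blast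
  next
    case 2
    then obtain w where w: "w \<in> P" "d1 * w = 1" unfolding dvd_in_def by metis
    have "[:b:] * h = [:b:] * (d1 * w) * h" unfolding w by simp
    also have "\<dots> = d * h * w" unfolding \<open>d = [:b:] * d1\<close> by (simp only: mult_ac)
    also have "\<dots> = (f * u * h + v * (g * h)) * w" unfolding uv by (simp add: algebra_simps)
    also have "\<dots> = f * ((u * h + v * k) * w)" unfolding k by (simp add: algebra_simps)
    finally have "dvd_in P f ([:b:] * h)"
      unfolding dvd_in_def using PD(4,6) uv h k w by blast
    then show ?thesis using irreducible_cancel_const[OF f] \<open>b \<in> S\<close> b0 h by blast
  qed
qed

text \<open>The norm is that of the leading coefficient plus the degree: both are additive, and norm
  zero leaves a constant that is a unit of \<open>S\<close>. Irreducible polynomials of degree zero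
  are irreducible constants of \<open>S\<close>, so the two primality lemmas cover both
  kinds.\<close>

theorem factorial_polys_over: "factorial_subring P"
proof -
  obtain \<delta> :: "'b \<Rightarrow> nat" where add: "\<And>a b. a \<in> S - {0} \<Longrightarrow> b \<in> S - {0} \<Longrightarrow> \<delta> (a * b) = \<delta> a + \<delta> b"
    and unit: "\<And>a. a \<in> S - {0} \<Longrightarrow> \<delta> a = 0 \<Longrightarrow> dvd_in S a 1"
    using S unfolding factorial_subring_def by blast
  have cunit: "dvd_in P [:c:] 1 \<longleftrightarrow> dvd_in S c 1" if "c \<in> S" for c
  proof
    assume "dvd_in P [:c:] 1"
    then obtain w where w: "w \<in> P" "1 = [:c:] * w" unfolding dvd_in_def by blast
    from arg_cong[OF w(2), of "\<lambda>p. coeff p 0"] have "1 = c * coeff w 0" by simp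
    then show "dvd_in S c 1" using polys_over_coeff[OF w(1)] unfolding dvd_in_def by blast
  next
    assume "dvd_in S c 1"
    then obtain w where "w \<in> S" "1 = c * w" unfolding dvd_in_def by blast
    then have "[:w:] \<in> P" "1 = [:c:] * [:w:]"
      using subS by (auto simp: one_pCons mult.commute)
    then show "dvd_in P [:c:] 1" unfolding dvd_in_def by blast
  qed
  show ?thesis unfolding factorial_subring_def
  proof (intro conjI exI[of _ "\<lambda>p. \<delta> (lead_coeff p) + degree p"] ballI impI allI)
    show "is_subring P" by (rule subP)
    fix a b assume ab: "a \<in> P - {0}" "b \<in> P - {0}"
    then have "lead_coeff a \<in> S - {0}" "lead_coeff b \<in> S - {0}"
      by (auto intro: polys_over_coeff)
    then show "\<delta> (lead_coeff (a * b)) + degree (a * b) =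
      \<delta> (lead_coeff a) + degree a + (\<delta> (lead_coeff b) + degree b)"
      using add ab by (simp add: degree_mult_eq coeff_mult_degree_sum)
  next
    fix a assume a: "a \<in> P - {0}" "\<delta> (lead_coeff a) + degree a = 0"
    then have "a = [:lead_coeff a:]" by (metis add_is_0 degree_0_id)
    moreover have "lead_coeff a \<in> S - {0}"
      using a(1) polys_over_coeff[of a S "degree a"] leading_coeff_0_iff[of a] by blast
    ultimately show "dvd_in P a 1" using unit cunit a(2) by (metis DiffD1 add_is_0)
  next
    fix p a b assume p: "irreducible_in P p" and ab: "a \<in> P" "b \<in> P"
      "dvd_in P p (a * b)"
    show "dvd_in P p a \<or> dvd_in P p b"
    proof (cases "degree p = 0")
      case True
      then obtain \<pi> where \<pi>: "p = [:\<pi>:]" by (meson degree_eq_zeroE)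
      have S\<pi>: "\<pi> \<in> S" using p \<pi> subS by (auto simp: irreducible_in_def)
      have "irreducible_in S \<pi>" unfolding irreducible_in_def
      proof (intro conjI ballI impI)
        show "\<not> dvd_in S \<pi> 1" "\<pi> \<noteq> 0" using p \<pi> cunit S\<pi> by (auto simp: irreducible_in_def)
        fix a b assume "a \<in> S" "b \<in> S" "\<pi> = a * b"
        then have "[:a:] \<in> P" "[:b:] \<in> P" "p = [:a:] * [:b:]"
          using \<pi> subS by auto
        then have "dvd_in P [:a:] 1 \<or> dvd_in P [:b:] 1"
          using p unfolding irreducible_in_def by blast
        then show "dvd_in S a 1 \<or> dvd_in S b 1" using cunit \<open>a \<in> S\<close> \<open>b \<in> S\<close> by blast
      qed (rule S\<pi>)
      then show ?thesis using irreducible_const_prime ab \<pi> by blast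
    qed (use irreducible_polys_over_prime p ab in auto)
  qed
qed

end

lemma polys_over_UNIV [simp]: "polys_over UNIV = UNIV"
  by (auto simp: polys_over_def)

section \<open>Cancelling common factors and least common multiples\<close>

context
  assumes fact: "factorial_subring (UNIV :: 'b::idom set)"
begin

text \<open>Induction over a factorisation of \<open>a\<close>. The quantifiers over
  \<open>b\<close> and \<open>c\<close> stand inside because in the product case the second factor
  is applied to the quotient of \<open>c\<close> by the first.\<close>

lemma factorial_coprime_dvd_mult:
  assumes "(a :: 'b) \<noteq> 0"
  shows "\<forall>b c. (\<forall>e. e dvd a \<and> e dvd b \<longrightarrow> e dvd 1) \<longrightarrow> a dvd b * c \<longrightarrow> a dvd c"
  using fact UNIV_I assms
proof (induction rule: factorial_subring_induct)
  case (unit u v)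
  then show ?case by (metis dvd_triv_left dvd_trans one_dvd)
next
  case (irreducible p)
  show ?case
  proof (intro allI impI)
    fix b c assume co: "\<forall>e. e dvd p \<and> e dvd b \<longrightarrow> e dvd 1" and d: "p dvd b * c"
    have "\<not> p dvd b" using co irreducible(1) by (auto simp: dvd_in_UNIV irreducible_in_def)
    then show "p dvd c" using irreducible(2)[of b c] d by (auto simp: dvd_in_UNIV)
  qed
next
  case (mult x y)
  show ?case
  proof (intro allI impI)
    fix b c assume co: "\<forall>e. e dvd x * y \<and> e dvd b \<longrightarrow> e dvd 1" and d: "x * y dvd b * c"
    have "x dvd c" using mult.IH(1) co d by (meson dvd_mult2 dvd_mult_left)
    then obtain k where k: "c = x * k" by (auto simp: dvd_def)
    have "x * y dvd x * (b * k)" using d k by (simp add: mult_ac)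
    then have "y dvd b * k" using mult.hyps(3) by simp
    then have "y dvd k" using mult.IH(2) co by (meson dvd_mult)
    then show "x * y dvd c" using k by simp
  qed
qed

text \<open>A common factor that is not a unit is cancelled as long as there is one; each
  cancellation lowers the norm of \<open>b\<close>.\<close>

lemma factorial_remove_common_factor:
  fixes a b :: 'b
  assumes "b \<noteq> 0"
  shows "\<exists>g a' b'. a = g * a' \<and> b = g * b' \<and> (\<forall>e. e dvd a' \<and> e dvd b' \<longrightarrow> e dvd 1)"
proof -
  obtain \<delta> :: "'b \<Rightarrow> nat" where add: "\<And>a b. a \<noteq> 0 \<Longrightarrow> b \<noteq> 0 \<Longrightarrow> \<delta> (a * b) = \<delta> a + \<delta> b"
    and unit: "\<And>a. a \<noteq> 0 \<Longrightarrow> \<delta> a = 0 \<Longrightarrow> a dvd 1"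
    using fact unfolding factorial_subring_def dvd_in_UNIV by (metis Diff_iff UNIV_I singletonD)
  show ?thesis using assms
  proof (induction "\<delta> b" arbitrary: a b rule: less_induct)
    case less
    show ?case
    proof (cases "\<forall>e. e dvd a \<and> e dvd b \<longrightarrow> e dvd 1")
      case True
      then show ?thesis by (metis mult_1)
    next
      case False
      then obtain e a1 b1 where e: "\<not> e dvd 1" "a = e * a1" "b = e * b1" by (auto simp: dvd_def)
      then have "e \<noteq> 0" "b1 \<noteq> 0" using less.prems by auto
      then have "\<delta> b1 < \<delta> b" using add unit e by (metis less_add_same_cancel2 neq0_conv)
      then obtain g a' b' where "a1 = g * a'" "b1 = g * b'" "\<forall>e. e dvd a' \<and> e dvd b' \<longrightarrow> e dvd 1"
        using less.hyps \<open>b1 \<noteq> 0\<close> by blast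
      then show ?thesis using e by (metis mult.assoc)
    qed
  qed
qed

lemma factorial_lcm_exists:
  fixes D :: "'b set"
  assumes "finite D" "0 \<notin> D"
  shows "\<exists>l. l \<noteq> 0 \<and> (\<forall>d\<in>D. d dvd l) \<and> (\<forall>k. (\<forall>d\<in>D. d dvd k) \<longrightarrow> l dvd k)"
  using assms
proof (induction D rule: finite_induct)
  case empty
  then show ?case by (intro exI[of _ 1]) auto
next
  case (insert b D)
  then obtain a where a: "a \<noteq> 0" "\<forall>d\<in>D. d dvd a" "\<And>k. (\<forall>d\<in>D. d dvd k) \<Longrightarrow> a dvd k" by auto
  have b0: "b \<noteq> 0" using insert.prems by auto
  obtain g a' b' where g: "a = g * a'" "b = g * b'" and co: "\<forall>e. e dvd a' \<and> e dvd b' \<longrightarrow> e dvd 1"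
    using factorial_remove_common_factor[OF b0] by metis
  have nz: "g \<noteq> 0" "a' \<noteq> 0" "b' \<noteq> 0" using g a b0 by auto
  show ?case
  \<comment> \<open>With \<open>g\<close> the common factor of \<open>a\<close> and
    \<open>b\<close>, this is the product of \<open>a\<close> and \<open>b\<close> divided by
    \<open>g\<close>.\<close>
  proof (intro exI[of _ "a * b'"] conjI allI impI)
    show "a * b' \<noteq> 0" using nz a by simp
    show "\<forall>d\<in>insert b D. d dvd a * b'"
    proof
      fix d assume "d \<in> insert b D"
      moreover have "a * b' = b * a'" using g by (simp only: mult_ac)
      ultimately show "d dvd a * b'" using a(2) by (metis dvd_mult2 dvd_triv_left insertE)
    qed
    fix k assume k: "\<forall>d\<in>insert b D. d dvd k"
    then have "a dvd k" "b dvd k" using a(3)[of k] by auto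
    then obtain x y where x: "k = a * x" and y: "k = b * y" unfolding dvd_def by blast
    then have "g * (a' * x) = g * (b' * y)" using g by (metis mult.assoc)
    then have xy: "a' * x = b' * y" using nz by simp
    then have "a' dvd b' * y" by (metis dvd_triv_left)
    then obtain z where "y = a' * z" using factorial_coprime_dvd_mult[OF nz(2)] co by (auto simp: dvd_def)
    then have "k = a * b' * z" using y g by (simp add: mult_ac)
    then show "a * b' dvd k" by simp
  qed
qed

end


section \<open>Polynomials in the parameters\<close>

lemma poly_mapping_sum_single:
  "p = (\<Sum>m\<in>Poly_Mapping.keys p. Poly_Mapping.single m (Poly_Mapping.lookup p m))"
  by (rule poly_mapping_eqI) (simp add: lookup_sum lookup_single when_def in_keys_iff)

lemma ypoly_induct [case_names single add]:
  fixes p :: "('y, 'a::comm_monoid_add) ypoly"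
  assumes "\<And>m c. P (Poly_Mapping.single m c)" and "\<And>p q. P p \<Longrightarrow> P q \<Longrightarrow> P (p + q)"
  shows "P p"
proof -
  have "P (\<Sum>m\<in>M. Poly_Mapping.single m (Poly_Mapping.lookup p m))" if "finite M" for M
    using that
  proof (induction M rule: finite_induct)
    case empty
    then show ?case using assms(1)[of 0 0] by simp
  qed (use assms in auto)
  then show ?thesis by (subst poly_mapping_sum_single) simp
qed

lemma comm_ring_homD:
  assumes "comm_ring_hom h"
  shows "h 0 = 0" "h 1 = 1" "h (x + y) = h x + h y" "h (x * y) = h x * h y" "h (x - y) = h x - h y"
    "h (- x) = - h x" "h (x ^ n) = h x ^ n" "h (sum f I) = (\<Sum>i\<in>I. h (f i))" "h (prod f I) = (\<Prod>i\<in>I. h (f i))"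
proof -
  interpret comm_ring_hom h by (rule assms)
  show "h 0 = 0" "h 1 = 1" "h (x + y) = h x + h y" "h (x * y) = h x * h y" "h (x - y) = h x - h y"
    "h (- x) = - h x" "h (x ^ n) = h x ^ n" "h (sum f I) = (\<Sum>i\<in>I. h (f i))" "h (prod f I) = (\<Prod>i\<in>I. h (f i))"
    by (simp_all add: hom_add hom_mult hom_minus hom_uminus hom_power hom_sum hom_prod)
qed

lemma comm_ring_hom_const_poly: "comm_ring_hom (\<lambda>c::'b::comm_ring_1. [:c:])"
  by unfold_locales (auto simp: one_pCons)

lemma comm_ring_hom_poly: "comm_ring_hom (\<lambda>p::'b::comm_ring_1 poly. poly p x)"
  by unfold_locales auto

lemma comm_ring_hom_to_ac: "comm_ring_hom (to_ac :: 'a::field \<Rightarrow> 'a alg_closure)"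
  by unfold_locales auto

lemma comm_ring_hom_single: "comm_ring_hom (Poly_Mapping.single 0 :: 'a \<Rightarrow> ('y, 'a::comm_ring_1) ypoly)"
  by unfold_locales (auto simp: single_add mult_single)

lemma comm_ring_hom_comp: "comm_ring_hom f \<Longrightarrow> comm_ring_hom g \<Longrightarrow> comm_ring_hom (\<lambda>x. f (g x))"
proof -
  assume "comm_ring_hom f" "comm_ring_hom g"
  then interpret f: comm_ring_hom f + g: comm_ring_hom g by simp_all
  show ?thesis by unfold_locales (auto simp: f.hom_add f.hom_mult g.hom_add g.hom_mult)
qed

lemma comm_ring_hom_to_fract: "comm_ring_hom (to_fract :: 'b::idom \<Rightarrow> 'b fract)"
  by unfold_locales auto

lemma comm_ring_hom_const_univ: "comm_ring_hom (const_univ :: 'a::field \<Rightarrow> ('y::linorder, 'a) univ)"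
  unfolding const_univ_def[abs_def]
  by (intro comm_ring_hom_comp[OF comm_ring_hom_to_ac] comm_ring_hom_comp[OF comm_ring_hom_to_fract]
      comm_ring_hom_single)

section \<open>Evaluation of parameter polynomials as a ring homomorphism\<close>

context
  fixes h :: "'a::comm_ring_1 \<Rightarrow> 'k::comm_ring_1"
  assumes h: "comm_ring_hom h"
begin

interpretation h: comm_ring_hom h by (rule h)

text \<open>Monomials outside the support contribute 0 and parameters outside a monomial contribute
  1, so sums and products can range over common index sets. In this form additivity and
  multiplicativity of evaluation become termwise.\<close>

lemma ypoly_eval_superset:
  fixes a :: "'y::finite \<Rightarrow> 'k"
  assumes "finite M" "Poly_Mapping.keys p \<subseteq> M"
  shows "ypoly_eval h a p =
    (\<Sum>m\<in>M. h (Poly_Mapping.lookup p m) * (\<Prod>i\<in>UNIV. a i ^ Poly_Mapping.lookup m i))"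
proof -
  have "(\<Prod>i\<in>UNIV. a i ^ Poly_Mapping.lookup m i) =
      (\<Prod>i\<in>Poly_Mapping.keys m. a i ^ Poly_Mapping.lookup m i)" for m
    by (rule prod.mono_neutral_right) (auto simp: in_keys_iff)
  then show ?thesis
    unfolding ypoly_eval_def
    by (simp only:) (rule sum.mono_neutral_left, use assms in \<open>auto simp: in_keys_iff\<close>)
qed

lemma ypoly_eval_single:
  fixes a :: "'y::finite \<Rightarrow> 'k"
  shows "ypoly_eval h a (Poly_Mapping.single m c) = h c * (\<Prod>i\<in>UNIV. a i ^ Poly_Mapping.lookup m i)"
  by (subst ypoly_eval_superset[of "{m}"]) auto

lemma ypoly_eval_add:
  fixes a :: "'y::finite \<Rightarrow> 'k"
  shows "ypoly_eval h a (p + q) = ypoly_eval h a p + ypoly_eval h a q"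
proof -
  let ?M = "Poly_Mapping.keys p \<union> Poly_Mapping.keys q"
  have "Poly_Mapping.keys (p + q) \<subseteq> ?M" by (rule Poly_Mapping.keys_add)
  then show ?thesis
    by (simp add: ypoly_eval_superset[of ?M] lookup_add h.hom_add distrib_right sum.distrib)
qed

lemma comm_ring_hom_ypoly_eval:
  fixes a :: "'y::finite \<Rightarrow> 'k"
  shows "comm_ring_hom (ypoly_eval h a)"
proof
  show "ypoly_eval h a 0 = 0" by (simp add: ypoly_eval_def)
  show "ypoly_eval h a 1 = 1" using ypoly_eval_single[of a 0 1] by simp
  fix p q
  show "ypoly_eval h a (p + q) = ypoly_eval h a p + ypoly_eval h a q" by (rule ypoly_eval_add)
  have *: "ypoly_eval h a (Poly_Mapping.single m c * Poly_Mapping.single m' c') =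
    ypoly_eval h a (Poly_Mapping.single m c) * ypoly_eval h a (Poly_Mapping.single m' c')" for m c m' c'
    by (simp add: mult_single ypoly_eval_single h.hom_mult lookup_add power_add prod.distrib mult_ac)
  show "ypoly_eval h a (p * q) = ypoly_eval h a p * ypoly_eval h a q"
  proof (induction p rule: ypoly_induct)
    case (single m c)
    then show ?case
      by (induction q rule: ypoly_induct) (simp_all add: * distrib_left ypoly_eval_add)
  qed (simp add: distrib_right ypoly_eval_add)
qed

lemma ypoly_eval_param_var:
  fixes a :: "'y::{finite,linorder} \<Rightarrow> 'k"
  shows "ypoly_eval h a (Poly_Mapping.single (Poly_Mapping.single i 1) 1) = a i"
proof -
  have "(\<Prod>j\<in>UNIV. a j ^ Poly_Mapping.lookup (Poly_Mapping.single i (Suc 0)) j) = (\<Prod>j\<in>{i}. a j)"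
    by (rule prod.mono_neutral_cong_right) (auto simp: lookup_single when_def)
  then show ?thesis by (simp add: ypoly_eval_single)
qed

lemma hom_ypoly_eval:
  fixes a :: "'y::finite \<Rightarrow> 'k" and \<psi> :: "'k \<Rightarrow> 'l::comm_ring_1"
  assumes "comm_ring_hom \<psi>"
  shows "\<psi> (ypoly_eval h a p) = ypoly_eval (\<lambda>c. \<psi> (h c)) (\<lambda>i. \<psi> (a i)) p"
proof -
  interpret \<psi>: comm_ring_hom \<psi> by (rule assms)
  show ?thesis
    by (simp add: ypoly_eval_def \<psi>.hom_sum \<psi>.hom_mult \<psi>.hom_prod \<psi>.hom_power)
qed

lemma ypoly_eval_in_subring:
  assumes "is_subring S" "\<And>c. h c \<in> S" "\<And>i. i \<in> params p \<Longrightarrow> a i \<in> S"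
  shows "ypoly_eval h a p \<in> S"
  unfolding ypoly_eval_def
proof (intro is_subring_sum[OF assms(1)] is_subringD(6)[OF assms(1)] is_subring_prod[OF assms(1)]
    is_subringD(7)[OF assms(1)] assms(2) assms(3))
  show "i \<in> params p" if "m \<in> Poly_Mapping.keys p" "i \<in> Poly_Mapping.keys m" for m i
    using that by (auto simp: params_def)
qed

end

lemma ypoly_eval_cong:
  assumes "\<And>i. i \<in> params p \<Longrightarrow> a i = b i"
  shows "ypoly_eval h a p = ypoly_eval h b p"
proof -
  have "a i = b i" if "m \<in> Poly_Mapping.keys p" "i \<in> Poly_Mapping.keys m" for m i
    using assms that unfolding params_def by blast
  then show ?thesis unfolding ypoly_eval_def
    by (intro sum.cong prod.cong refl arg_cong2[where f = "(*)"]) simp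
qed

lemma param_var_power:
  "(param_var i :: ('y::linorder, 'a::field) ypoly) ^ k = Poly_Mapping.single (Poly_Mapping.single i k) 1"
proof (induction k)
  case 0
  show ?case unfolding power_0 single_zero single_one by (rule refl)
next
  case (Suc k)
  have "Poly_Mapping.single i 1 + Poly_Mapping.single i k = Poly_Mapping.single i (Suc k)"
    by (subst single_add[symmetric]) simp
  then show ?case
    unfolding power_Suc Suc by (simp only: param_var_def mult_single mult_1)
qed

lemma ypoly_eval_param_var_id:
  fixes p :: "('y::{finite,linorder}, 'a::field) ypoly"
  shows "ypoly_eval (Poly_Mapping.single 0) param_var p = p"
proof (induction p rule: ypoly_induct)
  case (single m c)
  have "(\<Prod>i\<in>I. param_var i ^ Poly_Mapping.lookup m i) =
    (Poly_Mapping.single (\<Sum>i\<in>I. Poly_Mapping.single i (Poly_Mapping.lookup m i)) 1 :: ('y, 'a) ypoly)"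
    if "finite I" for I
    using that by (induction I rule: finite_induct) (auto simp: param_var_power mult_single)
  moreover have "(\<Sum>i\<in>UNIV. Poly_Mapping.single i (Poly_Mapping.lookup m i)) = m"
    by (rule poly_mapping_eqI) (simp add: lookup_sum lookup_single when_def)
  ultimately show ?case
    by (simp add: ypoly_eval_single[OF comm_ring_hom_single] mult_single)
qed (simp add: ypoly_eval_add[OF comm_ring_hom_single])

section \<open>Unique factorisation in F[Y] and F[Y,x], one parameter at a time\<close>

definition ypolys_in :: "'y set \<Rightarrow> ('y, 'a::zero) ypoly set" where
  "ypolys_in V = {p. params p \<subseteq> V}"

lemma is_subring_ypolys_in: "is_subring (ypolys_in V :: ('y, 'a::comm_ring_1) ypoly set)"
  unfolding is_subring_def
proof (intro conjI ballI)
  fix p q :: "('y, 'a) ypoly" assume pq: "p \<in> ypolys_in V" "q \<in> ypolys_in V"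
  show "p + q \<in> ypolys_in V" using pq Poly_Mapping.keys_add[of p q]
    unfolding ypolys_in_def params_def mem_Collect_eq by blast
  show "p * q \<in> ypolys_in V" unfolding ypolys_in_def params_def
  proof safe
    fix m i assume "m \<in> Poly_Mapping.keys (p * q)" and i: "i \<in> Poly_Mapping.keys m"
    then obtain m1 m2 where m: "m = m1 + m2" "m1 \<in> Poly_Mapping.keys p" "m2 \<in> Poly_Mapping.keys q"
      using Poly_Mapping.keys_mult[of p q] by blast
    have "i \<in> Poly_Mapping.keys m1 \<or> i \<in> Poly_Mapping.keys m2" using i m Poly_Mapping.keys_add[of m1 m2] by blast
    then show "i \<in> V" using pq m unfolding ypolys_in_def params_def mem_Collect_eq by blast
  qed
next
  fix p :: "('y, 'a) ypoly" assume p: "p \<in> ypolys_in V"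
  have "Poly_Mapping.keys (- p) = Poly_Mapping.keys p"
    by (simp add: Poly_Mapping.keys.rep_eq)
  then show "- p \<in> ypolys_in V" using p by (simp add: ypolys_in_def params_def)
qed (simp_all add: ypolys_in_def params_def)

lemma ypolys_in_empty:
  fixes p :: "('y, 'a::zero) ypoly"
  assumes "p \<in> ypolys_in {}"
  shows "p = Poly_Mapping.single 0 (Poly_Mapping.lookup p 0)"
proof (rule poly_mapping_eqI)
  fix m
  show "Poly_Mapping.lookup p m = Poly_Mapping.lookup (Poly_Mapping.single 0 (Poly_Mapping.lookup p 0)) m"
  proof (cases "m = 0")
    case False
    then have "m \<notin> Poly_Mapping.keys p" using assms by (auto simp: ypolys_in_def params_def)
    then have "Poly_Mapping.lookup p m = 0" by (metis in_keys_iff)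
    then show ?thesis using False by (simp add: lookup_single when_def)
  qed simp
qed

lemma const_in_ypolys_in: "Poly_Mapping.single 0 c \<in> ypolys_in V"
  by (simp add: ypolys_in_def params_def)

lemma param_var_in_ypolys_in: "i \<in> V \<Longrightarrow> param_var i \<in> ypolys_in V"
  by (simp add: ypolys_in_def params_def param_var_def)

text \<open>The polynomial variable of the result stands for the parameter \<open>i\<close>, not for
  \<open>x\<close>, although the type is that of \<open>F[Y,x]\<close>. The map inverts the
  substitution of \<open>param_var i\<close> and so exhibits \<open>F[insert i V]\<close>, for
  \<open>i\<close> outside \<open>V\<close>, as a polynomial ring over \<open>F[V]\<close>.\<close>

definition split_var :: "'y::{finite,linorder} \<Rightarrow> ('y, 'a::field) ypoly \<Rightarrow> ('y, 'a) yxpoly" where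
  "split_var i = ypoly_eval (\<lambda>c. [:Poly_Mapping.single 0 c:])
     (\<lambda>j. if j = i then [:0, 1:] else [:param_var j:])"

lemma comm_ring_hom_const_yxpoly:
  "comm_ring_hom (\<lambda>c. [:Poly_Mapping.single 0 c:] :: ('y, 'a::comm_ring_1) yxpoly)"
  by (rule comm_ring_hom_comp[OF comm_ring_hom_const_poly comm_ring_hom_single])

lemma comm_ring_hom_split_var: "comm_ring_hom (split_var i)"
  unfolding split_var_def by (rule comm_ring_hom_ypoly_eval[OF comm_ring_hom_const_yxpoly])

lemma poly_split_var: "poly (split_var i p) (param_var i) = p"
proof -
  have "poly (split_var i p) (param_var i) = ypoly_eval (Poly_Mapping.single 0) param_var p"
    unfolding split_var_def
    by (subst hom_ypoly_eval[OF comm_ring_hom_const_yxpoly comm_ring_hom_poly])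
      (auto simp: if_distrib[of "\<lambda>p. poly p _"] intro!: ypoly_eval_cong)
  then show ?thesis by (simp add: ypoly_eval_param_var_id)
qed

lemma split_var_const:
  assumes "p \<in> ypolys_in V" "i \<notin> V"
  shows "split_var i p = [:p:]"
proof -
  have "split_var i p = ypoly_eval (\<lambda>c. [:Poly_Mapping.single 0 c:]) (\<lambda>j. [:param_var j:]) p"
    unfolding split_var_def using assms by (intro ypoly_eval_cong) (auto simp: ypolys_in_def)
  also have "\<dots> = [:ypoly_eval (Poly_Mapping.single 0) param_var p:]"
    by (rule hom_ypoly_eval[OF comm_ring_hom_single comm_ring_hom_const_poly, symmetric])
  finally show ?thesis by (simp add: ypoly_eval_param_var_id)
qed

lemma split_var_in:
  assumes "p \<in> ypolys_in (insert i V)"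
  shows "split_var i p \<in> polys_over (ypolys_in V)"
  unfolding split_var_def
proof (rule ypoly_eval_in_subring[OF comm_ring_hom_const_yxpoly])
  show "is_subring (polys_over (ypolys_in V) :: ('a, 'b) yxpoly set)"
    by (intro is_subring_polys_over is_subring_ypolys_in)
  show "[:Poly_Mapping.single 0 c:] \<in> polys_over (ypolys_in V)" for c :: 'b
    by (simp add: is_subring_ypolys_in const_in_ypolys_in)
  have "[:0, 1:] = (monom 1 1 :: ('a, 'b) yxpoly)" by (simp add: monom_Suc monom_0)
  moreover have "monom 1 1 \<in> polys_over (ypolys_in V :: ('a, 'b) ypoly set)"
    by (intro polys_over_monom is_subringD(2) is_subring_ypolys_in)
  ultimately show "(if j = i then [:0, 1:] else [:param_var j:]) \<in> polys_over (ypolys_in V :: ('a, 'b) ypoly set)"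
    if "j \<in> params p" for j
    using assms that by (auto simp: is_subring_ypolys_in ypolys_in_def[of "insert i V"] intro!: param_var_in_ypolys_in)
qed

lemma split_var_poly:
  fixes P :: "('y::{finite,linorder}, 'a::field) yxpoly"
  assumes "i \<notin> V"
  shows "P \<in> polys_over (ypolys_in V) \<Longrightarrow> split_var i (poly P (param_var i)) = P"
proof (induction P)
  case 0
  then show ?case by (simp add: comm_ring_homD(1)[OF comm_ring_hom_split_var])
next
  case (pCons c P)
  interpret \<psi>: comm_ring_hom "split_var i" by (rule comm_ring_hom_split_var)
  have "c \<in> ypolys_in V" using polys_over_coeff[OF pCons.prems, of 0] by simp
  moreover have "P \<in> polys_over (ypolys_in V)"
    using polys_over_coeff[OF pCons.prems, of "Suc _"] by (simp add: polys_over_def)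
  moreover have "split_var i (param_var i :: ('y, 'a) ypoly) = [:0, 1:]"
    unfolding split_var_def param_var_def
    by (subst ypoly_eval_param_var[OF comm_ring_hom_const_yxpoly]) simp
  ultimately show ?case
    using split_var_const[OF _ assms, of c] pCons.IH by (simp add: \<psi>.hom_add \<psi>.hom_mult mult.commute)
qed

text \<open>Without parameters only constants remain, and these form a field. A new parameter makes
  \<open>F[insert i V]\<close> isomorphic to the polynomials over \<open>F[V]\<close>, to which
  \<open>factorial_polys_over\<close> applies.\<close>

theorem factorial_ypolys_in:
  "finite V \<Longrightarrow> factorial_subring (ypolys_in V :: ('y::{finite,linorder}, 'a::field) ypoly set)"
proof (induction V rule: finite_induct)
  case empty
  show ?case
  proof (rule factorial_subring_field[OF is_subring_ypolys_in])
    fix p :: "('y, 'a) ypoly" assume p: "p \<in> ypolys_in {}" "p \<noteq> 0"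
    define c where "c = Poly_Mapping.lookup p 0"
    have pc: "p = Poly_Mapping.single 0 c" unfolding c_def by (rule ypolys_in_empty[OF p(1)])
    then have "c \<noteq> 0" using p by auto
    then have "1 = p * Poly_Mapping.single 0 (inverse c)" by (simp add: pc mult_single)
    then show "dvd_in (ypolys_in {}) p 1" unfolding dvd_in_def using const_in_ypolys_in by blast
  qed
next
  case (insert i V)
  let ?P = "polys_over (ypolys_in V) :: ('y, 'a) yxpoly set"
  show ?case
  proof (rule factorial_subring_iso[OF factorial_polys_over[OF insert.IH]])
    show "bij_betw (\<lambda>P. poly P (param_var i)) ?P (ypolys_in (insert i V))"
    proof (rule bij_betw_byWitness[where f' = "split_var i"])
      show "\<forall>P\<in>?P. split_var i (poly P (param_var i)) = P" using split_var_poly insert by blast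
      show "\<forall>p\<in>ypolys_in (insert i V). poly (split_var i p) (param_var i) = p" by (simp add: poly_split_var)
      show "split_var i ` ypolys_in (insert i V) \<subseteq> ?P" using split_var_in by blast
      show "(\<lambda>P. poly P (param_var i)) ` ?P \<subseteq> ypolys_in (insert i V)"
      proof safe
        fix P assume P: "P \<in> ?P"
        have "coeff P k \<in> ypolys_in (insert i V)" for k
          using polys_over_coeff[OF P, of k] by (auto simp: ypolys_in_def)
        then show "poly P (param_var i) \<in> ypolys_in (insert i V)"
          unfolding poly_altdef
          by (intro is_subring_sum is_subringD(6,7) is_subring_ypolys_in param_var_in_ypolys_in) auto
      qed
    qed
  qed simp_all
qed

corollary factorial_ypoly: "factorial_subring (UNIV :: ('y::{finite,linorder}, 'a::field) ypoly set)"
  using factorial_ypolys_in[of UNIV] by (simp add: ypolys_in_def)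

corollary factorial_yxpoly: "factorial_subring (UNIV :: ('y::{finite,linorder}, 'a::field) yxpoly set)"
  using factorial_polys_over[OF factorial_ypoly] by simp

section \<open>Images of parameter polynomials in the extension field\<close>

lemma is_subfield_adjoin: "is_subfield (adjoin h S)"
  unfolding is_subfield_def by (intro conjI ballI) (simp_all add: adjoin_def is_subfield_def)

lemma adjoin_range: "h c \<in> adjoin h S"
  unfolding adjoin_def by blast

lemma adjoin_gen: "x \<in> S \<Longrightarrow> x \<in> adjoin h S"
  unfolding adjoin_def by blast

lemma adjoin_least: "is_subfield K \<Longrightarrow> range h \<subseteq> K \<Longrightarrow> S \<subseteq> K \<Longrightarrow> adjoin h S \<subseteq> K"
  unfolding adjoin_def by blast

lemma is_subring_subfield: "is_subfield K \<Longrightarrow> is_subring K"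
  by (simp add: is_subfield_def is_subring_def)

lemma poly_over_iff: "poly_over K p \<longleftrightarrow> p \<in> polys_over K"
  by (simp add: poly_over_def polys_over_def)

lemma comm_ring_hom_gen_eval: "comm_ring_hom (gen_eval (E :: ('y::{finite,linorder}, 'a::field) param_ext))"
  unfolding gen_eval_def[abs_def] by (rule comm_ring_hom_ypoly_eval[OF comm_ring_hom_const_univ])

lemma comm_ring_hom_map_poly: 
  assumes "comm_ring_hom h"
  shows "comm_ring_hom (map_poly h)"
proof -
  interpret map_poly_comm_ring_hom h using assms unfolding map_poly_comm_ring_hom_def by simp
  show ?thesis by unfold_locales
qed

lemma comm_ring_hom_gen_poly: "comm_ring_hom (gen_poly (E :: ('y::{finite,linorder}, 'a::field) param_ext))"
  unfolding gen_poly_def[abs_def] by (rule comm_ring_hom_map_poly[OF comm_ring_hom_gen_eval])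

lemma coeff_gen_poly:
  "coeff (gen_poly (E :: ('y::{finite,linorder}, 'a::field) param_ext) p) k = gen_eval E (coeff p k)"
  unfolding gen_poly_def by (simp add: coeff_map_poly comm_ring_homD(1)[OF comm_ring_hom_gen_eval])

lemma gen_eval_poly:
  fixes E :: "('y::{finite,linorder}, 'a::field) param_ext"
  shows "gen_eval E (poly P (param_var i)) = poly (gen_poly E P) (ext_gen E i)"
proof -
  interpret g: comm_ring_hom "gen_eval E" by (rule comm_ring_hom_gen_eval)
  have "gen_eval E (param_var i) = ext_gen E i"
    unfolding gen_eval_def param_var_def by (rule ypoly_eval_param_var[OF comm_ring_hom_const_univ])
  then show ?thesis unfolding gen_poly_def
    by (metis g.eval_poly_poly g.poly_map_poly_eval_poly)
qed

lemma gen_eval_in_adjoin: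
  fixes E :: "('y::{finite,linorder}, 'a::field) param_ext"
  assumes "params p \<subseteq> V"
  shows "gen_eval E p \<in> adjoin const_univ (ext_gen E ` V)"
  unfolding gen_eval_def
  by (rule ypoly_eval_in_subring[OF comm_ring_hom_const_univ])
    (use assms in \<open>auto intro: is_subring_subfield is_subfield_adjoin adjoin_range adjoin_gen\<close>)

text \<open>Parameters adjoined one after the other, each transcendental over the field so far, are
  algebraically independent. The polynomial is split along the last parameter: transcendence makes
  the images of all its coefficients vanish, and these involve earlier parameters only.\<close>

theorem gen_eval_eq_0_iff:
  fixes E :: "('y::{finite,linorder}, 'a::field) param_ext"
  assumes E: "parameterized_extension E" and pt: "purely_transcendental E"
  shows "gen_eval E p = 0 \<longleftrightarrow> p = 0"
proof
  let ?V = "\<lambda>j. set (map fst (take j (ext_steps E)))"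
  have dist: "distinct (map fst (ext_steps E))" and all: "set (map fst (ext_steps E)) = UNIV"
    using E by (auto simp: parameterized_extension_def)
  \<comment> \<open>The induction runs over initial segments of the tower; the full tower contains
    every parameter.\<close>
  have "\<forall>p. params p \<subseteq> ?V j \<longrightarrow> gen_eval E p = 0 \<longrightarrow> p = 0" if "j \<le> length (ext_steps E)" for j
    using that
  proof (induction j)
    case 0
    show ?case
    proof (intro allI impI)
      fix p :: "('y, 'a) ypoly" assume p: "params p \<subseteq> ?V 0" "gen_eval E p = 0"
      define c where "c = Poly_Mapping.lookup p 0"
      have pc: "p = Poly_Mapping.single 0 c"
        unfolding c_def by (rule ypolys_in_empty) (use p in \<open>simp add: ypolys_in_def\<close>)
      have "gen_eval E p = const_univ c"
        unfolding gen_eval_def pc by (subst ypoly_eval_single[OF comm_ring_hom_const_univ]) simp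
      then have "to_fract (Poly_Mapping.single 0 c :: ('y, 'a) ypoly) = 0"
        using p(2) unfolding const_univ_def by simp
      then have "Poly_Mapping.lookup (Poly_Mapping.single 0 c :: ('y, 'a) ypoly) 0 = 0" by simp
      then have "c = 0" by (simp only: lookup_single_eq)
      then show "p = 0" using pc by simp
    qed
  next
    case (Suc j)
    let ?i = "fst (ext_steps E ! j)"
    have j: "j < length (ext_steps E)" using Suc.prems by simp
    have snoc: "map fst (take (Suc j) (ext_steps E)) = map fst (take j (ext_steps E)) @ [?i]"
      unfolding take_Suc_conv_app_nth[OF j] by simp
    have VS: "?V (Suc j) = insert ?i (?V j)" unfolding snoc by simp
    note snoc
    moreover have "distinct (map fst (take (Suc j) (ext_steps E)))"
      using dist by (metis distinct_take take_map)
    ultimately have i: "?i \<notin> ?V j" by (metis distinct_append disjoint_iff list.set_intros(1))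
    have "snd (ext_steps E ! j) = None"
      using bspec[OF pt[unfolded purely_transcendental_def] nth_mem[OF j]] by (simp add: case_prod_unfold)
    then have tr: "q = 0" if "poly_over (adjoin const_univ (ext_gen E ` ?V j)) q" "poly q (ext_gen E ?i) = 0" for q
      using conjunct2[OF conjunct2[OF E[unfolded parameterized_extension_def]], rule_format, OF j]
        \<open>snd (ext_steps E ! j) = None\<close> that
      by (simp only: Let_def option.case)
    show ?case
    proof (intro allI impI)
      fix p :: "('y, 'a) ypoly" assume p: "params p \<subseteq> ?V (Suc j)" "gen_eval E p = 0"
      define P where "P = split_var ?i p"
      have pP: "p = poly P (param_var ?i)" by (simp add: P_def poly_split_var)
      have "P \<in> polys_over (ypolys_in (?V j))"
        unfolding P_def by (rule split_var_in) (use p VS in \<open>simp add: ypolys_in_def\<close>)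
      then have Pc: "params (coeff P k) \<subseteq> ?V j" for k
        by (auto simp: polys_over_def ypolys_in_def)
      have "gen_poly E P = 0"
      proof (rule tr)
        show "poly_over (adjoin const_univ (ext_gen E ` ?V j)) (gen_poly E P)"
          unfolding poly_over_def coeff_gen_poly using gen_eval_in_adjoin[OF Pc] by simp
        show "poly (gen_poly E P) (ext_gen E ?i) = 0" using p(2) pP gen_eval_poly by metis
      qed
      then have "gen_eval E (coeff P k) = 0" for k by (metis coeff_0 coeff_gen_poly)
      then have "coeff P k = 0" for k using Suc Pc by simp
      then have "P = 0" by (simp add: poly_eq_iff)
      then show "p = 0" using pP by simp
    qed
  qed
  from this[of "length (ext_steps E)"] show "gen_eval E p = 0 \<Longrightarrow> p = 0"
    using all by simp
qed (simp add: comm_ring_homD(1)[OF comm_ring_hom_gen_eval])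


section \<open>Localization and evaluation\<close>

text \<open>Values defined by \<open>THE\<close> are meaningful only where a suitable representation
  exists; elsewhere they are arbitrary. Hence \<open>ev\<close> is a total function that is required
  to be a ring homomorphism on the carrier \<open>L\<close> alone.\<close>

locale partial_hom =
  fixes L :: "'b::comm_ring_1 set" and ev :: "'b \<Rightarrow> 'c::comm_ring_1"
  assumes subring: "is_subring L"
    and ev_1: "ev 1 = 1"
    and ev_add: "x \<in> L \<Longrightarrow> y \<in> L \<Longrightarrow> ev (x + y) = ev x + ev y"
    and ev_mult: "x \<in> L \<Longrightarrow> y \<in> L \<Longrightarrow> ev (x * y) = ev x * ev y"
begin

lemma ev_0: "ev 0 = 0"
  using ev_add[of 0 0] is_subringD(1)[OF subring] by (simp only: add_0_left add_cancel_right_right)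

lemma ev_uminus: "x \<in> L \<Longrightarrow> ev (- x) = - ev x"
  using ev_add[of x "- x"] is_subringD(3)[OF subring] ev_0 by (simp add: eq_neg_iff_add_eq_0 add.commute)

lemma ev_sum: "(\<And>i. i \<in> I \<Longrightarrow> g i \<in> L) \<Longrightarrow> ev (sum g I) = (\<Sum>i\<in>I. ev (g i))"
proof (induction I rule: infinite_finite_induct)
  case (insert i I)
  then have "sum g I \<in> L" by (intro is_subring_sum[OF subring]) auto
  then show ?case using insert by (simp add: ev_add)
qed (simp_all add: ev_0)

end

lemma map_poly_pCons_zero: "h 0 = 0 \<Longrightarrow> map_poly h (pCons c p) = pCons (h c) (map_poly h p)"
  by (rule poly_eqI) (simp add: coeff_map_poly coeff_pCons split: nat.split)

lemma partial_hom_UNIV: "comm_ring_hom h \<Longrightarrow> partial_hom UNIV h"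
  by unfold_locales (simp_all add: is_subring_def comm_ring_homD)

lemma partial_hom_comp:
  assumes "partial_hom L h" "partial_hom M g" "\<And>x. x \<in> L \<Longrightarrow> h x \<in> M"
  shows "partial_hom L (\<lambda>x. g (h x))"
proof -
  interpret h: partial_hom L h by (rule assms(1))
  interpret g: partial_hom M g by (rule assms(2))
  show ?thesis by unfold_locales
      (simp_all add: h.subring h.ev_1 g.ev_1 h.ev_add h.ev_mult g.ev_add g.ev_mult assms(3))
qed

text \<open>If the image of \<open>P\<close> is nonzero, this is the localisation of the image of
  \<open>f\<close> at the powers of \<open>P\<close>. Divisibility is tested after applying
  \<open>f\<close> because \<open>f\<close> may have a kernel. It is used with
  \<open>gen_eval\<close> for coefficients and with \<open>gen_poly\<close> followed by
  \<open>to_fract\<close> for rational functions in \<open>x\<close>.\<close>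

definition localization :: "('r::comm_ring_1 \<Rightarrow> 'f::field) \<Rightarrow> 'r \<Rightarrow> 'f set" where
  "localization f P = {c. \<exists>n d e k. f d \<noteq> 0 \<and> c = f n / f d \<and> f (d * e) = f (P ^ k)}"

definition frac_eval :: "('r::comm_ring_1 \<Rightarrow> 'f::field) \<Rightarrow> ('r \<Rightarrow> 'k::field) \<Rightarrow> 'f \<Rightarrow> 'k" where
  "frac_eval f ev c = (THE v. \<exists>n d. (f d \<noteq> 0 \<and> c = f n / f d) \<and> ev d \<noteq> 0 \<and> v = ev n / ev d)"

lemma localizationI: "f d \<noteq> 0 \<Longrightarrow> c = f n / f d \<Longrightarrow> f (d * e) = f (P ^ k) \<Longrightarrow> c \<in> localization f P"
  unfolding localization_def by blast

context
  fixes f :: "'r::comm_ring_1 \<Rightarrow> 'f::field"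
  assumes f: "comm_ring_hom f"
begin

private lemmas fD = comm_ring_homD[OF f]

lemma localization_image: "f r \<in> localization f P"
  by (rule localizationI[where d = 1 and n = r and e = 1 and k = 0]) (simp_all add: fD)

lemma is_subring_localization: "is_subring (localization f P)"
  unfolding is_subring_def
proof (intro conjI ballI)
  show "0 \<in> localization f P" "1 \<in> localization f P"
    using localization_image[of 0 P] localization_image[of 1 P] by (simp_all add: fD)
next
  fix x assume "x \<in> localization f P"
  then obtain n d e k where "f d \<noteq> 0" "x = f n / f d" "f (d * e) = f (P ^ k)"
    unfolding localization_def by blast
  then show "- x \<in> localization f P"
    by (intro localizationI[where n = "- n" and d = d and e = e and k = k]) (simp_all add: fD)
next
  fix x y assume "x \<in> localization f P" "y \<in> localization f P"
  then obtain n d e k n' d' e' k' where x: "f d \<noteq> 0" "x = f n / f d" "f (d * e) = f (P ^ k)"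
    and y: "f d' \<noteq> 0" "y = f n' / f d'" "f (d' * e') = f (P ^ k')"
    unfolding localization_def by blast
  have "f (d * d' * (e * e')) = f (d * e) * f (d' * e')" by (simp add: fD mult_ac)
  then have P: "f (d * d' * (e * e')) = f (P ^ (k + k'))"
    unfolding x y by (simp add: fD power_add)
  show "x + y \<in> localization f P"
    by (rule localizationI[where n = "n * d' + n' * d", OF _ _ P]) (use x y in \<open>simp_all add: fD add_frac_eq\<close>)
  show "x * y \<in> localization f P"
    by (rule localizationI[where n = "n * n'", OF _ _ P]) (use x y in \<open>simp_all add: fD\<close>)
qed

lemma localization_inverse:
  assumes "r * t = P" "f r \<noteq> 0"
  shows "1 / f r \<in> localization f P"
  by (rule localizationI[where n = 1 and d = r and e = t and k = 1]) (use assms in \<open>simp_all add: fD\<close>)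

context
  fixes ev :: "'r \<Rightarrow> 'k::field"
  assumes ev: "comm_ring_hom ev" and ker: "\<And>p. f p = 0 \<Longrightarrow> ev p = 0"
begin

private lemmas evD = comm_ring_homD[OF ev]

lemma ev_cong: "f p = f q \<Longrightarrow> ev p = ev q"
  using ker[of "p - q"] by (simp add: fD evD)

text \<open>Cross-multiplying two representations of \<open>c\<close> gives an equation in the image
  of \<open>f\<close>; by the kernel condition it holds for \<open>ev\<close> too, so the value does
  not depend on the representation. For extensions the kernel condition comes from
  \<open>compatible_point\<close>.\<close>

lemma frac_eval_eq:
  assumes d: "f d \<noteq> 0" "c = f n / f d" "ev d \<noteq> 0"
  shows "frac_eval f ev c = ev n / ev d"
  unfolding frac_eval_def
proof (rule the_equality)
  show "\<exists>n' d'. (f d' \<noteq> 0 \<and> c = f n' / f d') \<and> ev d' \<noteq> 0 \<and> ev n / ev d = ev n' / ev d'"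
    using d by blast
  fix v assume "\<exists>n d. (f d \<noteq> 0 \<and> c = f n / f d) \<and> ev d \<noteq> 0 \<and> v = ev n / ev d"
  then obtain n' d' where d': "f d' \<noteq> 0" "c = f n' / f d'" "ev d' \<noteq> 0" "v = ev n' / ev d'" by blast
  have "f (n' * d) = f (n * d')" using d d' by (simp add: fD frac_eq_eq)
  then have "ev (n' * d) = ev (n * d')" by (rule ev_cong)
  then show "v = ev n / ev d" using d d' by (simp add: evD frac_eq_eq)
qed

lemma frac_eval_image: "frac_eval f ev (f r) = ev r"
  using frac_eval_eq[of 1 "f r" r] by (simp add: fD evD)

text \<open>A factor of a power of \<open>P\<close> cannot vanish where \<open>P\<close> does not;
  the kernel condition carries the factorisation over from \<open>f\<close> to
  \<open>ev\<close>.\<close>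

lemma denominator_ev_nonzero:
  assumes "f (d * e) = f (P ^ k)" "ev P \<noteq> 0"
  shows "ev d \<noteq> 0"
  using ev_cong[OF assms(1)] assms(2) by (auto simp: evD)

lemma partial_hom_frac_eval:
  assumes P: "ev P \<noteq> 0"
  shows "partial_hom (localization f P) (frac_eval f ev)"
proof
  show "is_subring (localization f P)" by (rule is_subring_localization)
  show "frac_eval f ev 1 = 1" using frac_eval_image[of 1] by (simp add: fD evD)
next
  fix x y assume "x \<in> localization f P" "y \<in> localization f P"
  then obtain n d e k n' d' e' k' where x: "f d \<noteq> 0" "x = f n / f d" "f (d * e) = f (P ^ k)"
    and y: "f d' \<noteq> 0" "y = f n' / f d'" "f (d' * e') = f (P ^ k')"
    unfolding localization_def by blast
  have nz: "ev d \<noteq> 0" "ev d' \<noteq> 0" using denominator_ev_nonzero x y P by blast+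
  have "frac_eval f ev (x + y) = ev (n * d' + n' * d) / ev (d * d')"
    by (rule frac_eval_eq) (use x y nz in \<open>simp_all add: fD evD add_frac_eq\<close>)
  moreover have "frac_eval f ev (x * y) = ev (n * n') / ev (d * d')"
    by (rule frac_eval_eq) (use x y nz in \<open>simp_all add: fD evD\<close>)
  moreover have "frac_eval f ev x = ev n / ev d" "frac_eval f ev y = ev n' / ev d'"
    using frac_eval_eq x y nz by blast+
  ultimately show "frac_eval f ev (x + y) = frac_eval f ev x + frac_eval f ev y"
    "frac_eval f ev (x * y) = frac_eval f ev x * frac_eval f ev y"
    using nz by (simp_all add: evD add_frac_eq)
qed

end

end

section \<open>Regular coefficients and regular fractions\<close>

definition regular_coeffs ::
    "('y::linorder, 'a::field) param_ext \<Rightarrow> ('y, 'a) ypoly set \<Rightarrow> ('y, 'a) univ set" where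
  "regular_coeffs E N = {c. coeff_regular E N c}"

definition regular_fracts ::
    "('y::linorder, 'a::field) param_ext \<Rightarrow> ('y, 'a) yxpoly set \<Rightarrow> ('y, 'a) univ poly fract set" where
  "regular_fracts E N = {q. \<exists>n d. is_fraction E q n d \<and> denominator_from E N d}"

lemma is_fraction_iff:
  "is_fraction E q n d \<longleftrightarrow> to_fract (gen_poly E d) \<noteq> 0 \<and> q = to_fract (gen_poly E n) / to_fract (gen_poly E d)"
  unfolding is_fraction_def by (auto simp: Fract_conv_to_fract)

lemma regular_coeffs_localization: "regular_coeffs E N = localization (gen_eval E) (\<Prod>N)"
  unfolding regular_coeffs_def localization_def coeff_regular_def coeff_fraction_def by blast

lemma regular_fracts_localization:
  "regular_fracts E N = localization (\<lambda>p. to_fract (gen_poly E p)) (\<Prod>N)"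
  unfolding regular_fracts_def localization_def denominator_from_def is_fraction_iff to_fract_eq_iff
  by blast

lemma eval_coeff_frac_eval: "eval_coeff E a = frac_eval (gen_eval E) (at_param a)"
  unfolding eval_coeff_def[abs_def] frac_eval_def[abs_def] coeff_fraction_def ..

lemma eval_fract_frac_eval:
  "eval_fract E a \<xi> = frac_eval (\<lambda>p. to_fract (gen_poly E p)) (at_point a \<xi>)"
  unfolding eval_fract_def[abs_def] frac_eval_def[abs_def] is_fraction_iff ..

lemma comm_ring_hom_at_param:
  "comm_ring_hom (at_param (a :: 'y::{finite,linorder} \<Rightarrow> 'a::field alg_closure))"
  by (rule comm_ring_hom_ypoly_eval[OF comm_ring_hom_to_ac])

lemma comm_ring_hom_at_point:
  "comm_ring_hom (at_point (a :: 'y::{finite,linorder} \<Rightarrow> 'a::field alg_closure) \<xi>)"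
  unfolding at_point_def[abs_def] at_params_x_def
  by (intro comm_ring_hom_comp[OF comm_ring_hom_poly] comm_ring_hom_map_poly comm_ring_hom_at_param)

lemma comm_ring_hom_fract_gen_poly:
  "comm_ring_hom (\<lambda>p. to_fract (gen_poly (E :: ('y::{finite,linorder}, 'a::field) param_ext) p))"
  by (rule comm_ring_hom_comp[OF comm_ring_hom_to_fract comm_ring_hom_gen_poly])

lemma at_point_const:
  fixes a :: "'y::{finite,linorder} \<Rightarrow> 'a::field alg_closure"
  shows "at_point a \<xi> [:p:] = at_param a p"
  by (simp add: at_point_def at_params_x_def map_poly_pCons_zero comm_ring_homD(1)[OF comm_ring_hom_at_param])

lemma gen_poly_pCons:
  "gen_poly (E :: ('y::{finite,linorder}, 'a::field) param_ext) (pCons c p) = pCons (gen_eval E c) (gen_poly E p)"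
  by (simp add: gen_poly_def map_poly_pCons_zero comm_ring_homD(1)[OF comm_ring_hom_gen_eval])

context
  fixes E :: "('y::{finite,linorder}, 'a::field) param_ext"
begin

lemma compatible_at_point:
  assumes "compatible_point E a" "to_fract (gen_poly E p) = 0"
  shows "at_point a \<xi> p = 0"
proof -
  have "gen_poly E p = 0" using assms(2) by simp
  then have "gen_eval E (coeff p k) = 0" for k by (metis coeff_0 coeff_gen_poly)
  then have "at_param a (coeff p k) = 0" for k
    using assms(1) unfolding compatible_point_def by blast
  then have "at_params_x a p = 0"
    unfolding at_params_x_def
    by (simp add: poly_eq_iff coeff_map_poly comm_ring_homD(1)[OF comm_ring_hom_at_param])
  then show ?thesis by (simp add: at_point_def)
qed

lemma partial_hom_eval_coeff:
  assumes "finite N" "compatible_point E a" "\<And>p. p \<in> N \<Longrightarrow> at_param a p \<noteq> 0"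
  shows "partial_hom (regular_coeffs E N) (eval_coeff E a)"
  unfolding regular_coeffs_localization eval_coeff_frac_eval
proof (rule partial_hom_frac_eval[OF comm_ring_hom_gen_eval comm_ring_hom_at_param])
  show "at_param a (\<Prod>N) \<noteq> 0" using assms by (simp add: comm_ring_homD[OF comm_ring_hom_at_param])
qed (use assms in \<open>auto simp: compatible_point_def\<close>)

lemma at_point_prod_nonzero:
  fixes a :: "'y::{finite,linorder} \<Rightarrow> 'a::field alg_closure"
  assumes "finite N" "\<And>p. p \<in> N \<Longrightarrow> at_point a \<xi> p \<noteq> 0"
  shows "at_point a \<xi> (\<Prod>N) \<noteq> 0"
  using assms by (simp add: comm_ring_homD[OF comm_ring_hom_at_point])

lemma partial_hom_eval_fract:
  assumes "finite N" "compatible_point E a" "\<And>p. p \<in> N \<Longrightarrow> at_point a \<xi> p \<noteq> 0"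
  shows "partial_hom (regular_fracts E N) (eval_fract E a \<xi>)"
  unfolding regular_fracts_localization eval_fract_frac_eval
  by (rule partial_hom_frac_eval[OF comm_ring_hom_fract_gen_poly comm_ring_hom_at_point
        compatible_at_point[OF assms(2)] at_point_prod_nonzero[OF assms(1,3)]])

lemma eval_fract_image:
  assumes "compatible_point E a"
  shows "eval_fract E a \<xi> (to_fract (gen_poly E p)) = at_point a \<xi> p"
  unfolding eval_fract_frac_eval
  using frac_eval_image[OF comm_ring_hom_fract_gen_poly comm_ring_hom_at_point, of E a \<xi> p]
    compatible_at_point[OF assms] by blast

lemma eval_fract_is_fraction:
  assumes "compatible_point E a" "is_fraction E q n d" "at_point a \<xi> d \<noteq> 0"
  shows "eval_fract E a \<xi> q = at_point a \<xi> n / at_point a \<xi> d"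
  unfolding eval_fract_frac_eval
  using frac_eval_eq[OF comm_ring_hom_fract_gen_poly comm_ring_hom_at_point, of E a \<xi> d q n]
    compatible_at_point[OF assms(1)] assms(2,3) unfolding is_fraction_iff by blast

lemma denominator_from_nonzero:
  assumes "finite N" "compatible_point E a" "\<And>p. p \<in> N \<Longrightarrow> at_point a \<xi> p \<noteq> 0"
    and "denominator_from E N d"
  shows "at_point a \<xi> d \<noteq> 0"
proof -
  obtain e k where "gen_poly E (d * e) = gen_poly E ((\<Prod>N) ^ k)"
    using assms(4) unfolding denominator_from_def by blast
  then have "to_fract (gen_poly E (d * e)) = to_fract (gen_poly E ((\<Prod>N) ^ k))" by simp
  from denominator_ev_nonzero[OF comm_ring_hom_fract_gen_poly comm_ring_hom_at_point _ this]
  show ?thesis using compatible_at_point[OF assms(2)] at_point_prod_nonzero[OF assms(1,3)] by blast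
qed

lemma denominator_from_mono:
  assumes "denominator_from E N d" "N \<subseteq> N'" "finite N'"
  shows "denominator_from E N' d"
proof -
  interpret g: comm_ring_hom "gen_poly E" by (rule comm_ring_hom_gen_poly)
  obtain e k where e: "gen_poly E (d * e) = gen_poly E ((\<Prod>N) ^ k)"
    using assms(1) unfolding denominator_from_def by blast
  have N': "\<Prod>N' = \<Prod>(N' - N) * \<Prod>N" using assms by (intro prod.subset_diff)
  have "gen_poly E (d * (e * (\<Prod>(N' - N)) ^ k)) = gen_poly E (d * e) * gen_poly E ((\<Prod>(N' - N)) ^ k)"
    by (simp add: g.hom_mult mult_ac)
  also have "\<dots> = gen_poly E ((\<Prod>N') ^ k)"
    unfolding e N' by (simp add: g.hom_mult g.hom_power power_mult_distrib mult_ac)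
  finally show ?thesis unfolding denominator_from_def by blast
qed

lemma regular_fracts_mono:
  assumes "N \<subseteq> N'" "finite N'"
  shows "regular_fracts E N \<subseteq> regular_fracts E N'"
  using denominator_from_mono[OF _ assms] unfolding regular_fracts_def by blast

lemma is_subring_regular_coeffs: "is_subring (regular_coeffs E N)"
  unfolding regular_coeffs_localization by (rule is_subring_localization[OF comm_ring_hom_gen_eval])

lemma is_subring_regular_fracts: "is_subring (regular_fracts E N)"
  unfolding regular_fracts_localization by (rule is_subring_localization[OF comm_ring_hom_fract_gen_poly])

lemma gen_poly_regular_fracts:
  shows "to_fract (gen_poly E p) \<in> regular_fracts E N"
  unfolding regular_fracts_localization by (rule localization_image[OF comm_ring_hom_fract_gen_poly])

text \<open>With \<open>q = n / d\<close> the inverse is \<open>d / n\<close>, and \<open>n\<close>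
  divides the product of \<open>N\<close>. This is how putting the numerator of \<open>s r\<close>
  into the nonvanishing set makes \<open>1 / s r\<close> available.\<close>

lemma regular_fracts_inverse:
  assumes "finite N" "is_fraction E q n d" "n \<in> N" "q \<noteq> 0"
  shows "1 / q \<in> regular_fracts E N"
proof -
  have "1 / to_fract (gen_poly E n) \<in> regular_fracts E N"
    unfolding regular_fracts_localization
  proof (rule localization_inverse[OF comm_ring_hom_fract_gen_poly])
    show "n * \<Prod>(N - {n}) = \<Prod>N" using assms(1,3) by (simp add: prod.remove)
    show "to_fract (gen_poly E n) \<noteq> 0" using assms(2,4) by (auto simp: is_fraction_iff)
  qed
  then have "to_fract (gen_poly E d) * (1 / to_fract (gen_poly E n)) \<in> regular_fracts E N"
    using is_subringD(6)[OF is_subring_regular_fracts] gen_poly_regular_fracts by blast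
  then show ?thesis using assms(2) by (simp add: is_fraction_iff)
qed

text \<open>Connects two ways of evaluating: \<open>eval_poly_Y\<close>, in terms of which Smith
  regimes are specified, and \<open>eval_fract\<close>, in terms of which solution regimes are. The
  induction follows Horner's scheme, using that both coefficient and fraction evaluation are
  homomorphisms on regular elements.\<close>

lemma regular_polys_fract:
  assumes N: "(\<lambda>p. [:p:]) ` N0 \<subseteq> N" "finite N"
  shows "p \<in> polys_over (regular_coeffs E N0) \<Longrightarrow> to_fract p \<in> regular_fracts E N \<and>
    (compatible_point E a \<longrightarrow> (\<forall>q\<in>N. at_point a \<xi> q \<noteq> 0) \<longrightarrow>
       eval_fract E a \<xi> (to_fract p) = poly (eval_poly_Y E a p) \<xi>)"
proof (induction p)
  case 0
  have "eval_fract E a \<xi> 0 = 0" if "compatible_point E a"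
    using eval_fract_image[OF that, of \<xi> 0] 
    by (simp add: comm_ring_homD[OF comm_ring_hom_gen_poly] comm_ring_homD[OF comm_ring_hom_at_point])
  then show ?case using is_subringD(1)[OF is_subring_regular_fracts, of N] by (simp add: eval_poly_Y_def)
next
  case (pCons c p)
  interpret g: comm_ring_hom "gen_eval E" by (rule comm_ring_hom_gen_eval)
  have c: "c \<in> regular_coeffs E N0" using polys_over_coeff[OF pCons.prems, of 0] by simp
  have p: "p \<in> polys_over (regular_coeffs E N0)"
    using polys_over_coeff[OF pCons.prems, of "Suc _"] by (simp add: polys_over_def)
  obtain n d e k where nd: "gen_eval E d \<noteq> 0" "c = gen_eval E n / gen_eval E d"
    "gen_eval E (d * e) = gen_eval E ((\<Prod>N0) ^ k)"
    using c unfolding regular_coeffs_def coeff_regular_def coeff_fraction_def by blast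
  have inj: "inj_on (\<lambda>p::('y, 'a) ypoly. [:p:]) N0" by (simp add: inj_on_def)
  have "\<Prod>((\<lambda>p. [:p:]) ` N0) = [:\<Prod>N0:]"
    unfolding prod.reindex[OF inj] o_def using comm_ring_homD(9)[OF comm_ring_hom_const_poly, of id N0] by simp
  moreover have "[:\<Prod>N0:] ^ k = [:(\<Prod>N0) ^ k:]" 
    using comm_ring_homD(7)[OF comm_ring_hom_const_poly, of "\<Prod>N0" k] by simp
  moreover have "gen_poly E ([:d:] * [:e:]) = gen_poly E [:(\<Prod>N0) ^ k:]"
    using nd(3) by (simp add: gen_poly_pCons mult.commute)
  ultimately have "denominator_from E ((\<lambda>p. [:p:]) ` N0) [:d:]"
    unfolding denominator_from_def by metis
  then have den: "denominator_from E N [:d:]" using denominator_from_mono N by blast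
  have "[:c:] * gen_poly E [:d:] = gen_poly E [:n:]" 
    using nd by (simp add: gen_poly_pCons comm_ring_homD(1)[OF comm_ring_hom_gen_poly])
  then have "to_fract [:c:] * to_fract (gen_poly E [:d:]) = to_fract (gen_poly E [:n:])"
    by (metis to_fract_mult)
  moreover have d0: "to_fract (gen_poly E [:d:]) \<noteq> 0" using nd by (simp add: gen_poly_pCons)
  ultimately have frac: "is_fraction E (to_fract [:c:]) [:n:] [:d:]"
    unfolding is_fraction_iff by (simp add: field_simps)
  then have cL: "to_fract [:c:] \<in> regular_fracts E N" using den unfolding regular_fracts_def by blast
  have X: "to_fract [:0, 1:] = to_fract (gen_poly E [:0, 1:])"
    by (simp add: gen_poly_pCons comm_ring_homD[OF comm_ring_hom_gen_poly])
  have XL: "to_fract [:0, 1:] \<in> regular_fracts E N" unfolding X by (rule gen_poly_regular_fracts)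
  have "pCons c p = [:c:] + [:0, 1:] * p" by (simp add: mult.commute)
  then have split: "to_fract (pCons c p) = to_fract [:c:] + to_fract [:0, 1:] * to_fract p"
    by (metis to_fract_add to_fract_mult)
  have pL: "to_fract p \<in> regular_fracts E N" using pCons.IH p by blast
  note LD = is_subringD[OF is_subring_regular_fracts[of N]]
  show ?case
  proof (intro conjI impI)
    show "to_fract (pCons c p) \<in> regular_fracts E N" unfolding split by (intro LD cL XL pL)
    assume comp: "compatible_point E a" and nz: "\<forall>q\<in>N. at_point a \<xi> q \<noteq> 0"
    interpret ph: partial_hom "regular_fracts E N" "eval_fract E a \<xi>"
      by (rule partial_hom_eval_fract) (use N comp nz in auto)
    have "at_param a q \<noteq> 0" if "q \<in> N0" for q
      using nz N that at_point_const by (metis image_subset_iff)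
    moreover have "finite N0" using finite_imageD[OF finite_subset[OF N] inj] .
    ultimately interpret pc: partial_hom "regular_coeffs E N0" "eval_coeff E a"
      using partial_hom_eval_coeff[OF _ comp] by blast
    have dnz: "at_point a \<xi> [:d:] \<noteq> 0" using denominator_from_nonzero[OF N(2) comp _ den] nz by blast
    have "eval_coeff E a c = at_param a n / at_param a d"
      unfolding eval_coeff_frac_eval
      by (rule frac_eval_eq[OF comm_ring_hom_gen_eval comm_ring_hom_at_param])
        (use comp nd dnz in \<open>auto simp: compatible_point_def at_point_const\<close>)
    then have 1: "eval_fract E a \<xi> (to_fract [:c:]) = eval_coeff E a c"
      using eval_fract_is_fraction[OF comp frac dnz] by (simp add: at_point_const)
    have 2: "eval_fract E a \<xi> (to_fract [:0, 1:]) = \<xi>"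
      unfolding X eval_fract_image[OF comp] at_point_def at_params_x_def
      by (simp add: map_poly_pCons_zero comm_ring_homD[OF comm_ring_hom_at_param])
    have "eval_fract E a \<xi> (to_fract (pCons c p)) = eval_coeff E a c + \<xi> * poly (eval_poly_Y E a p) \<xi>"
      unfolding split using pCons.IH p comp nz
      by (simp add: ph.ev_add ph.ev_mult LD cL XL pL 1 2)
    then show "eval_fract E a \<xi> (to_fract (pCons c p)) = poly (eval_poly_Y E a (pCons c p)) \<xi>"
      unfolding eval_poly_Y_def by (simp add: map_poly_pCons_zero pc.ev_0)
  qed
qed

lemma ext_field_fraction:
  assumes "c \<in> ext_field E"
  shows "\<exists>n d. gen_eval E d \<noteq> 0 \<and> c = gen_eval E n / gen_eval E d"
proof -
  interpret g: comm_ring_hom "gen_eval E" by (rule comm_ring_hom_gen_eval)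
  let ?K = "localization (gen_eval E) 0"
  have K: "c \<in> ?K \<longleftrightarrow> (\<exists>n d. gen_eval E d \<noteq> 0 \<and> c = gen_eval E n / gen_eval E d)" for c
  proof
    assume "\<exists>n d. gen_eval E d \<noteq> 0 \<and> c = gen_eval E n / gen_eval E d"
    then obtain n d where "gen_eval E d \<noteq> 0" "c = gen_eval E n / gen_eval E d" by blast
    then show "c \<in> ?K" by (rule localizationI[where e = 0 and k = 1]) simp
  qed (auto simp: localization_def)
  have sub: "is_subring ?K" by (rule is_subring_localization[OF comm_ring_hom_gen_eval])
  have "is_subfield ?K" unfolding is_subfield_def
  proof (intro conjI ballI)
    fix x assume x: "x \<in> ?K"
    show "inverse x \<in> ?K"
    proof (cases "x = 0")
      case True
      then show ?thesis using x by simp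
    next
      case False
      obtain n d where nd: "gen_eval E d \<noteq> 0" "x = gen_eval E n / gen_eval E d" using x K by blast
      then have "gen_eval E n \<noteq> 0" "inverse x = gen_eval E d / gen_eval E n" using False by auto
      then show ?thesis using K by blast
    qed
  qed (auto intro: is_subringD[OF sub])
  moreover have "range const_univ \<subseteq> ?K"
  proof safe
    fix c :: 'a
    have "const_univ c = gen_eval E (Poly_Mapping.single 0 c)"
      unfolding gen_eval_def by (simp add: ypoly_eval_single[OF comm_ring_hom_const_univ])
    then show "const_univ c \<in> ?K" using localization_image[OF comm_ring_hom_gen_eval] by simp
  qed
  moreover have "range (ext_gen E) \<subseteq> ?K"
  proof safe
    fix i
    have "ext_gen E i = gen_eval E (param_var i)"
      unfolding gen_eval_def param_var_def by (rule ypoly_eval_param_var[OF comm_ring_hom_const_univ, symmetric])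
    then show "ext_gen E i \<in> ?K" using localization_image[OF comm_ring_hom_gen_eval] by simp
  qed
  ultimately have "ext_field E \<subseteq> ?K" unfolding ext_field_def by (rule adjoin_least)
  then show ?thesis using K assms by blast
qed

lemma gen_eval_ext_field: "gen_eval E p \<in> ext_field E"
  unfolding ext_field_def by (rule gen_eval_in_adjoin) simp

text \<open>\<open>M\<close> is a multiplicative set of permitted denominators: all of
  \<open>F[Y]\<close> when any common denominator will do, the divisors of powers of the product of
  \<open>N\<close> when regularity has to be kept.\<close>

lemma common_denominator:
  assumes M: "1 \<in> M" "\<And>x y. x \<in> M \<Longrightarrow> y \<in> M \<Longrightarrow> x * y \<in> M"
  shows "(\<And>k. \<exists>n d. d \<in> M \<and> gen_eval E d \<noteq> 0 \<and> coeff p k = gen_eval E n / gen_eval E d) \<Longrightarrow>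
    \<exists>n d. d \<in> M \<and> gen_eval E d \<noteq> 0 \<and> gen_poly E n = smult (gen_eval E d) p"
proof (induction p)
  case 0
  show ?case
    by (rule exI[of _ 0], rule exI[of _ 1])
      (simp add: M comm_ring_homD[OF comm_ring_hom_gen_eval] comm_ring_homD[OF comm_ring_hom_gen_poly])
next
  case (pCons c p)
  have "\<exists>n d. d \<in> M \<and> gen_eval E d \<noteq> 0 \<and> coeff p k = gen_eval E n / gen_eval E d" for k
    using pCons.prems[of "Suc k"] by simp
  then obtain n d where nd: "d \<in> M" "gen_eval E d \<noteq> 0" "gen_poly E n = smult (gen_eval E d) p"
    using pCons.IH by blast
  obtain n0 d0 where 0: "d0 \<in> M" "gen_eval E d0 \<noteq> 0" "c = gen_eval E n0 / gen_eval E d0"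
    using pCons.prems[of 0] by auto
  interpret g: comm_ring_hom "gen_eval E" by (rule comm_ring_hom_gen_eval)
  interpret gp: comm_ring_hom "gen_poly E" by (rule comm_ring_hom_gen_poly)
  have "gen_poly E (pCons (n0 * d) ([:d0:] * n)) =
    pCons (gen_eval E n0 * gen_eval E d) (smult (gen_eval E d0) (gen_poly E n))"
    unfolding gen_poly_pCons gp.hom_mult g.hom_mult by (simp add: gp.hom_zero)
  also have "\<dots> = smult (gen_eval E (d0 * d)) (pCons c p)"
    unfolding nd(3) using 0 by (simp add: g.hom_mult)
  finally show ?case using M(2) nd 0 g.hom_mult by (metis no_zero_divisors)
qed

end

section \<open>Denominators in lowest terms\<close>

text \<open>As \<open>s\<close> is monic, \<open>c\<close> has the leading coefficient of
  \<open>s * c\<close>, which lies in \<open>L\<close>; removing that leading term from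
  \<open>c\<close> leaves a shorter quotient of the same kind. Nothing is assumed about the
  coefficients of \<open>c\<close>, which may come from a larger field.\<close>

lemma monic_quotient_polys_over:
  fixes s :: "'b::idom poly"
  assumes L: "is_subring L" and s: "s \<in> polys_over L" "lead_coeff s = 1"
  shows "s * c \<in> polys_over L \<Longrightarrow> c \<in> polys_over L"
proof (induction "length (coeffs c)" arbitrary: c rule: less_induct)
  case less
  note PD = is_subringD[OF is_subring_polys_over[OF L]]
  show ?case
  proof (cases "c = 0")
    case True
    then show ?thesis using PD(1) by simp
  next
    case False
    let ?m = "monom (lead_coeff c) (degree c)"
    have "lead_coeff c = coeff (s * c) (degree (s * c))"
      using s(2) by (simp only: lead_coeff_mult mult_1_left)
    then have "lead_coeff c \<in> L" using polys_over_coeff[OF less.prems] by metis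
    then have m: "?m \<in> polys_over L" by (rule polys_over_monom[OF L])
    have "s * (c - ?m) = s * c - s * ?m" by (rule right_diff_distrib)
    then have "s * (c - ?m) \<in> polys_over L" using PD(5,6) less.prems s(1) m by metis
    then have "c - ?m \<in> polys_over L" using less.hyps length_coeffs_diff_monom[OF False] by blast
    then have "c - ?m + ?m \<in> polys_over L" using PD(4) m by blast
    then show ?thesis by simp
  qed
qed

lemma gen_poly_eq_0_iff:
  fixes E :: "('y::{finite,linorder}, 'a::field) param_ext"
  assumes "parameterized_extension E" "purely_transcendental E"
  shows "gen_poly E p = 0 \<longleftrightarrow> p = 0"
  by (simp add: poly_eq_iff coeff_gen_poly gen_eval_eq_0_iff[OF assms])

lemma gen_poly_eq_iff:
  fixes E :: "('y::{finite,linorder}, 'a::field) param_ext"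
  assumes "parameterized_extension E" "purely_transcendental E"
  shows "gen_poly E p = gen_poly E q \<longleftrightarrow> p = q"
proof
  assume "gen_poly E p = gen_poly E q"
  then have "gen_poly E (p - q) = 0" by (simp add: comm_ring_homD[OF comm_ring_hom_gen_poly])
  then show "p = q" using gen_poly_eq_0_iff[OF assms] by simp
qed simp

text \<open>In the algebraic case the bound on the denominator is part of admissibility. In the
  transcendental case \<open>d\<close> is coprime to \<open>n\<close> and divides
  \<open>n * d0\<close> for every denominator \<open>d0\<close> of the same fraction, hence divides
  \<open>d0\<close>, and one such \<open>d0\<close> comes from \<open>N\<close>.\<close>

lemma fraction_choice_denominator:
  fixes E :: "('y::{finite,linorder}, 'a::field) param_ext"
  assumes \<rho>: "fraction_choice \<rho>" and E: "parameterized_extension E" and q: "q \<in> regular_fracts E N"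
  shows "is_fraction E q (fst (\<rho> E N q)) (snd (\<rho> E N q))" "denominator_from E N (snd (\<rho> E N q))"
proof -
  interpret g: comm_ring_hom "gen_poly E" by (rule comm_ring_hom_gen_poly)
  obtain n0 d0 where 0: "is_fraction E q n0 d0" "denominator_from E N d0"
    using q unfolding regular_fracts_def by blast
  obtain n d where nd: "\<rho> E N q = (n, d)" by (cases "\<rho> E N q")
  have "is_fraction E q n d \<and> denominator_from E N d"
  proof (cases "purely_transcendental E")
    case False
    then have "admissible_fraction E N q (n0, d0)" using 0 by (simp add: admissible_fraction_def)
    then have "admissible_fraction E N q (n, d)" using \<rho> nd unfolding fraction_choice_def by metis
    then show ?thesis using False by (simp add: admissible_fraction_def)
  next
    case True
    have "d0 \<noteq> 0" using 0 by (auto simp: is_fraction_iff g.hom_zero)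
    then obtain h n1 d1 where 1: "n0 = h * n1" "d0 = h * d1" and co1: "\<forall>e. e dvd n1 \<and> e dvd d1 \<longrightarrow> e dvd 1"
      using factorial_remove_common_factor[OF factorial_yxpoly] by blast
    have "is_fraction E q n1 d1" using 0(1) unfolding is_fraction_iff 1 g.hom_mult to_fract_mult by auto
    \<comment> \<open>\<open>fraction_choice\<close> constrains \<open>\<rho>\<close> only where an
      admissible pair exists; the cancelled pair supplies one.\<close>
    then have "admissible_fraction E N q (n1, d1)" using co1 True by (simp add: admissible_fraction_def)
    then have "admissible_fraction E N q (n, d)" using \<rho> nd unfolding fraction_choice_def by metis
    then have fr: "is_fraction E q n d" and co: "\<forall>e. e dvd n \<and> e dvd d \<longrightarrow> e dvd 1"
      using True by (auto simp: admissible_fraction_def)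
    have "to_fract (gen_poly E (n * d0)) = to_fract (gen_poly E (n0 * d))"
      using fr 0(1) unfolding is_fraction_iff g.hom_mult to_fract_mult
      by (metis (no_types, lifting) frac_eq_eq)
    then have "n * d0 = n0 * d" using gen_poly_eq_iff[OF E True] by simp
    then have "d dvd n * d0" by simp
    moreover have "d \<noteq> 0" using fr by (auto simp: is_fraction_iff g.hom_zero)
    ultimately have "d dvd d0" using factorial_coprime_dvd_mult[OF factorial_yxpoly] co by blast
    then obtain c where c: "d0 = d * c" by (auto simp: dvd_def)
    show ?thesis using fr 0(2) unfolding denominator_from_def c by (metis mult.assoc)
  qed
  then show "is_fraction E q (fst (\<rho> E N q)) (snd (\<rho> E N q))" "denominator_from E N (snd (\<rho> E N q))"
    using nd by simp_all
qed

text \<open>The least common multiple divides the product of \<open>D\<close>, whose value is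
  nonzero. That the choice in \<open>yx_lcm\<close> has something to choose from is where unique
  factorisation enters.\<close>

lemma at_point_yx_lcm_nonzero:
  fixes a :: "'y::{finite,linorder} \<Rightarrow> 'a::field alg_closure"
  assumes D: "finite D" "\<And>d. d \<in> D \<Longrightarrow> at_point a \<xi> d \<noteq> 0"
  shows "at_point a \<xi> (yx_lcm D) \<noteq> 0"
proof -
  note hD = comm_ring_homD[OF comm_ring_hom_at_point[of a \<xi>]]
  have "0 \<notin> D" using D(2)[of 0] hD(1) by blast
  then obtain l where "(\<forall>d\<in>D. d dvd l) \<and> (\<forall>k. (\<forall>d\<in>D. d dvd k) \<longrightarrow> l dvd k)"
    using factorial_lcm_exists[OF factorial_yxpoly D(1)] by blast
  then have "(\<forall>d\<in>D. d dvd yx_lcm D) \<and> (\<forall>k. (\<forall>d\<in>D. d dvd k) \<longrightarrow> yx_lcm D dvd k)"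
    unfolding yx_lcm_def by (rule someI)
  moreover have "\<forall>d\<in>D. d dvd \<Prod>D" using D(1) by (auto intro: dvd_prodI)
  ultimately have "yx_lcm D dvd \<Prod>D" by blast
  then obtain c where "\<Prod>D = yx_lcm D * c" by (auto simp: dvd_def)
  moreover have "at_point a \<xi> (\<Prod>D) \<noteq> 0" using at_point_prod_nonzero D by blast
  ultimately show ?thesis by (auto simp: hD)
qed

lemma dvd_const_yxpoly:
  assumes "e dvd [:d:]" "(d :: 'b::idom) \<noteq> 0"
  shows "\<exists>e0. e = [:e0:]"
proof -
  have "degree e = 0" using dvd_imp_degree_le[OF assms(1)] assms(2) by simp
  then show ?thesis by (meson degree_eq_zeroE)
qed

text \<open>Since \<open>f\<close> is monic, the coefficient of \<open>n\<close> at
  \<open>degree f\<close> is \<open>d\<close> itself, so a constant dividing \<open>n\<close>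
  divides \<open>d\<close>. Together with coprimality this makes \<open>n\<close> primitive.\<close>

lemma monic_lowest_terms:
  fixes E :: "('y::{finite,linorder}, 'a::field) param_ext"
  assumes E: "parameterized_extension E" "purely_transcendental E"
    and f: "f \<in> polys_over (ext_field E)" "lead_coeff f = 1"
  shows "\<exists>n d. d \<noteq> 0 \<and> gen_poly E n = smult (gen_eval E d) f \<and>
    (\<forall>e. e dvd n \<longrightarrow> e dvd [:d:] \<longrightarrow> e dvd 1) \<and> (\<forall>c. [:c:] dvd n \<longrightarrow> c dvd d)"
proof -
  interpret g: comm_ring_hom "gen_eval E" by (rule comm_ring_hom_gen_eval)
  interpret gp: comm_ring_hom "gen_poly E" by (rule comm_ring_hom_gen_poly)
  note g0 = gen_eval_eq_0_iff[OF E]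
  have "\<exists>n d. d \<in> UNIV \<and> gen_eval E d \<noteq> 0 \<and> coeff f k = gen_eval E n / gen_eval E d" for k
    using ext_field_fraction[OF polys_over_coeff[OF f(1)]] by auto
  then obtain n0 d0 where 0: "gen_eval E d0 \<noteq> 0" "gen_poly E n0 = smult (gen_eval E d0) f"
    using common_denominator[of UNIV E f] by auto
  have d0: "d0 \<noteq> 0" "[:d0:] \<noteq> 0" using 0(1) by (auto simp: g0)
  obtain h n d' where h: "n0 = h * n" "[:d0:] = h * d'" and co: "\<forall>e. e dvd n \<and> e dvd d' \<longrightarrow> e dvd 1"
    using factorial_remove_common_factor[OF factorial_yxpoly d0(2), of n0]
    by (elim exE conjE) (rule that)
  have "h dvd [:d0:]" "d' dvd [:d0:]" unfolding h(2) by simp_all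
  then have "\<exists>h0. h = [:h0:]" "\<exists>d. d' = [:d:]" using dvd_const_yxpoly[OF _ d0(1)] by simp_all
  then obtain h0 d where c: "h = [:h0:]" "d' = [:d:]" by (elim exE) (rule that)
  have dd: "d0 = h0 * d" using h(2) unfolding c by (simp add: mult.commute)
  then have hd: "h0 \<noteq> 0" "d \<noteq> 0" using d0(1) by auto
  have "[:gen_eval E h0:] * gen_poly E n = [:gen_eval E h0:] * smult (gen_eval E d) f"
    using 0(2) unfolding h c dd gp.hom_mult g.hom_mult
    by (simp add: gen_poly_pCons gp.hom_zero mult.commute)
  moreover have "[:gen_eval E h0:] \<noteq> 0" using hd(1) g0[of h0] by simp
  ultimately have eq: "gen_poly E n = smult (gen_eval E d) f"
    by (simp only: mult_cancel_left) blast
  have lc: "coeff n (degree f) = d"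
  proof -
    have "gen_eval E (coeff n (degree f)) = gen_eval E d"
      using arg_cong[OF eq, of "\<lambda>p. coeff p (degree f)"] f(2)
      by (simp add: coeff_gen_poly)
    then have "gen_eval E (coeff n (degree f) - d) = 0" by (simp add: g.hom_minus)
    then show ?thesis unfolding g0 by simp
  qed
  show ?thesis
  proof (intro exI conjI allI impI)
    show "d \<noteq> 0" by (rule hd(2))
    show "gen_poly E n = smult (gen_eval E d) f" by (rule eq)
    show "e dvd 1" if "e dvd n" "e dvd [:d:]" for e using co c that by simp
    show "c dvd d" if "[:c:] dvd n" for c
      using that[unfolded const_poly_dvd_iff, rule_format, of "degree f"] lc by simp
  qed
qed

text \<open>
  Gauss' lemma in the form needed here: the denominator of a monic factor in lowest terms is prime
  to the numerators of both factors, hence divides any denominator of the product.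
\<close>

lemma monic_factor_regular:
  fixes E :: "('y::{finite,linorder}, 'a::field) param_ext"
  assumes E: "parameterized_extension E" "purely_transcendental E"
    and f: "f \<in> polys_over (ext_field E)" "lead_coeff f = 1"
    and g: "g \<in> polys_over (ext_field E)" "lead_coeff g = 1"
    and fg: "f * g \<in> polys_over (regular_coeffs E N)"
  shows "f \<in> polys_over (regular_coeffs E N)"
proof -
  interpret g: comm_ring_hom "gen_eval E" by (rule comm_ring_hom_gen_eval)
  interpret gp: comm_ring_hom "gen_poly E" by (rule comm_ring_hom_gen_poly)
  obtain n1 d1 where 1: "d1 \<noteq> 0" "gen_poly E n1 = smult (gen_eval E d1) f"
    "\<forall>e. e dvd n1 \<longrightarrow> e dvd [:d1:] \<longrightarrow> e dvd 1" "\<forall>c. [:c:] dvd n1 \<longrightarrow> c dvd d1"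
    using monic_lowest_terms[OF E f] by (elim exE conjE) (rule that)
  obtain n2 d2 where 2: "d2 \<noteq> 0" "gen_poly E n2 = smult (gen_eval E d2) g"
    "\<forall>e. e dvd n2 \<longrightarrow> e dvd [:d2:] \<longrightarrow> e dvd 1" "\<forall>c. [:c:] dvd n2 \<longrightarrow> c dvd d2"
    using monic_lowest_terms[OF E g] by (elim exE conjE) (rule that)
  \<comment> \<open>The denominators that become invertible when \<open>N\<close> is inverted; they
    form a multiplicative set, as \<open>common_denominator\<close> requires.\<close>
  let ?M = "{d. \<exists>e k. gen_eval E (d * e) = gen_eval E ((\<Prod>N) ^ k)}"
  have M1: "1 \<in> ?M" by (intro CollectI exI[of _ 1] exI[of _ 0]) simp
  have Mm: "x * y \<in> ?M" if xy: "x \<in> ?M" "y \<in> ?M" for x y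
  proof -
    obtain e k e' k' where "gen_eval E (x * e) = gen_eval E ((\<Prod>N) ^ k)" "gen_eval E (y * e') = gen_eval E ((\<Prod>N) ^ k')"
      using xy by blast
    then have "gen_eval E ((x * e) * (y * e')) = gen_eval E ((\<Prod>N) ^ (k + k'))"
      by (simp only: g.hom_mult power_add)
    moreover have "(x * e) * (y * e') = x * y * (e * e')" by (simp only: mult_ac)
    ultimately show ?thesis by auto
  qed
  have "\<exists>n d. d \<in> ?M \<and> gen_eval E d \<noteq> 0 \<and> coeff (f * g) k = gen_eval E n / gen_eval E d" for k
    using polys_over_coeff[OF fg, of k]
    unfolding regular_coeffs_def coeff_regular_def coeff_fraction_def by blast
  from common_denominator[OF M1 Mm this]
  obtain n0 d0 where 0: "d0 \<in> ?M" "gen_poly E n0 = smult (gen_eval E d0) (f * g)" by blast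
  have const: "gen_poly E [:d:] = [:gen_eval E d:]" for d by (simp add: gen_poly_pCons gp.hom_zero)
  have "gen_poly E (n1 * (n2 * [:d0:])) = gen_poly E ([:d1:] * ([:d2:] * n0))"
    unfolding gp.hom_mult const 0(2) 1(2) 2(2) by (simp add: mult_ac)
  then have eqn: "n1 * (n2 * [:d0:]) = [:d1:] * ([:d2:] * n0)" using gen_poly_eq_iff[OF E] by blast
  have "[:d1:] dvd n1 * (n2 * [:d0:])" unfolding eqn by (rule dvd_triv_left)
  moreover have d1: "[:d1:] \<noteq> 0" using 1(1) by simp
  ultimately have "[:d1:] dvd n2 * [:d0:]"
    using factorial_coprime_dvd_mult[OF factorial_yxpoly d1] 1(3) by blast
  \<comment> \<open>A divisor of \<open>[:d1:]\<close> is constant, and a constant dividing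
    \<open>n2\<close> divides \<open>d2\<close>; lowest terms of the second factor then make it a
    unit.\<close>
  moreover have "e dvd 1" if e: "e dvd [:d1:]" "e dvd n2" for e
  proof -
    obtain e0 where e0: "e = [:e0:]" using dvd_const_yxpoly[OF e(1) 1(1)] by (rule exE)
    then have "e dvd [:d2:]" using 2(4) e(2) by simp
    then show ?thesis using 2(3) e(2) by blast
  qed
  ultimately have "[:d1:] dvd [:d0:]"
    using factorial_coprime_dvd_mult[OF factorial_yxpoly d1] by blast
  then have "d1 dvd d0" by simp
  then obtain c where c: "d0 = d1 * c" by (auto simp: dvd_def)
  obtain e k where "gen_eval E (d0 * e) = gen_eval E ((\<Prod>N) ^ k)" using 0(1) by blast
  then have e: "gen_eval E (d1 * (c * e)) = gen_eval E ((\<Prod>N) ^ k)" unfolding c by (simp only: mult.assoc)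
  have d1': "gen_eval E d1 \<noteq> 0" using 1(1) gen_eval_eq_0_iff[OF E] by simp
  have "coeff f k = gen_eval E (coeff n1 k) / gen_eval E d1" for k
    using arg_cong[OF 1(2), of "\<lambda>p. coeff p k"] d1' by (simp add: coeff_gen_poly)
  then have "coeff_regular E N (coeff f k)" for k
    using e d1' unfolding coeff_regular_def coeff_fraction_def by blast
  then show ?thesis by (simp add: polys_over_def regular_coeffs_def)
qed


section \<open>Square-free parts\<close>

context
  fixes K :: "'k::field set"
  assumes K: "is_subfield K"
begin

private abbreviation "PK \<equiv> polys_over K"

private lemma subK: "is_subring K"
  by (rule is_subring_subfield[OF K])

private lemma factK: "factorial_subring K"
proof (rule factorial_subring_field[OF subK])
  fix x assume "x \<in> K" "x \<noteq> 0"
  then have "inverse x \<in> K" "1 = x * inverse x" using K by (simp_all add: is_subfield_def)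
  then show "dvd_in K x 1" unfolding dvd_in_def by (intro bexI)
qed

private lemma factP: "factorial_subring PK"
  by (rule factorial_polys_over[OF factK])

private lemmas subPK = is_subring_polys_over[OF subK]
private lemmas PKD = is_subringD[OF subPK]

lemma dvd_over_iff: "dvd_over K p q \<longleftrightarrow> dvd_in PK p q"
  by (auto simp: dvd_over_def dvd_in_def poly_over_iff)

lemma unit_in_polys_over_field:
  assumes "p \<in> PK" "p \<noteq> 0" "degree p = 0"
  shows "dvd_in PK p 1"
proof -
  obtain c where c: "p = [:c:]" using assms(3) by (meson degree_eq_zeroE)
  then have "c \<in> K" "c \<noteq> 0" using assms subK by auto
  then have "inverse c \<in> K" using K by (auto simp: is_subfield_def)
  then have "[:inverse c:] \<in> PK" using subK by simp
  moreover have "1 = p * [:inverse c:]" using c \<open>c \<noteq> 0\<close> by (simp add: one_pCons)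
  ultimately show ?thesis unfolding dvd_in_def by blast
qed

lemma irreducible_over_imp_in:
  assumes "irreducible_over K g"
  shows "irreducible_in PK g"
  unfolding irreducible_in_def
proof (intro conjI ballI impI)
  have g: "g \<in> PK" "degree g > 0"
    using assms by (auto simp: irreducible_over_def poly_over_iff)
  then show "g \<in> PK" "g \<noteq> 0" by auto
  show "\<not> dvd_in PK g 1" using unit_in_polys_over_degree[OF factK, of g] g by auto
  fix a b assume ab: "a \<in> PK" "b \<in> PK" "g = a * b"
  then have "degree a = 0 \<or> degree b = 0"
    using assms by (auto simp: irreducible_over_def poly_over_iff)
  moreover have "a \<noteq> 0" "b \<noteq> 0" using g ab by auto
  ultimately show "dvd_in PK a 1 \<or> dvd_in PK b 1"
    using unit_in_polys_over_field ab by blast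
qed

definition monic_irreducible_factors :: "'k poly \<Rightarrow> 'k poly set" where
  "monic_irreducible_factors s =
     {g. lead_coeff g = 1 \<and> irreducible_over K g \<and> dvd_over K g s}"

lemma sqfr_eq: "sqfr K s = \<Prod>(monic_irreducible_factors s)"
  by (simp add: sqfr_def monic_irreducible_factors_def)

lemma monic_irreducible_factorsD:
  assumes "g \<in> monic_irreducible_factors s"
  shows "lead_coeff g = 1" "irreducible_in PK g" "g \<in> PK"
    "degree g > 0" "dvd_in PK g s"
  using assms irreducible_over_imp_in
  by (auto simp: monic_irreducible_factors_def dvd_over_iff irreducible_over_def poly_over_iff)

lemma monic_irreducible_dvd_eq:
  assumes g: "lead_coeff g = 1" "irreducible_in PK g"
    and h: "lead_coeff h = 1" "irreducible_in PK h"
    and dvd: "dvd_in PK g h"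
  shows "g = h"
proof -
  obtain u where u: "u \<in> PK" "h = g * u" using dvd by (auto simp: dvd_in_def)
  have "\<not> dvd_in PK g 1" "g \<in> PK" using g(2) by (auto simp: irreducible_in_def)
  then have "dvd_in PK u 1" using h(2) u unfolding irreducible_in_def by blast
  then have "degree u = 0" by (rule unit_in_polys_over_degree[OF factK])
  then obtain c where c: "u = [:c:]" by (meson degree_eq_zeroE)
  have "lead_coeff h = lead_coeff g * lead_coeff u"
    unfolding u(2) by (rule lead_coeff_mult)
  then have "c = 1" using g(1) h(1) c by simp
  then show ?thesis using u(2) c by simp
qed

lemma irreducible_dvd_prod:
  assumes g: "irreducible_in PK g"
  shows "finite G \<Longrightarrow> G \<subseteq> PK \<Longrightarrow> dvd_in PK g (\<Prod>G) \<Longrightarrow>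
    \<exists>h\<in>G. dvd_in PK g h"
proof (induction G rule: finite_induct)
  case empty
  then show ?case using g by (auto simp: irreducible_in_def)
next
  case (insert h G)
  have "\<Prod>G \<in> PK"
    using insert.prems by (intro is_subring_prod[OF subPK]) auto
  then have "dvd_in PK g h \<or> dvd_in PK g (\<Prod>G)"
    using insert factP g unfolding factorial_subring_def by simp
  then show ?case using insert by auto
qed

text \<open>A new factor \<open>g\<close> is prime and, being different from the other monic
  irreducibles, divides none of them; it therefore divides the cofactor of their product.\<close>

lemma prod_monic_irreducible_factors_dvd:
  "finite G \<Longrightarrow> G \<subseteq> monic_irreducible_factors s \<Longrightarrow> s \<in> PK \<Longrightarrow>
    dvd_in PK (\<Prod>G) s"
proof (induction G rule: finite_induct)
  case empty
  then show ?case unfolding dvd_in_def by (intro bexI[of _ s]) auto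
next
  case (insert g G)
  have g: "g \<in> monic_irreducible_factors s" using insert.prems by simp
  note gD = monic_irreducible_factorsD[OF g]
  have GP: "G \<subseteq> PK" using insert.prems monic_irreducible_factorsD(3) by blast
  then have pG: "\<Prod>G \<in> PK"
    by (intro is_subring_prod[OF subPK]) auto
  obtain c where c: "c \<in> PK" "s = \<Prod>G * c"
    using insert by (auto simp: dvd_in_def)
  have "\<not> dvd_in PK g (\<Prod>G)"
  proof
    assume "dvd_in PK g (\<Prod>G)"
    then obtain h where h: "h \<in> G" "dvd_in PK g h"
      using irreducible_dvd_prod[OF gD(2) insert.hyps(1) GP] by blast
    then have "g = h"
      using monic_irreducible_dvd_eq gD(1,2) monic_irreducible_factorsD(1,2) insert.prems by blast
    then show False using h insert.hyps by simp
  qed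
  then have "dvd_in PK g c"
    using gD(2,5) factP pG c unfolding factorial_subring_def by blast
  then obtain c' where c': "c' \<in> PK" "c = g * c'" by (auto simp: dvd_in_def)
  have "s = \<Prod>(insert g G) * c'" using insert.hyps c c' by (simp add: mult_ac)
  then show ?case using c'(1) unfolding dvd_in_def by blast
qed

text \<open>The product of any finite set of factors divides \<open>s\<close>, and each has degree
  at least 1, so there are at most \<open>degree s\<close> of them. Finiteness matters for
  \<open>sqfr\<close>, because a product over an infinite set is 1 by convention.\<close>

lemma finite_monic_irreducible_factors:
  assumes s: "s \<in> PK" "s \<noteq> 0"
  shows "finite (monic_irreducible_factors s)"
proof (rule ccontr)
  assume "infinite (monic_irreducible_factors s)"
  then obtain G where G: "finite G" "card G = Suc (degree s)" "G \<subseteq> monic_irreducible_factors s"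
    using infinite_arbitrarily_large by blast
  obtain c where c: "s = \<Prod>G * c"
    using prod_monic_irreducible_factors_dvd[OF G(1,3) s(1)] by (auto simp: dvd_in_def)
  have nz: "g \<noteq> 0" "1 \<le> degree g" if "g \<in> G" for g
    using monic_irreducible_factorsD(4)[of g s] that G(3) by auto
  have "card G = (\<Sum>g\<in>G. 1)" by simp
  also have "\<dots> \<le> (\<Sum>g\<in>G. degree g)" by (rule sum_mono) (rule nz)
  also have "\<dots> = degree (\<Prod>G)" 
    using degree_prod_eq_sum_degree[of G "\<lambda>x. x"] nz by simp
  also have "\<dots> \<le> degree s" using c s(2) by (auto simp: degree_mult_eq)
  finally show False using G(2) by simp
qed

lemma sqfr_monic:
  assumes "s \<in> PK" "s \<noteq> 0"
  shows "lead_coeff (sqfr K s) = 1" "sqfr K s \<in> PK"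
    "dvd_in PK (sqfr K s) s"
proof -
  show "lead_coeff (sqfr K s) = 1"
    unfolding sqfr_eq lead_coeff_prod by (intro prod.neutral ballI monic_irreducible_factorsD(1))
  show "sqfr K s \<in> PK" unfolding sqfr_eq
    by (intro is_subring_prod[OF subPK] monic_irreducible_factorsD(3))
  show "dvd_in PK (sqfr K s) s" unfolding sqfr_eq
    by (intro prod_monic_irreducible_factors_dvd finite_monic_irreducible_factors assms order_refl)
qed

lemma sqfr_1: "sqfr K 1 = 1"
proof -
  have "degree g = 0" if "dvd_in PK g 1" for g
    using that by (rule unit_in_polys_over_degree[OF factK])
  then have "monic_irreducible_factors 1 = {}" using monic_irreducible_factorsD(4,5) by fastforce
  then show ?thesis by (simp add: sqfr_eq)
qed

lemma dvd_in_trans_polys: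
  assumes "dvd_in PK a b" "dvd_in PK b c"
  shows "dvd_in PK a c"
proof -
  obtain u v where "u \<in> PK" "b = a * u" "v \<in> PK" "c = b * v"
    using assms by (auto simp: dvd_in_def)
  then have "c = a * (u * v)" "u * v \<in> PK" using PKD(6) by (simp_all add: mult.assoc)
  then show ?thesis unfolding dvd_in_def by blast
qed

lemma sqfr_dvd_sqfr:
  assumes "s' \<in> PK" "s' \<noteq> 0" "dvd_in PK s s'"
  shows "dvd_in PK (sqfr K s) (sqfr K s')"
proof -
  have sub: "monic_irreducible_factors s \<subseteq> monic_irreducible_factors s'"
    using dvd_in_trans_polys assms(3) by (auto simp: monic_irreducible_factors_def dvd_over_iff)
  have "sqfr K s' = \<Prod>(monic_irreducible_factors s' - monic_irreducible_factors s) * sqfr K s"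
    unfolding sqfr_eq by (rule prod.subset_diff[OF sub finite_monic_irreducible_factors[OF assms(1,2)]])
  moreover have "\<Prod>(monic_irreducible_factors s' - monic_irreducible_factors s) \<in> PK"
    by (intro is_subring_prod[OF subPK] monic_irreducible_factorsD(3)[of _ s']) auto
  ultimately show ?thesis unfolding dvd_in_def by (metis mult.commute)
qed

text \<open>Every irreducible factor of \<open>s\<close> is, up to a constant, one of the factors of
  \<open>sqfr K s\<close>, and for products the exponents add up. This is the direction that takes a
  zero of \<open>s\<close> to a zero of its square-free part.\<close>

lemma dvd_power_sqfr:
  assumes s: "s \<in> PK" "s \<noteq> 0"
  shows "\<exists>e. dvd_in PK s (sqfr K s ^ e)"
proof -
  have self: "dvd_in PK s s" unfolding dvd_in_def using PKD(2) by (intro bexI[of _ 1]) auto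
  \<comment> \<open>Generalised from \<open>s\<close> to its divisors, so that both factors of a
    product remain covered by the induction.\<close>
  have "dvd_in PK c s \<longrightarrow> (\<exists>e. dvd_in PK c (sqfr K s ^ e))"
    if "c \<in> PK" "c \<noteq> 0" for c
    using factP that
  proof (induction rule: factorial_subring_induct)
    case (unit u v)
    then have "dvd_in PK u (sqfr K s ^ 0)" unfolding dvd_in_def by (intro bexI[of _ v]) auto
    then show ?case by blast
  next
    case (irreducible p)
    have p: "p \<in> PK" "p \<noteq> 0" using irreducible(1) by (auto simp: irreducible_in_def)
    define l where "l = lead_coeff p"
    have l: "l \<in> K" "l \<noteq> 0" "inverse l \<in> K"
      using p K polys_over_coeff[OF p(1)] by (auto simp: l_def is_subfield_def)
    \<comment> \<open>The monic associate of \<open>p\<close>, since only monic irreducibles occur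
      in \<open>sqfr\<close>.\<close>
    define q where "q = smult (inverse l) p"
    have q: "q \<in> PK" "lead_coeff q = 1" "p = q * [:l:]"
      using l p(1) polys_over_smult[OF subK] by (simp_all add: q_def l_def)
    have lP: "[:l:] \<in> PK" "[:inverse l:] \<in> PK" using l subK by simp_all
    have "degree p > 0"
      using unit_in_polys_over_field p irreducible(1) unfolding irreducible_in_def by blast
    then have dq: "degree q > 0" using l by (simp add: q_def)
    have irr: "irreducible_over K q" unfolding irreducible_over_def poly_over_iff
    proof (intro conjI allI impI)
      fix g h assume gh: "g \<in> PK \<and> h \<in> PK \<and> q = g * h"
      then have "p = g * (h * [:l:])" "h * [:l:] \<in> PK"
        using q(3) PKD(6) lP by (simp_all only: mult.assoc)
      then have "dvd_in PK g 1 \<or> dvd_in PK (h * [:l:]) 1"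
        using irreducible(1) gh unfolding irreducible_in_def by blast
      then have "degree g = 0 \<or> degree (h * [:l:]) = 0"
        by (rule disj_forward) (rule unit_in_polys_over_degree[OF factK], assumption)+
      then show "degree g = 0 \<or> degree h = 0" using l by simp
    qed (use q dq in auto)
    show ?case
    proof
      assume ps: "dvd_in PK p s"
      have "dvd_in PK q p" unfolding dvd_in_def using q(3) lP by blast
      then have "q \<in> monic_irreducible_factors s"
        using dvd_in_trans_polys[OF _ ps] irr q(2) by (simp add: monic_irreducible_factors_def dvd_over_iff)
      then have "sqfr K s = q * \<Prod>(monic_irreducible_factors s - {q})"
        unfolding sqfr_eq by (rule prod.remove[OF finite_monic_irreducible_factors[OF s]])
      also have "\<dots> = p * ([:inverse l:] * \<Prod>(monic_irreducible_factors s - {q}))"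
      proof -
        have "q * r = p * ([:inverse l:] * r)" for r by (simp add: q_def)
        then show ?thesis .
      qed
      finally have "sqfr K s ^ 1 = p * ([:inverse l:] * \<Prod>(monic_irreducible_factors s - {q}))"
        by (simp only: power_one_right)
      moreover have "\<Prod>(monic_irreducible_factors s - {q}) \<in> PK"
        by (intro is_subring_prod[OF subPK] monic_irreducible_factorsD(3)[of _ s]) auto
      ultimately show "\<exists>e. dvd_in PK p (sqfr K s ^ e)"
        unfolding dvd_in_def using PKD(6) lP(2) by blast
    qed
  next
    case (mult a b)
    show ?case
    proof
      assume "dvd_in PK (a * b) s"
      then obtain w where w: "w \<in> PK" "s = a * b * w" by (auto simp: dvd_in_def)
      have eq: "s = a * (b * w)" "s = b * (a * w)" unfolding w(2) by (simp_all only: mult_ac)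
      have "dvd_in PK a s" unfolding dvd_in_def
        using eq(1) PKD(6)[OF mult.hyps(2) w(1)] by (intro bexI[where x = "b * w"])
      moreover have "dvd_in PK b s" unfolding dvd_in_def
        using eq(2) PKD(6)[OF mult.hyps(1) w(1)] by (intro bexI[where x = "a * w"])
      ultimately
      obtain e e' where "dvd_in PK a (sqfr K s ^ e)" "dvd_in PK b (sqfr K s ^ e')"
        using mult.IH by blast
      then obtain u v where uv: "u \<in> PK" "sqfr K s ^ e = a * u" "v \<in> PK" "sqfr K s ^ e' = b * v"
        by (auto simp: dvd_in_def)
      have "sqfr K s ^ (e + e') = a * b * (u * v)" unfolding power_add uv(2,4) by (simp only: mult_ac)
      then show "\<exists>e. dvd_in PK (a * b) (sqfr K s ^ e)"
        unfolding dvd_in_def using PKD(6) uv(1,3) by blast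
    qed
  qed
  then show ?thesis using s self by blast
qed

end


section \<open>Linear systems in block form\<close>

lemma mult_mat_unit_vec:
  assumes "(A :: 'k::semiring_1 mat) \<in> carrier_mat n k" "i < k"
  shows "A *\<^sub>v unit_vec k i = col A i"
  using assms by (intro eq_vecI) auto

lemma mult_mat_vec_uminus:
  assumes "(A :: 'k::comm_ring_1 mat) \<in> carrier_mat m n" "v \<in> carrier_vec n"
  shows "A *\<^sub>v (- v) = - (A *\<^sub>v v)"
  using assms by (intro eq_vecI) (auto simp: scalar_prod_uminus_right)

text \<open>Linear combinations of the columns are the vectors \<open>B *\<^sub>v c\<close>, so
  \<open>ker\<close>, \<open>inj\<close> and \<open>span\<close> say that the columns lie in the
  kernel, are independent and span it. Distinctness of the columns follows from \<open>inj\<close>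
  applied to a difference of unit vectors.\<close>

lemma nullspace_basisI:
  fixes A B :: "'k::field mat"
  assumes A: "A \<in> carrier_mat m n" and B: "B \<in> carrier_mat n k"
    and ker: "\<And>c. c \<in> carrier_vec k \<Longrightarrow> A *\<^sub>v (B *\<^sub>v c) = 0\<^sub>v m"
    and inj: "\<And>c. c \<in> carrier_vec k \<Longrightarrow> B *\<^sub>v c = 0\<^sub>v n \<Longrightarrow> c = 0\<^sub>v k"
    and span: "\<And>v. v \<in> carrier_vec n \<Longrightarrow> A *\<^sub>v v = 0\<^sub>v m \<Longrightarrow> \<exists>c\<in>carrier_vec k. v = B *\<^sub>v c"
  shows "nullspace_basis A B"
proof -
  interpret kernel m n A by unfold_locales (rule A)
  let ?S = "set (cols B)"
  have dist: "distinct (cols B)"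
    unfolding distinct_conv_nth
  proof (intro allI impI)
    fix i j assume ij: "i < length (cols B)" "j < length (cols B)" "i \<noteq> j"
    show "cols B ! i \<noteq> cols B ! j"
    proof
      assume eq: "cols B ! i = cols B ! j"
      have k: "i < k" "j < k" using ij B by auto
      let ?c = "unit_vec k i - unit_vec k j :: 'k vec"
      have "B *\<^sub>v ?c = B *\<^sub>v unit_vec k i - B *\<^sub>v unit_vec k j"
        by (rule mult_minus_distrib_mat_vec[OF B]) auto
      also have "\<dots> = col B i - col B j" using mult_mat_unit_vec[OF B] k by simp
      also have "\<dots> = 0\<^sub>v n" using eq ij B by auto
      finally have "?c = 0\<^sub>v k" using inj by auto
      then have "?c $ i = 0" using k by simp
      then show False using k ij by simp
    qed
  qed
  have Bc: "?S \<subseteq> carrier_vec n" using cols_dim[of B] B by simp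
  have lin: "NC.lincomb a ?S = B *\<^sub>v vec k (\<lambda>i. a (col B i))" for a
    using NC.mat_mult_eq_lincomb[OF B dist] by simp
  have S: "?S \<subseteq> mat_kernel A"
  proof
    fix v assume "v \<in> ?S"
    then obtain i where i: "i < k" "v = col B i" using B by (auto simp: cols_def)
    then have "v = B *\<^sub>v unit_vec k i" using mult_mat_unit_vec[OF B] by simp
    then show "v \<in> mat_kernel A" using ker[of "unit_vec k i"] B by (intro mat_kernelI[OF A]) auto
  qed
  have "Ker.basis ?S" unfolding Ker.basis_def
  proof (intro conjI)
    show "?S \<subseteq> mat_kernel A" by (rule S)
    show "Ker.lin_indpt ?S" unfolding lindep_same[OF S]
    proof (rule NC.finite_lin_indpt2)
      show "?S \<subseteq> carrier_vec n" by (rule Bc)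
      fix a assume "NC.lincomb a ?S = 0\<^sub>v n"
      then have "B *\<^sub>v vec k (\<lambda>i. a (col B i)) = 0\<^sub>v n" unfolding lin by (simp add: module_vec_simps)
      then have z: "vec k (\<lambda>i. a (col B i)) = 0\<^sub>v k" by (intro inj) simp_all
      have "a (col B i) = 0" if "i < k" for i
        using arg_cong[OF z, of "\<lambda>v. vec_index v i"] that by simp
      then show "\<forall>v\<in>?S. a v = 0" using B by (auto simp: cols_def)
    qed simp
    show "Ker.span ?S = mat_kernel A" unfolding span_same[OF S]
    proof
      have fs: "NC.span ?S = {NC.lincomb a ?S |a. a \<in> ?S \<rightarrow> UNIV}"
        using NC.finite_span[OF _ Bc] by simp
      show "NC.span ?S \<subseteq> mat_kernel A" unfolding fs lin
        using ker B by (auto intro!: mat_kernelI[OF A])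
      show "mat_kernel A \<subseteq> NC.span ?S"
      proof
        fix v assume "v \<in> mat_kernel A"
        then have "v \<in> carrier_vec n" "A *\<^sub>v v = 0\<^sub>v m" using mat_kernelD[OF A] by auto
        then obtain c where c: "c \<in> carrier_vec k" "v = B *\<^sub>v c" using span by blast
        have "v = NC.lincomb (\<lambda>a. c $ find_first a (cols B)) ?S"
          unfolding c(2) by (rule NC.lincomb_eq_mat_mult[OF B c(1) dist, symmetric])
        then show "v \<in> NC.span ?S" unfolding fs by (auto simp: class_ring_simps)
      qed
    qed
  qed
  then show ?thesis using A B dist by (simp add: nullspace_basis_def)
qed

text \<open>The adjugate formula is kept in the conclusion: it shows that the inverse has entries in
  every ring containing the entries of \<open>A\<close> and the inverse of its determinant.\<close>

lemma obtain_inverse_mat: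
  fixes A :: "'k::field mat"
  assumes A: "A \<in> carrier_mat n n" and det: "det A \<noteq> 0"
  obtains V where "V \<in> carrier_mat n n" "A * V = 1\<^sub>m n" "V * A = 1\<^sub>m n"
    "V = inverse (det A) \<cdot>\<^sub>m adj_mat A"
proof -
  let ?V = "inverse (det A) \<cdot>\<^sub>m adj_mat A"
  note adj = adj_mat[OF A]
  have "A * ?V = inverse (det A) \<cdot>\<^sub>m (det A \<cdot>\<^sub>m 1\<^sub>m n)"
    using mult_smult_distrib[OF A adj(1)] adj(2) by simp
  also have "\<dots> = 1\<^sub>m n" using det by (intro eq_matI) auto
  finally have 1: "A * ?V = 1\<^sub>m n" .
  have "?V * A = inverse (det A) \<cdot>\<^sub>m (det A \<cdot>\<^sub>m 1\<^sub>m n)"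
    using mult_smult_assoc_mat[OF adj(1) A] adj(3) by simp
  also have "\<dots> = 1\<^sub>m n" using det by (intro eq_matI) auto
  finally have 2: "?V * A = 1\<^sub>m n" .
  show ?thesis using that[OF _ 1 2] adj(1) by simp
qed

section \<open>A matrix with invertible leading block above zero rows\<close>

context
  fixes H :: "'k::field mat" and m n r :: nat and V Hr H12 :: "'k mat"
  assumes H: "H \<in> carrier_mat m n" and r: "r \<le> m" "r \<le> n"
    and zero: "\<And>i j. r \<le> i \<Longrightarrow> i < m \<Longrightarrow> j < n \<Longrightarrow> H $$ (i, j) = 0"
    and Hr_def: "Hr = mat r r (\<lambda>(i, j). H $$ (i, j))"
    and H12_def: "H12 = mat r (n - r) (\<lambda>(i, j). H $$ (i, j + r))"
    and V: "V \<in> carrier_mat r r" "Hr * V = 1\<^sub>m r" "V * Hr = 1\<^sub>m r"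
begin

lemma block_dims: "Hr \<in> carrier_mat r r" "H12 \<in> carrier_mat r (n - r)"
  by (simp_all add: Hr_def H12_def)

lemma block_mult_append:
  assumes v: "v \<in> carrier_vec r" and w: "w \<in> carrier_vec (n - r)"
  shows "H *\<^sub>v (v @\<^sub>v w) = (Hr *\<^sub>v v + H12 *\<^sub>v w) @\<^sub>v 0\<^sub>v (m - r)"
proof -
  have "H = four_block_mat Hr H12 (0\<^sub>m (m - r) r) (0\<^sub>m (m - r) (n - r))"
    by (rule eq_matI) (use H r zero in \<open>auto simp: Hr_def H12_def\<close>)
  then have "H *\<^sub>v (v @\<^sub>v w) =
    (Hr *\<^sub>v v + H12 *\<^sub>v w) @\<^sub>v (0\<^sub>m (m - r) r *\<^sub>v v + 0\<^sub>m (m - r) (n - r) *\<^sub>v w)"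
    using four_block_mat_mult_vec[OF block_dims zero_carrier_mat zero_carrier_mat v w] by simp
  also have "0\<^sub>m (m - r) r *\<^sub>v v + 0\<^sub>m (m - r) (n - r) *\<^sub>v w = 0\<^sub>v (m - r)"
    using v w by (intro eq_vecI) auto
  finally show ?thesis .
qed

lemma block_particular_solution:
  fixes b :: "'k vec"
  assumes b: "b \<in> carrier_vec m" "\<And>j. r \<le> j \<Longrightarrow> j < m \<Longrightarrow> b $ j = 0"
  shows "H *\<^sub>v ((V *\<^sub>v vec r (\<lambda>i. b $ i)) @\<^sub>v 0\<^sub>v (n - r)) = b"
proof -
  let ?b = "vec r (\<lambda>i. b $ i)"
  have "Hr *\<^sub>v (V *\<^sub>v ?b) = (Hr * V) *\<^sub>v ?b"
    by (rule assoc_mult_mat_vec[OF block_dims(1) V(1), symmetric]) simp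
  then have "Hr *\<^sub>v (V *\<^sub>v ?b) = ?b" using V(2) by simp
  moreover have "H12 *\<^sub>v 0\<^sub>v (n - r) = 0\<^sub>v r" using block_dims(2) by (intro eq_vecI) auto
  ultimately have "H *\<^sub>v ((V *\<^sub>v ?b) @\<^sub>v 0\<^sub>v (n - r)) = ?b @\<^sub>v 0\<^sub>v (m - r)"
    using V(1) by (subst block_mult_append) auto
  also have "\<dots> = b" using b r by (intro eq_vecI) auto
  finally show ?thesis .
qed

lemma block_kernel_mult:
  assumes c: "c \<in> carrier_vec (n - r)"
  shows "((- (V * H12)) @\<^sub>r 1\<^sub>m (n - r)) *\<^sub>v c = - (V *\<^sub>v (H12 *\<^sub>v c)) @\<^sub>v c"
proof -
  have XH: "V * H12 \<in> carrier_mat r (n - r)" using V(1) block_dims(2) by simp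
  have "((- (V * H12)) @\<^sub>r 1\<^sub>m (n - r)) *\<^sub>v c = (- (V * H12)) *\<^sub>v c @\<^sub>v 1\<^sub>m (n - r) *\<^sub>v c"
    by (rule mat_mult_append) (use XH c in auto)
  also have "(- (V * H12)) *\<^sub>v c = - ((V * H12) *\<^sub>v c)"
    using XH c by (intro eq_vecI) (auto simp: scalar_prod_uminus_left)
  also have "(V * H12) *\<^sub>v c = V *\<^sub>v (H12 *\<^sub>v c)" by (rule assoc_mult_mat_vec[OF V(1) block_dims(2) c])
  finally show ?thesis using c by simp
qed

text \<open>The identity block makes \<open>C\<close> injective. Conversely, the first
  \<open>r\<close> coordinates of a kernel vector are determined by the remaining ones, which serve
  as the coefficient vector \<open>c\<close>.\<close>

lemma block_kernel:
  fixes c v :: "'k vec"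
  defines "C \<equiv> (- (V * H12)) @\<^sub>r 1\<^sub>m (n - r)"
  shows "C \<in> carrier_mat n (n - r)"
    and "c \<in> carrier_vec (n - r) \<Longrightarrow> H *\<^sub>v (C *\<^sub>v c) = 0\<^sub>v m"
    and "c \<in> carrier_vec (n - r) \<Longrightarrow> C *\<^sub>v c = 0\<^sub>v n \<Longrightarrow> c = 0\<^sub>v (n - r)"
    and "v \<in> carrier_vec n \<Longrightarrow> H *\<^sub>v v = 0\<^sub>v m \<Longrightarrow> \<exists>c\<in>carrier_vec (n - r). v = C *\<^sub>v c"
proof -
  have XH: "V * H12 \<in> carrier_mat r (n - r)" using V(1) block_dims(2) by simp
  have "C \<in> carrier_mat (r + (n - r)) (n - r)" unfolding C_def by (rule carrier_append_rows) (use XH in auto)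
  then show "C \<in> carrier_mat n (n - r)" using r by simp
  {
    fix c :: "'k vec" assume c: "c \<in> carrier_vec (n - r)"
    let ?h = "H12 *\<^sub>v c"
    have h: "?h \<in> carrier_vec r" by (rule mult_mat_vec_carrier[OF block_dims(2) c])
    then have "V *\<^sub>v ?h \<in> carrier_vec r" by (rule mult_mat_vec_carrier[OF V(1)])
    note h = h this
    have "Hr *\<^sub>v (- (V *\<^sub>v ?h)) = - (Hr *\<^sub>v (V *\<^sub>v ?h))"
      by (rule mult_mat_vec_uminus[OF block_dims(1) h(2)])
    also have "Hr *\<^sub>v (V *\<^sub>v ?h) = (Hr * V) *\<^sub>v ?h"
      by (rule assoc_mult_mat_vec[OF block_dims(1) V(1) h(1), symmetric])
    also have "\<dots> = ?h" using V(2) h by simp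
    finally have "Hr *\<^sub>v (- (V *\<^sub>v ?h)) + ?h = 0\<^sub>v r" using h by simp
    then have "H *\<^sub>v (C *\<^sub>v c) = 0\<^sub>v r @\<^sub>v 0\<^sub>v (m - r)"
      unfolding C_def block_kernel_mult[OF c] using block_mult_append[of "- (V *\<^sub>v ?h)" c] h c by simp
    also have "\<dots> = 0\<^sub>v m" using r by (intro eq_vecI) auto
    finally have 1: "H *\<^sub>v (C *\<^sub>v c) = 0\<^sub>v m" .
    have "c = 0\<^sub>v (n - r)" if "C *\<^sub>v c = 0\<^sub>v n"
    proof (rule eq_vecI)
      have z: "- (V *\<^sub>v ?h) @\<^sub>v c = 0\<^sub>v n" using that unfolding C_def block_kernel_mult[OF c] .
      fix i assume i: "i < dim_vec (0\<^sub>v (n - r) :: 'k vec)"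
      have "(- (V *\<^sub>v ?h) @\<^sub>v c) $ (r + i) = c $ i" using h c i V(1) by simp
      then show "c $ i = 0\<^sub>v (n - r) $ i" unfolding z using i by simp
    qed (use c in simp)
    note 1 this
  } note * = this
  show "c \<in> carrier_vec (n - r) \<Longrightarrow> H *\<^sub>v (C *\<^sub>v c) = 0\<^sub>v m"
    "c \<in> carrier_vec (n - r) \<Longrightarrow> C *\<^sub>v c = 0\<^sub>v n \<Longrightarrow> c = 0\<^sub>v (n - r)"
    using * by blast+
  {
    fix v :: "'k vec" assume v: "v \<in> carrier_vec n" and Hv: "H *\<^sub>v v = 0\<^sub>v m"
    define v1 v2 where "v1 = vec_first v r" and "v2 = vec_last v (n - r)"
    have c: "v1 \<in> carrier_vec r" "v2 \<in> carrier_vec (n - r)" by (simp_all add: v1_def v2_def)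
    have v12: "v = v1 @\<^sub>v v2" unfolding v1_def v2_def by (rule vec_first_last_append[symmetric]) (use v r in simp)
    have h: "H12 *\<^sub>v v2 \<in> carrier_vec r" "Hr *\<^sub>v v1 \<in> carrier_vec r"
      using mult_mat_vec_carrier[OF block_dims(2) c(2)] mult_mat_vec_carrier[OF block_dims(1) c(1)] by simp_all
    have "(Hr *\<^sub>v v1 + H12 *\<^sub>v v2) @\<^sub>v 0\<^sub>v (m - r) = 0\<^sub>v m"
      using Hv unfolding v12 block_mult_append[OF c] .
    also have "0\<^sub>v m = (0\<^sub>v r @\<^sub>v 0\<^sub>v (m - r) :: 'k vec)" using r by (intro eq_vecI) auto
    finally have s: "Hr *\<^sub>v v1 + H12 *\<^sub>v v2 = 0\<^sub>v r"
      using h by (subst (asm) append_vec_eq[of _ r]) auto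
    have "Hr *\<^sub>v v1 = - (H12 *\<^sub>v v2)"
    proof (rule eq_vecI)
      fix i assume "i < dim_vec (- (H12 *\<^sub>v v2))"
      then have i: "i < r" using block_dims(2) by simp
      then have "(Hr *\<^sub>v v1 + H12 *\<^sub>v v2) $ i = 0" unfolding s by simp
      then show "(Hr *\<^sub>v v1) $ i = (- (H12 *\<^sub>v v2)) $ i"
        using i h block_dims by (simp add: eq_neg_iff_add_eq_0 del: index_mult_mat_vec)
    qed (use block_dims in simp)
    then have "V *\<^sub>v (Hr *\<^sub>v v1) = V *\<^sub>v (- (H12 *\<^sub>v v2))" by simp
    also have "V *\<^sub>v (Hr *\<^sub>v v1) = (V * Hr) *\<^sub>v v1"
      by (rule assoc_mult_mat_vec[OF V(1) block_dims(1) c(1), symmetric])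
    also have "\<dots> = v1" using V(3) c by simp
    also have "V *\<^sub>v (- (H12 *\<^sub>v v2)) = - (V *\<^sub>v (H12 *\<^sub>v v2))"
      by (rule mult_mat_vec_uminus[OF V(1) h(1)])
    finally have "v = C *\<^sub>v v2" unfolding C_def block_kernel_mult[OF c(2)] v12 by simp
    then have "\<exists>c\<in>carrier_vec (n - r). v = C *\<^sub>v c" using c(2) by (intro bexI)
  }
  then show "v \<in> carrier_vec n \<Longrightarrow> H *\<^sub>v v = 0\<^sub>v m \<Longrightarrow> \<exists>c\<in>carrier_vec (n - r). v = C *\<^sub>v c" .
qed

end

section \<open>Transport along an equivalence \<open>U * A * R = H\<close>\<close>

context
  fixes A U R H :: "'k::field mat" and m n :: nat
  assumes A: "A \<in> carrier_mat m n" and U: "U \<in> carrier_mat m m" "det U \<noteq> 0"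
    and R: "R \<in> carrier_mat n n" "det R \<noteq> 0" and H: "U * A * R = H"
begin

lemma transformed_mult:
  assumes w: "w \<in> carrier_vec n"
  shows "H *\<^sub>v w = U *\<^sub>v (A *\<^sub>v (R *\<^sub>v w))"
proof -
  have "H *\<^sub>v w = (U * A) *\<^sub>v (R *\<^sub>v w)"
    unfolding H[symmetric] by (rule assoc_mult_mat_vec[OF mult_carrier_mat[OF U(1) A] R(1) w])
  also have "\<dots> = U *\<^sub>v (A *\<^sub>v (R *\<^sub>v w))" by (rule assoc_mult_mat_vec[OF U(1) A]) (use R w in simp)
  finally show ?thesis .
qed

lemma mult_U_cancel:
  assumes "x \<in> carrier_vec m" "y \<in> carrier_vec m" "U *\<^sub>v x = U *\<^sub>v y"
  shows "x = y"
proof -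
  obtain V where V: "V \<in> carrier_mat m m" "V * U = 1\<^sub>m m" using obtain_inverse_mat[OF U] by blast
  have "x = (V * U) *\<^sub>v x" using V assms by simp
  also have "\<dots> = V *\<^sub>v (U *\<^sub>v x)" by (rule assoc_mult_mat_vec[OF V(1) U(1) assms(1)])
  also have "\<dots> = (V * U) *\<^sub>v y" unfolding assms(3) by (rule assoc_mult_mat_vec[OF V(1) U(1) assms(2), symmetric])
  also have "\<dots> = y" using V assms by simp
  finally show ?thesis .
qed

lemma transformed_solution:
  assumes "w \<in> carrier_vec n" "b \<in> carrier_vec m" "H *\<^sub>v w = U *\<^sub>v b"
  shows "A *\<^sub>v (R *\<^sub>v w) = b"
proof (rule mult_U_cancel)
  show "A *\<^sub>v (R *\<^sub>v w) \<in> carrier_vec m"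
    by (rule mult_mat_vec_carrier[OF A mult_mat_vec_carrier[OF R(1) assms(1)]])
  show "U *\<^sub>v (A *\<^sub>v (R *\<^sub>v w)) = U *\<^sub>v b" using transformed_mult[OF assms(1)] assms(3) by simp
qed (rule assms(2))

lemma solution_transformed:
  assumes u: "u \<in> carrier_vec n"
  shows "\<exists>w\<in>carrier_vec n. R *\<^sub>v w = u \<and> H *\<^sub>v w = U *\<^sub>v (A *\<^sub>v u)"
proof -
  obtain V where V: "V \<in> carrier_mat n n" "R * V = 1\<^sub>m n" using obtain_inverse_mat[OF R] by blast
  have w: "V *\<^sub>v u \<in> carrier_vec n" using V u by simp
  have "R *\<^sub>v (V *\<^sub>v u) = (R * V) *\<^sub>v u" by (rule assoc_mult_mat_vec[OF R(1) V(1) u, symmetric])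
  then have Rw: "R *\<^sub>v (V *\<^sub>v u) = u" using V u by simp
  show ?thesis using transformed_mult[OF w] unfolding Rw by (intro bexI[OF _ w]) (simp add: Rw)
qed

text \<open>\<open>U\<close> and \<open>R\<close> are invertible, so \<open>R\<close> maps the
  kernel of \<open>H\<close> bijectively onto that of \<open>A\<close>; the columns of
  \<open>R * C\<close> inherit all three properties.\<close>

lemma transformed_nullspace_basis:
  assumes C: "C \<in> carrier_mat n k"
    and ker: "\<And>c. c \<in> carrier_vec k \<Longrightarrow> H *\<^sub>v (C *\<^sub>v c) = 0\<^sub>v m"
    and inj: "\<And>c. c \<in> carrier_vec k \<Longrightarrow> C *\<^sub>v c = 0\<^sub>v n \<Longrightarrow> c = 0\<^sub>v k"
    and span: "\<And>v. v \<in> carrier_vec n \<Longrightarrow> H *\<^sub>v v = 0\<^sub>v m \<Longrightarrow> \<exists>c\<in>carrier_vec k. v = C *\<^sub>v c"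
  shows "nullspace_basis A (R * C)"
proof (rule nullspace_basisI[OF A])
  show "R * C \<in> carrier_mat n k" using R C by simp
  have U0: "U *\<^sub>v 0\<^sub>v m = 0\<^sub>v m" using U by (intro eq_vecI) auto
  have RC: "(R * C) *\<^sub>v c = R *\<^sub>v (C *\<^sub>v c)" if "c \<in> carrier_vec k" for c
    by (rule assoc_mult_mat_vec[OF R(1) C that])
  have Cc: "C *\<^sub>v c \<in> carrier_vec n" if "c \<in> carrier_vec k" for c
    by (rule mult_mat_vec_carrier[OF C that])
  show "A *\<^sub>v ((R * C) *\<^sub>v c) = 0\<^sub>v m" if c: "c \<in> carrier_vec k" for c
    unfolding RC[OF c] by (rule transformed_solution[OF Cc[OF c]]) (simp_all add: ker c U0)
  show "c = 0\<^sub>v k" if c: "c \<in> carrier_vec k" "(R * C) *\<^sub>v c = 0\<^sub>v n" for c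
  proof -
    obtain V where V: "V \<in> carrier_mat n n" "V * R = 1\<^sub>m n" using obtain_inverse_mat[OF R] by blast
    have "C *\<^sub>v c = (V * R) *\<^sub>v (C *\<^sub>v c)" using V Cc[OF c(1)] by simp
    also have "\<dots> = V *\<^sub>v (R *\<^sub>v (C *\<^sub>v c))" by (rule assoc_mult_mat_vec[OF V(1) R(1) Cc[OF c(1)]])
    also have "\<dots> = V *\<^sub>v 0\<^sub>v n" using c RC by simp
    also have "\<dots> = 0\<^sub>v n" using V by (intro eq_vecI) auto
    finally show ?thesis using inj c by blast
  qed
  show "\<exists>c\<in>carrier_vec k. v = (R * C) *\<^sub>v c" if v: "v \<in> carrier_vec n" "A *\<^sub>v v = 0\<^sub>v m" for v
  proof -
    obtain w where w: "w \<in> carrier_vec n" "R *\<^sub>v w = v" "H *\<^sub>v w = U *\<^sub>v (A *\<^sub>v v)"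
      using solution_transformed[OF v(1)] by blast
    then have "H *\<^sub>v w = 0\<^sub>v m" using v U0 by simp
    then obtain c where "c \<in> carrier_vec k" "w = C *\<^sub>v c" using span w by blast
    then show ?thesis using w(2) RC by (intro bexI[of _ c]) simp_all
  qed
qed

end


section \<open>Triangular Smith forms\<close>

definition mat_in :: "'b set \<Rightarrow> 'b mat \<Rightarrow> bool" where
  "mat_in L M \<longleftrightarrow> (\<forall>i<dim_row M. \<forall>j<dim_col M. M $$ (i, j) \<in> L)"

definition vec_in :: "'b set \<Rightarrow> 'b vec \<Rightarrow> bool" where
  "vec_in L v \<longleftrightarrow> (\<forall>i<dim_vec v. vec_index v i \<in> L)"

lemma scalar_prod_in:
  assumes "is_subring L" "\<And>i. i < dim_vec w \<Longrightarrow> vec_index v i \<in> L" "vec_in L w"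
  shows "v \<bullet> w \<in> L"
  unfolding scalar_prod_def
  by (intro is_subring_sum[OF assms(1)] is_subringD(6)[OF assms(1)])
    (use assms(2,3) in \<open>auto simp: vec_in_def\<close>)

lemma mat_in_mult:
  assumes "is_subring L" "mat_in L M" "mat_in L M'" "dim_col M = dim_row M'"
  shows "mat_in L (M * M')"
  unfolding mat_in_def
proof (intro allI impI)
  fix i j assume ij: "i < dim_row (M * M')" "j < dim_col (M * M')"
  have "row M i \<bullet> col M' j \<in> L"
    by (rule scalar_prod_in[OF assms(1)]) (use assms ij in \<open>auto simp: mat_in_def vec_in_def\<close>)
  then show "(M * M') $$ (i, j) \<in> L" using ij by simp
qed

lemma vec_in_mult:
  assumes "is_subring L" "mat_in L M" "vec_in L v" "dim_col M = dim_vec v"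
  shows "vec_in L (M *\<^sub>v v)"
  unfolding vec_in_def
proof (intro allI impI)
  fix i assume i: "i < dim_vec (M *\<^sub>v v)"
  have "row M i \<bullet> v \<in> L"
    by (rule scalar_prod_in[OF assms(1)]) (use assms i in \<open>auto simp: mat_in_def vec_in_def\<close>)
  then show "vec_index (M *\<^sub>v v) i \<in> L" using i by simp
qed

lemma det_in:
  assumes L: "is_subring L" and M: "mat_in L M"
  shows "det M \<in> L"
proof (cases "dim_row M = dim_col M")
  case True
  have sg: "signof p \<in> L" for p
    using is_subringD(2)[OF L] is_subringD(3)[OF L is_subringD(2)[OF L]] by (simp add: sign_def)
  have "M $$ (i, p i) \<in> L" if "p permutes {0..<dim_row M}" "i < dim_row M" for p i
  proof -
    have "p i \<in> {0..<dim_row M}" using permutes_in_image[OF that(1), of i] that(2) by simp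
    then show ?thesis using M that True by (simp add: mat_in_def)
  qed
  then show ?thesis unfolding det_def using True sg
    by (auto intro!: is_subring_sum[OF L] is_subringD(6)[OF L] is_subring_prod[OF L])
next
  case False
  then show ?thesis using is_subringD(1)[OF L] by (simp add: det_def)
qed

lemma adj_mat_in:
  assumes L: "is_subring L" and M: "mat_in L M" "M \<in> carrier_mat n n"
  shows "mat_in L (adj_mat M)"
  unfolding mat_in_def
proof (intro allI impI)
  fix i j assume ij: "i < dim_row (adj_mat M)" "j < dim_col (adj_mat M)"
  have "mat_in L (mat_delete M j i)"
    unfolding mat_in_def mat_delete_def using M ij by (auto simp: mat_in_def adj_mat_def)
  then have "det (mat_delete M j i) \<in> L" by (rule det_in[OF L])
  moreover have "(- 1) ^ (j + i) \<in> L"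
    by (rule is_subringD(7)[OF L is_subringD(3)[OF L is_subringD(2)[OF L]]])
  ultimately have "cofactor M j i \<in> L" unfolding cofactor_def by (intro is_subringD(6)[OF L])
  then show "adj_mat M $$ (i, j) \<in> L" using ij by (simp add: adj_mat_def)
qed

context partial_hom
begin

lemma ev_scalar_prod:
  assumes "\<And>i. i < dim_vec w \<Longrightarrow> vec_index v i \<in> L" "vec_in L w"
  shows "ev (v \<bullet> w) = (\<Sum>i = 0..<dim_vec w. ev (vec_index v i) * ev (vec_index w i))"
  unfolding scalar_prod_def using assms is_subringD(6)[OF subring]
  by (subst ev_sum) (auto simp: vec_in_def ev_mult)

lemma map_mat_mult:
  assumes "mat_in L M" "mat_in L M'" "dim_col M = dim_row M'"
  shows "map_mat ev (M * M') = map_mat ev M * map_mat ev M'"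
proof (rule eq_matI)
  fix i j assume "i < dim_row (map_mat ev M * map_mat ev M')" "j < dim_col (map_mat ev M * map_mat ev M')"
  then have ij: "i < dim_row M" "j < dim_col M'" by simp_all
  have "ev (row M i \<bullet> col M' j) = (\<Sum>k = 0..<dim_row M'. ev (vec_index (row M i) k) * ev (vec_index (col M' j) k))"
    by (subst ev_scalar_prod) (use assms ij in \<open>auto simp: mat_in_def vec_in_def\<close>)
  then show "map_mat ev (M * M') $$ (i, j) = (map_mat ev M * map_mat ev M') $$ (i, j)"
    using ij assms(3) by (simp add: scalar_prod_def)
qed simp_all

lemma map_vec_mult:
  assumes "mat_in L M" "vec_in L v" "dim_col M = dim_vec v"
  shows "map_vec ev (M *\<^sub>v v) = map_mat ev M *\<^sub>v map_vec ev v"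
proof (rule eq_vecI)
  fix i assume "i < dim_vec (map_mat ev M *\<^sub>v map_vec ev v)"
  then have i: "i < dim_row M" by simp
  have "ev (row M i \<bullet> v) = (\<Sum>k = 0..<dim_vec v. ev (vec_index (row M i) k) * ev (vec_index v k))"
    by (subst ev_scalar_prod) (use assms i in \<open>auto simp: mat_in_def vec_in_def\<close>)
  then show "vec_index (map_vec ev (M *\<^sub>v v)) i = vec_index (map_mat ev M *\<^sub>v map_vec ev v) i"
    using i assms(3) by (simp add: scalar_prod_def)
qed simp

end

locale smith_form =
  fixes K :: "'k::field set" and H :: "'k poly mat" and m n :: nat
  assumes K: "is_subfield K" and H: "H \<in> carrier_mat m n" and tsf: "triangular_smith_form K H"
begin

abbreviation "s \<equiv> smith_diag H"
abbreviation "r\<^sub>0 \<equiv> smith_rank H"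
abbreviation "f \<equiv> sqfr_quotient K H"

lemma subring_K: "is_subring K"
  by (rule is_subring_subfield[OF K])

lemma diag_0: "s 0 = 1"
  by (simp add: smith_diag_def)

text \<open>\<open>smith_diag\<close> counts from 1, with \<open>s 0 = 1\<close> as a convention,
  whereas matrix indices start at 0.\<close>

lemma diag_Suc: "i < min m n \<Longrightarrow> s (Suc i) = H $$ (i, i)"
  using H by (simp add: smith_diag_def)

lemma entry_over_K: "i < m \<Longrightarrow> j < n \<Longrightarrow> H $$ (i, j) \<in> polys_over K"
  using tsf H unfolding triangular_smith_form_def poly_over_iff by simp

lemma below_diagonal: "i < m \<Longrightarrow> j < i \<Longrightarrow> j < n \<Longrightarrow> H $$ (i, j) = 0"
  using tsf H unfolding triangular_smith_form_def by simp

lemma diag_over_K: "i \<le> min m n \<Longrightarrow> s i \<in> polys_over K"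
  using entry_over_K is_subringD(2)[OF is_subring_polys_over[OF subring_K]]
  by (cases i) (simp_all add: diag_0 diag_Suc)

lemma diag_monic: "i \<le> min m n \<Longrightarrow> s i \<noteq> 0 \<Longrightarrow> lead_coeff (s i) = 1"
proof (cases i)
  case (Suc j)
  assume "i \<le> min m n" "s i \<noteq> 0"
  then show ?thesis using tsf H Suc unfolding triangular_smith_form_def by (simp add: diag_Suc)
qed (simp add: diag_0)

lemma diag_dvd_entry:
  assumes "i < min m n" "i \<le> k" "k < m" "i \<le> l" "l < n"
  shows "\<exists>c. H $$ (k, l) = s (Suc i) * c"
proof -
  have "dvd_over K (H $$ (i, i)) (H $$ (k, l))"
    using tsf H assms unfolding triangular_smith_form_def by simp
  then show ?thesis using diag_Suc[OF assms(1)] unfolding dvd_over_def by auto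
qed

lemma diag_dvd_diag:
  assumes "i \<le> k" "k \<le> min m n"
  shows "\<exists>c. s k = s i * c"
proof (cases i)
  case 0
  then show ?thesis by (simp add: diag_0)
next
  case (Suc j)
  then obtain l where "k = Suc l" using assms by (cases k) auto
  then show ?thesis using Suc assms diag_dvd_entry[of j l l] by (simp add: diag_Suc)
qed

lemma rank_set: "finite {i. i \<le> min m n \<and> s i \<noteq> 0}" "0 \<in> {i. i \<le> min m n \<and> s i \<noteq> 0}"
  by (simp_all add: diag_0)

lemma smith_rank_eq: "r\<^sub>0 = Max {i. i \<le> min m n \<and> s i \<noteq> 0}"
  using H by (simp add: smith_rank_def)

lemma smith_rank_in: "r\<^sub>0 \<le> min m n" "s r\<^sub>0 \<noteq> 0"
  using Max_in[OF rank_set(1)] rank_set(2) unfolding smith_rank_eq by blast+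

lemma smith_rank_ge: "i \<le> min m n \<Longrightarrow> s i \<noteq> 0 \<Longrightarrow> i \<le> r\<^sub>0"
  unfolding smith_rank_eq by (rule Max_ge[OF rank_set(1)]) simp

text \<open>Each earlier entry divides the last nonzero one, so zeros occur only beyond the
  rank.\<close>

lemma diag_nonzero: "i \<le> r\<^sub>0 \<Longrightarrow> s i \<noteq> 0"
  using diag_dvd_diag[of i "r\<^sub>0"] smith_rank_in by auto

lemma diag_rank:
  assumes "i \<le> r\<^sub>0"
  shows "s i \<in> polys_over K" "lead_coeff (s i) = 1"
  using assms diag_over_K[of i] diag_monic[of i] diag_nonzero smith_rank_in(1) by auto

lemma diag_dvd_in:
  assumes "i \<le> k" "k \<le> r\<^sub>0"
  shows "dvd_in (polys_over K) (s i) (s k)"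
proof -
  obtain c where c: "s k = s i * c" using diag_dvd_diag[OF assms(1)] smith_rank_in assms by auto
  have "c \<in> polys_over K"
    by (rule monic_quotient_polys_over[OF subring_K diag_rank[of i]])
      (use assms diag_rank(1)[of k] c in simp_all)
  then show ?thesis using c unfolding dvd_in_def by (intro bexI)
qed

lemma sqfr_diag:
  assumes "i \<le> r\<^sub>0"
  shows "lead_coeff (sqfr K (s i)) = 1" "sqfr K (s i) \<in> polys_over K"
    "dvd_in (polys_over K) (sqfr K (s i)) (s i)" "sqfr K (s i) \<noteq> 0"
proof -
  note * = sqfr_monic[OF K diag_rank(1)[OF assms] diag_nonzero[OF assms]]
  show "lead_coeff (sqfr K (s i)) = 1" "sqfr K (s i) \<in> polys_over K"
    "dvd_in (polys_over K) (sqfr K (s i)) (s i)" by (rule *)+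
  show "sqfr K (s i) \<noteq> 0" using *(1) by auto
qed

text \<open>The monic irreducible factors of \<open>s i\<close> are among those of
  \<open>s (Suc i)\<close>, so the division defining \<open>f i\<close> is exact; comparing leading
  coefficients shows that the quotient is monic.\<close>

lemma sqfr_quotient_mult:
  assumes "i < r\<^sub>0"
  shows "sqfr K (s (Suc i)) = sqfr K (s i) * f i" "f i \<in> polys_over K"
    "lead_coeff (f i) = 1"
proof -
  have "dvd_in (polys_over K) (sqfr K (s i)) (sqfr K (s (Suc i)))"
    by (rule sqfr_dvd_sqfr[OF K]) (use assms diag_rank diag_nonzero diag_dvd_in in auto)
  then obtain c where c: "c \<in> polys_over K" "sqfr K (s (Suc i)) = sqfr K (s i) * c"
    unfolding dvd_in_def by blast
  have "f i = sqfr K (s i) * c div sqfr K (s i)"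
    using assms c(2) by (simp add: sqfr_quotient_def)
  then have fc: "f i = c" using sqfr_diag(4)[of i] assms by simp
  then show eq: "sqfr K (s (Suc i)) = sqfr K (s i) * f i" and "f i \<in> polys_over K" using c by simp_all
  have "lead_coeff (sqfr K (s (Suc i))) =
    lead_coeff (sqfr K (s i)) * lead_coeff (f i)"
    unfolding eq by (rule lead_coeff_mult)
  then show "lead_coeff (f i) = 1"
    using sqfr_diag(1)[of i] sqfr_diag(1)[of "Suc i"] assms by simp
qed

text \<open>\<open>f i\<close> divides the square-free part of \<open>s (Suc i)\<close> and so
  \<open>s (Suc i)\<close> itself. This is why a zero of \<open>f i\<close> is a zero of
  \<open>s (Suc i)\<close>, and the monic cofactor is what Gauss' lemma asks for.\<close>

lemma sqfr_quotient_cofactor: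
  assumes i: "i < r\<^sub>0"
  obtains g where "g \<in> polys_over K" "lead_coeff g = 1" "s (Suc i) = f i * g"
proof -
  note f = sqfr_quotient_mult[OF i]
  obtain c where "s (Suc i) = sqfr K (s (Suc i)) * c"
    using sqfr_diag(3)[of "Suc i"] i unfolding dvd_in_def by auto
  then have g: "s (Suc i) = f i * (sqfr K (s i) * c)" unfolding f(1) by (simp only: mult_ac)
  have "sqfr K (s i) * c \<in> polys_over K"
    by (rule monic_quotient_polys_over[OF subring_K f(2,3)]) (use diag_rank(1)[of "Suc i"] i g in simp)
  moreover have "lead_coeff (s (Suc i)) =
    lead_coeff (f i) * lead_coeff (sqfr K (s i) * c)"
    unfolding g by (rule lead_coeff_mult)
  then have "lead_coeff (sqfr K (s i) * c) = 1" using f(3) diag_rank(2)[of "Suc i"] i by simp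
  ultimately show ?thesis using that g by blast
qed

end

text \<open>Divisibility is known over \<open>K\<close>, values exist over \<open>C\<close>. The
  subring \<open>C\<close> is kept abstract here; later it is \<open>regular_coeffs\<close>, the
  coefficients with permitted denominators.\<close>

locale regular_smith_form = smith_form +
  fixes C :: "'a set"
  assumes subring_C: "is_subring C"
    and entry_regular: "\<And>i j. i < m \<Longrightarrow> j < n \<Longrightarrow> H $$ (i, j) \<in> polys_over C"
    and quotient_regular: "\<And>i. i < smith_rank H \<Longrightarrow> sqfr_quotient K H i \<in> polys_over C"
begin

lemmas regD = is_subringD[OF is_subring_polys_over[OF subring_C]]

lemma diag_regular: "i \<le> min m n \<Longrightarrow> s i \<in> polys_over C"
  using entry_regular regD(2) by (cases i) (simp_all add: diag_0 diag_Suc)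

lemma monic_quotient_regular:
  assumes "p \<in> polys_over C" "lead_coeff p = 1" "q \<in> polys_over C" "q = p * c"
  shows "c \<in> polys_over C"
  using monic_quotient_polys_over[OF subring_C assms(1,2), of c] assms(3,4) by simp

lemma diag_regular_quotient:
  assumes "i \<le> k" "k \<le> r\<^sub>0"
  shows "\<exists>c\<in>polys_over C. s k = s i * c"
proof -
  obtain c where c: "s k = s i * c" using diag_dvd_in[OF assms] unfolding dvd_in_def by blast
  have "c \<in> polys_over C"
    by (rule monic_quotient_regular[OF _ _ _ c]) (use assms diag_rank(2) diag_regular smith_rank_in(1) in auto)
  then show ?thesis using c by (intro bexI)
qed

lemma quotient_regular_all: "f i \<in> polys_over C"
  using quotient_regular[of i] regD(1) by (cases "i < r\<^sub>0") (auto simp: sqfr_quotient_def)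

text \<open>The square-free parts are the partial products of the \<open>f i\<close>, starting from
  1, so regularity of the quotients is enough to evaluate them.\<close>

lemma sqfr_diag_regular: "i \<le> r\<^sub>0 \<Longrightarrow> sqfr K (s i) \<in> polys_over C"
proof (induction i)
  case 0
  then show ?case using sqfr_1[OF K] regD(2) by (simp add: diag_0)
next
  case (Suc i)
  then show ?case using sqfr_quotient_mult(1)[of i] quotient_regular_all regD(6) by simp
qed

section \<open>Strata of the Smith form under a specialisation\<close>

context
  fixes pe :: "'a poly \<Rightarrow> 'c::field"
  assumes pe: "partial_hom (polys_over C) pe"
begin

interpretation pe: partial_hom "polys_over C" pe by (rule pe)

text \<open>For the last \<open>r\<close> up to the rank with nonzero value of \<open>s r\<close>,
  if \<open>r\<close> is below the rank, \<open>s (Suc r)\<close> vanishes, and with it its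
  square-free part, of which it divides a power. That part is \<open>sqfr K (s r) * f r\<close>,
  whose first factor divides \<open>s r\<close> and is nonzero; so \<open>f r\<close> vanishes. At
  the rank itself \<open>f r\<close> is zero by definition.\<close>

lemma exists_stratum:
  "\<exists>r\<in>smith_index_set K H. pe (s r) \<noteq> 0 \<and> pe (f r) = 0"
proof -
  let ?S = "{i. i \<le> r\<^sub>0 \<and> pe (s i) \<noteq> 0}"
  define r where "r = Max ?S"
  have "finite ?S" "0 \<in> ?S" by (simp_all add: diag_0 pe.ev_1)
  then have r: "r \<le> r\<^sub>0" "pe (s r) \<noteq> 0" and max: "\<And>i. i \<le> r\<^sub>0 \<Longrightarrow> pe (s i) \<noteq> 0 \<Longrightarrow> i \<le> r"
  proof -
    assume fin: "finite ?S" and "0 \<in> ?S"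
    then have "?S \<noteq> {}" by blast
    from Max_in[OF fin this] show "r \<le> r\<^sub>0" "pe (s r) \<noteq> 0" unfolding r_def by blast+
    show "i \<le> r" if "i \<le> r\<^sub>0" "pe (s i) \<noteq> 0" for i
      unfolding r_def by (rule Max_ge[OF fin]) (use that in simp)
  qed
  show ?thesis
  proof (cases "r < r\<^sub>0")
    case False
    then have "f r = 0" by (simp add: sqfr_quotient_def)
    then show ?thesis using r pe.ev_0 by (intro bexI[of _ r]) (simp_all add: smith_index_set_def)
  next
    case True
    then have Suc_r: "Suc r \<le> r\<^sub>0" by simp
    then have z: "pe (s (Suc r)) = 0" using max by fastforce
    note q = sqfr_quotient_mult[OF True]
    obtain e c where e: "sqfr K (s (Suc r)) ^ e = s (Suc r) * c"
      using dvd_power_sqfr[OF K diag_rank(1)[OF Suc_r] diag_nonzero[OF Suc_r]] unfolding dvd_in_def by blast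
    have sR: "s (Suc r) \<in> polys_over C" "sqfr K (s (Suc r)) \<in> polys_over C" "sqfr K (s r) \<in> polys_over C"
      "s r \<in> polys_over C"
      using diag_regular sqfr_diag_regular Suc_r smith_rank_in(1) by simp_all
    have cR: "c \<in> polys_over C"
      by (rule monic_quotient_regular[OF sR(1) diag_rank(2)[OF Suc_r] regD(7)[OF sR(2)] e])
    have "pe (sqfr K (s (Suc r)) ^ e) = 0" unfolding e using pe.ev_mult[OF sR(1) cR] z by simp
    moreover have "pe (p ^ k) = pe p ^ k" if "p \<in> polys_over C" for p k
      using that by (induction k) (simp_all add: pe.ev_1 pe.ev_mult regD)
    ultimately have "pe (sqfr K (s (Suc r))) = 0" using sR(2) by simp
    then have 0: "pe (sqfr K (s r)) * pe (f r) = 0"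
      unfolding q(1) using pe.ev_mult[OF sR(3) quotient_regular_all] by simp
    obtain d where d: "s r = sqfr K (s r) * d"
      using sqfr_diag(3)[OF r(1)] unfolding dvd_in_def by blast
    have dR: "d \<in> polys_over C"
      by (rule monic_quotient_regular[OF sR(3) sqfr_diag(1)[OF r(1)] sR(4) d])
    have "pe (s r) = pe (sqfr K (s r)) * pe d" by (subst d) (rule pe.ev_mult[OF sR(3) dR])
    then have f0: "pe (f r) = 0" using 0 r(2) by auto
    \<comment> \<open>A monic constant is 1 and cannot vanish, so the index set discards no stratum
      that occurs.\<close>
    have "degree (f r) > 0"
    proof (rule ccontr)
      assume "\<not> degree (f r) > 0"
      then have d0: "degree (f r) = 0" by simp
      then obtain c where c: "f r = [:c:]" by (rule degree_eq_zeroE)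
      then have "f r = 1" using q(3) by (simp add: one_pCons)
      then show False using f0 pe.ev_1 by simp
    qed
    then show ?thesis using r f0 by (intro bexI[of _ r]) (simp_all add: smith_index_set_def)
  qed
qed

text \<open>In the first \<open>r\<close> columns these entries lie below the diagonal. In the
  trailing block every entry is a multiple of \<open>s (Suc r)\<close>, which is a multiple of
  \<open>f r\<close> if \<open>r\<close> is below the rank and is zero if \<open>r\<close> equals
  the rank.\<close>

lemma stratum_zero_rows:
  assumes r: "r \<in> smith_index_set K H" and f0: "pe (f r) = 0"
    and kl: "r \<le> k" "k < m" "l < n"
  shows "pe (H $$ (k, l)) = 0"
proof (cases "l < r")
  case True
  then show ?thesis using below_diagonal[of k l] kl pe.ev_0 by simp
next
  case False
  have rr: "r \<le> r\<^sub>0" using r by (simp add: smith_index_set_def)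
  have rmin: "r < min m n" using False kl by simp
  have srC: "s (Suc r) \<in> polys_over C" using diag_regular rmin by simp
  obtain c where c: "H $$ (k, l) = s (Suc r) * c" using diag_dvd_entry[OF rmin kl(1,2) _ kl(3)] False by auto
  show ?thesis
  proof (cases "r < r\<^sub>0")
    case True
    obtain g where g: "s (Suc r) = f r * g" by (rule sqfr_quotient_cofactor[OF True])
    have gR: "g \<in> polys_over C"
      by (rule monic_quotient_regular[OF quotient_regular_all sqfr_quotient_mult(3)[OF True] srC g])
    have z: "pe (s (Suc r)) = 0" unfolding g using pe.ev_mult[OF quotient_regular_all gR] f0 by simp
    have "lead_coeff (s (Suc r)) = 1" using diag_rank(2)[of "Suc r"] True by simp
    then have cR: "c \<in> polys_over C" by (rule monic_quotient_regular[OF srC _ entry_regular[OF kl(2,3)] c])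
    then show ?thesis unfolding c using pe.ev_mult[OF srC cR] z by simp
  next
    case False
    then have "s (Suc r) = 0" using smith_rank_ge[of "Suc r"] rmin rr by fastforce
    then show ?thesis using c pe.ev_0 by simp
  qed
qed

end

text \<open>The determinant is the product of \<open>s 1, ..., s r\<close>, all of which divide
  \<open>s r\<close>: the single inverse \<open>1 / s r\<close> yields the inverse of the
  determinant, and the adjugate does the rest.\<close>

lemma leading_inverse_in:
  fixes L :: "'a poly fract set"
  assumes L: "is_subring L" "\<And>p. p \<in> polys_over C \<Longrightarrow> to_fract p \<in> L"
    and r: "r \<le> r\<^sub>0" and inv: "1 / to_fract (s r) \<in> L"
  defines "M \<equiv> mat r r (\<lambda>(i, j). to_fract (H $$ (i, j)))"
  shows "leading_inverse H r \<in> carrier_mat r r" "mat_in L (leading_inverse H r)"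
    "M * leading_inverse H r = 1\<^sub>m r" "leading_inverse H r * M = 1\<^sub>m r"
proof -
  have M: "M \<in> carrier_mat r r" by (simp add: M_def)
  have rmn: "r \<le> m" "r \<le> n" using r smith_rank_in(1) by auto
  have Mi: "mat_in L M" using rmn L(2) entry_regular by (auto simp: mat_in_def M_def)
  have "upper_triangular M"
    using below_diagonal rmn by (auto simp: upper_triangular_def M_def)
  then have "det M = prod_list (diag_mat M)" by (rule det_upper_triangular[OF _ M])
  also have "\<dots> = (\<Prod>i = 0..<r. M $$ (i, i))" using M by (simp add: prod_list_diag_prod)
  also have "\<dots> = (\<Prod>i = 0..<r. to_fract (s (Suc i)))"
    by (rule prod.cong) (use rmn in \<open>auto simp: M_def diag_Suc\<close>)
  finally have det: "det M = (\<Prod>i = 0..<r. to_fract (s (Suc i)))" .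
  have "inverse (to_fract (s (Suc i))) \<in> L" if "i < r" for i
  proof -
    obtain c where c: "c \<in> polys_over C" "s r = s (Suc i) * c"
      using diag_regular_quotient[OF Suc_leI[OF \<open>i < r\<close>] r] by blast
    have nz: "to_fract (s r) \<noteq> 0" "to_fract (s (Suc i)) \<noteq> 0"
      using diag_nonzero[of r] diag_nonzero[of "Suc i"] r that by simp_all
    have "to_fract (s r) = to_fract (s (Suc i)) * to_fract c" unfolding c(2) by (rule to_fract_mult)
    then have "inverse (to_fract (s (Suc i))) = to_fract c * (1 / to_fract (s r))"
      using nz by (simp add: field_simps)
    then show ?thesis using is_subringD(6)[OF L(1) L(2)[OF c(1)] inv] by simp
  qed
  then have dL: "inverse (det M) \<in> L" unfolding det prod_inversef[symmetric] o_def
    by (intro is_subring_prod[OF L(1)]) simp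
  have dnz: "det M \<noteq> 0" unfolding det using diag_nonzero r by simp
  obtain V where V: "V \<in> carrier_mat r r" "M * V = 1\<^sub>m r" "V * M = 1\<^sub>m r" "V = inverse (det M) \<cdot>\<^sub>m adj_mat M"
    by (rule obtain_inverse_mat[OF M dnz])
  \<comment> \<open>\<open>leading_inverse\<close> is defined through \<open>mat_inverse\<close>; by
    uniqueness of inverses its result is the adjugate expression \<open>V\<close>.\<close>
  have "mat_inverse M \<noteq> None"
    using mat_inverse(1)[OF M, where b = "()"] det_non_zero_imp_unit[OF M dnz, where b = "()"] by blast
  then obtain B where B: "mat_inverse M = Some B" by blast
  note BD = mat_inverse(2)[OF M B]
  have Bc: "B \<in> carrier_mat r r" "B * M = 1\<^sub>m r" using BD by simp_all
  have "B = B * (M * V)" using V(2) Bc by simp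
  also have "\<dots> = (B * M) * V" by (rule assoc_mult_mat[OF Bc(1) M V(1), symmetric])
  also have "\<dots> = V" unfolding Bc(2) by (rule left_mult_one_mat[OF V(1)])
  finally have li: "leading_inverse H r = V" using B by (simp add: leading_inverse_def M_def)
  show "leading_inverse H r \<in> carrier_mat r r" "M * leading_inverse H r = 1\<^sub>m r" "leading_inverse H r * M = 1\<^sub>m r"
    unfolding li by (rule V)+
  show "mat_in L (leading_inverse H r)"
    unfolding li V(4) using adj_mat_in[OF L(1) Mi M] dL is_subringD(6)[OF L(1)] by (simp add: mat_in_def)
qed

end


section \<open>Correctness of TriangularSmithPLS\<close>

text \<open>\<open>quot\<close> settles the algebraic case. In the transcendental case
  \<open>f i\<close> is a monic factor, with monic cofactor, of \<open>s (Suc i)\<close>, whose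
  coefficients are regular, and \<open>monic_factor_regular\<close> applies.\<close>

lemma regular_sqfr_quotient:
  fixes E :: "('y::{finite,linorder}, 'a::field) param_ext"
  assumes E: "parameterized_extension E" and H: "smith_form (ext_field E) H m n"
    and entry: "\<And>i j. i < m \<Longrightarrow> j < n \<Longrightarrow> H $$ (i, j) \<in> polys_over (regular_coeffs E N)"
    and quot: "\<not> purely_transcendental E \<Longrightarrow>
      sqfr_quotient (ext_field E) H i \<in> polys_over (regular_coeffs E N)"
    and i: "i < smith_rank H"
  shows "sqfr_quotient (ext_field E) H i \<in> polys_over (regular_coeffs E N)"
proof (cases "purely_transcendental E")
  case False
  then show ?thesis by (rule quot)
next
  case True
  interpret smith_form "ext_field E" H m n by (rule H)
  obtain g where g: "g \<in> polys_over (ext_field E)" "lead_coeff g = 1" "s (Suc i) = f i * g"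
    by (rule sqfr_quotient_cofactor[OF i])
  have "i < min m n" using i smith_rank_in(1) by simp
  then have "f i * g \<in> polys_over (regular_coeffs E N)"
    unfolding g(3)[symmetric] using diag_Suc entry by simp
  then show ?thesis using monic_factor_regular[OF E True sqfr_quotient_mult(2,3)[OF i] g(1,2)] by blast
qed

context
  fixes E :: "('y::{finite,linorder}, 'a::field) param_ext"
begin

lemma regular_fracts_entry_over:
  assumes "q \<in> regular_fracts E N"
  shows "entry_over E N q"
proof -
  obtain n d where nd: "is_fraction E q n d" "denominator_from E N d"
    using assms unfolding regular_fracts_def by blast
  have "poly_over (ext_field E) (gen_poly E p)" for p
    by (simp add: poly_over_def coeff_gen_poly gen_eval_ext_field)
  moreover have "gen_poly E d \<noteq> 0" "q = Fract (gen_poly E n) (gen_poly E d)"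
    using nd(1) by (simp_all add: is_fraction_def)
  ultimately show ?thesis unfolding entry_over_def using nd by blast
qed

lemma gen_poly_regular:
  shows "gen_poly E p \<in> polys_over (regular_coeffs E N)"
  by (simp add: polys_over_def coeff_gen_poly regular_coeffs_localization
      localization_image[OF comm_ring_hom_gen_eval])

lemma gen_poly_const:
  shows "gen_poly E [:Poly_Mapping.single 0 c:] = [:const_univ c:]"
  by (simp add: gen_poly_pCons comm_ring_homD(1)[OF comm_ring_hom_gen_poly] gen_eval_def
      ypoly_eval_single[OF comm_ring_hom_const_univ])

end

lemma at_point_single:
  fixes a :: "'y::{finite,linorder} \<Rightarrow> 'a::field alg_closure"
  shows "at_point a \<xi> [:Poly_Mapping.single 0 c:] = to_ac c"
  by (simp add: at_point_const ypoly_eval_single[OF comm_ring_hom_to_ac])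

lemma mem_triangular_smith_pls:
  "\<sigma> \<in> triangular_smith_pls \<rho> E H b N Z \<longleftrightarrow>
     (\<exists>r\<in>smith_index_set (ext_field E) H.
        let num = (\<lambda>q. fst (\<rho> E N (to_fract q)));
            den = (\<lambda>q. snd (\<rho> E N (to_fract q)));
            s = smith_diag H r;
            f = sqfr_quotient (ext_field E) H r;
            Ns = N \<union> {num s, den s}
        in \<sigma> = Solution E (particular_solution H b r) (kernel_matrix H r)
             (Ns \<union> {yx_lcm ((\<lambda>q. snd (\<rho> E Ns q)) ` set\<^sub>v (particular_solution H b r)),
                yx_lcm ((\<lambda>q. snd (\<rho> E Ns q)) ` elements_mat (kernel_matrix H r)), den f} \<union>
                (\<lambda>j. den (vec_index b j)) ` {r..<dim_row H})
             (Z \<union> {num f} \<union> (\<lambda>j. num (vec_index b j)) ` {r..<dim_row H}) \<or>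
           (\<exists>j\<in>{r..<dim_row H}. \<sigma> = Inconsistent
             (Ns \<union> {num (vec_index b j), den (vec_index b j), den f}) (Z \<union> {num f})))"
  unfolding triangular_smith_pls_def Let_def by (simp add: image_iff)

lemma mem_constructible:
  "(a, \<xi>) \<in> constructible N Z \<longleftrightarrow> (\<forall>p\<in>Z. at_point a \<xi> p = 0) \<and> (\<forall>p\<in>N. at_point a \<xi> p \<noteq> 0)"
  by (simp add: constructible_def)

lemma constructible_mono: "N \<subseteq> N' \<Longrightarrow> Z \<subseteq> Z' \<Longrightarrow> constructible N' Z' \<subseteq> constructible N Z"
  by (auto simp: constructible_def)

text \<open>\<open>N0\<close> holds the parameter polynomials that control the denominators of
  \<open>H\<close> and \<open>b\<close>; \<open>N\<close> contains them as constants, possibly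
  together with conditions in \<open>x\<close>. Coefficients are regular for \<open>N0\<close>,
  rational functions for \<open>N\<close>.\<close>

locale smith_regime =
  regular_smith_form "ext_field E" H m n "regular_coeffs E N0"
  for E :: "('y::{finite,linorder}, 'a::field) param_ext" and H m n N0 +
  fixes \<rho> :: "('y, 'a) fraction_choice" and b :: "('y, 'a) univ poly vec"
    and N Z :: "('y, 'a) yxpoly set"
  assumes E: "parameterized_extension E" and \<rho>: "fraction_choice \<rho>"
    and finite_N: "finite N" and finite_Z: "finite Z" and N0: "(\<lambda>p. [:p:]) ` N0 \<subseteq> N"
    and compatible: "\<And>a \<xi>. (a, \<xi>) \<in> constructible N Z \<Longrightarrow> compatible_point E a"
    and b_carrier: "b \<in> carrier_vec m"
    and b_regular: "\<And>j. j < m \<Longrightarrow> vec_index b j \<in> polys_over (regular_coeffs E N0)"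
begin

abbreviation "num q \<equiv> fst (\<rho> E N (to_fract q))"
abbreviation "den q \<equiv> snd (\<rho> E N (to_fract q))"
abbreviation "reg \<equiv> polys_over (regular_coeffs E N0)"

text \<open>Denominators of \<open>u r\<close> and \<open>B r\<close> are chosen relative to this
  enlarged set: the entries involve \<open>1 / s r\<close>, which becomes regular once the numerator
  of \<open>s r\<close> is inverted.\<close>

definition "Ns r = N \<union> {num (s r), den (s r)}"

abbreviation "Lr r \<equiv> regular_fracts E (Ns r)"
abbreviation "u r \<equiv> particular_solution H b r"
abbreviation "B r \<equiv> kernel_matrix H r"

abbreviation "N_solution r \<equiv>
  Ns r \<union> {yx_lcm ((\<lambda>q. snd (\<rho> E (Ns r) q)) ` set\<^sub>v (u r)),
    yx_lcm ((\<lambda>q. snd (\<rho> E (Ns r) q)) ` elements_mat (B r)), den (f r)} \<union>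
    (\<lambda>j. den (vec_index b j)) ` {r..<m}"
abbreviation "Z_solution r \<equiv> Z \<union> {num (f r)} \<union> (\<lambda>j. num (vec_index b j)) ` {r..<m}"
abbreviation "N_inconsistent r j \<equiv> Ns r \<union> {num (vec_index b j), den (vec_index b j), den (f r)}"
abbreviation "Z_inconsistent r \<equiv> Z \<union> {num (f r)}"

lemma finite_Ns: "finite (Ns r)"
  using finite_N by (simp add: Ns_def)

lemma to_fract_regular: "p \<in> reg \<Longrightarrow> to_fract p \<in> regular_fracts E N"
  using regular_polys_fract[OF N0 finite_N] by blast

lemma num_den:
  assumes "p \<in> reg"
  shows "is_fraction E (to_fract p) (num p) (den p)" "denominator_from E N (den p)"
  using fraction_choice_denominator[OF \<rho> E to_fract_regular[OF assms]] by blast+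

lemma rank_le: "r \<in> smith_index_set (ext_field E) H \<Longrightarrow> r \<le> r\<^sub>0"
  by (simp add: smith_index_set_def)

lemma diag_reg: "r \<le> r\<^sub>0 \<Longrightarrow> s r \<in> reg"
  using diag_regular smith_rank_in(1) by simp

lemma regular_Ns: "p \<in> reg \<Longrightarrow> to_fract p \<in> Lr r"
  using to_fract_regular regular_fracts_mono[of N "Ns r" E] finite_Ns by (auto simp: Ns_def)

lemma inverse_diag_regular:
  assumes "r \<le> r\<^sub>0"
  shows "1 / to_fract (s r) \<in> Lr r"
  by (rule regular_fracts_inverse[OF finite_Ns num_den(1)[OF diag_reg[OF assms]]])
    (use diag_nonzero[OF assms] in \<open>simp_all add: Ns_def\<close>)

lemma leading_inverse_regular:
  assumes r: "r \<le> r\<^sub>0"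
  shows "leading_inverse H r \<in> carrier_mat r r" "mat_in (Lr r) (leading_inverse H r)"
    "mat r r (\<lambda>(i, j). to_fract (H $$ (i, j))) * leading_inverse H r = 1\<^sub>m r"
    "leading_inverse H r * mat r r (\<lambda>(i, j). to_fract (H $$ (i, j))) = 1\<^sub>m r"
  using leading_inverse_in[of "Lr r", OF is_subring_regular_fracts regular_Ns r inverse_diag_regular[OF r]]
  by blast+

lemmas LD = is_subringD[OF is_subring_regular_fracts[of E]]

lemma rank_dims: "r \<le> r\<^sub>0 \<Longrightarrow> r \<le> m" "r \<le> r\<^sub>0 \<Longrightarrow> r \<le> n"
  using smith_rank_in(1) by simp_all

lemma u_regular:
  assumes r: "r \<le> r\<^sub>0"
  shows "u r \<in> carrier_vec n" "vec_in (Lr r) (u r)"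
proof -
  let ?v = "leading_inverse H r *\<^sub>v vec r (\<lambda>i. to_fract (vec_index b i))"
  note li = leading_inverse_regular[OF r]
  have c: "?v \<in> carrier_vec r" by (rule mult_mat_vec_carrier[OF li(1)]) simp
  have n: "dim_col H = n" using H by simp
  have "u r \<in> carrier_vec (r + (n - r))" unfolding particular_solution_def n
    by (rule append_carrier_vec[OF c]) simp
  then show "u r \<in> carrier_vec n" using rank_dims[OF r] by simp
  have "vec_in (Lr r) ?v"
    by (rule vec_in_mult[OF is_subring_regular_fracts li(2)])
      (use li(1) b_regular regular_Ns rank_dims[OF r] in \<open>auto simp: vec_in_def\<close>)
  then show "vec_in (Lr r) (u r)"
    using c LD(1) unfolding particular_solution_def by (auto simp: vec_in_def)
qed

lemma B_regular:
  assumes r: "r \<le> r\<^sub>0"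
  shows "B r \<in> carrier_mat n (n - r)" "mat_in (Lr r) (B r)"
proof -
  let ?H = "mat r (n - r) (\<lambda>(i, j). to_fract (H $$ (i, j + r)))"
  note li = leading_inverse_regular[OF r]
  have n: "dim_col H = n" using H by simp
  have c: "leading_inverse H r * ?H \<in> carrier_mat r (n - r)" using li(1) by simp
  have "B r \<in> carrier_mat (r + (n - r)) (n - r)" unfolding kernel_matrix_def n
    by (rule carrier_append_rows) (use c in auto)
  then show "B r \<in> carrier_mat n (n - r)" using rank_dims[OF r] by simp
  have "mat_in (Lr r) (leading_inverse H r * ?H)"
    by (rule mat_in_mult[OF is_subring_regular_fracts li(2)])
      (use li(1) entry_regular regular_Ns rank_dims[OF r] in \<open>auto simp: mat_in_def\<close>)
  then show "mat_in (Lr r) (B r)"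
    using c LD(1,2,3) unfolding kernel_matrix_def n append_rows_def by (auto simp: mat_in_def)
qed

section \<open>Values at a point of the constructible set\<close>

context
  fixes a :: "'y \<Rightarrow> 'a alg_closure" and \<xi> :: "'a alg_closure"
  assumes point: "(a, \<xi>) \<in> constructible N Z"
begin

abbreviation "ev \<equiv> eval_fract E a \<xi>"
abbreviation "pe p \<equiv> eval_fract E a \<xi> (to_fract p)"

lemma point_compatible: "compatible_point E a"
  using compatible point by blast

lemma point_nonzero: "p \<in> N \<Longrightarrow> at_point a \<xi> p \<noteq> 0"
  using point by (simp add: mem_constructible)

lemma pe_eq: "p \<in> reg \<Longrightarrow> pe p = poly (eval_poly_Y E a p) \<xi>"
  using regular_polys_fract[OF N0 finite_N] point_compatible point_nonzero by blast

lemma partial_hom_pe: "partial_hom reg (\<lambda>p. pe p)"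
proof (rule partial_hom_comp[where h = to_fract and g = ev and M = "regular_fracts E N"])
  show "partial_hom reg to_fract"
    by unfold_locales (simp_all add: is_subring_polys_over subring_C)
  show "partial_hom (regular_fracts E N) ev"
    by (rule partial_hom_eval_fract[OF finite_N point_compatible point_nonzero])
qed (rule to_fract_regular)

lemma den_nonzero: "p \<in> reg \<Longrightarrow> at_point a \<xi> (den p) \<noteq> 0"
  using denominator_from_nonzero[OF finite_N point_compatible point_nonzero num_den(2)] by blast

text \<open>Translates the constraints of a regime, stated on chosen numerators, into conditions on
  values. The chosen denominator is nonzero at the point, so numerator and fraction vanish
  together.\<close>

lemma num_eq_0_iff:
  assumes "p \<in> reg"
  shows "at_point a \<xi> (num p) = 0 \<longleftrightarrow> pe p = 0"
  using eval_fract_is_fraction[OF point_compatible num_den(1)[OF assms] den_nonzero[OF assms]]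
    den_nonzero[OF assms] by simp

definition "He = map_mat (\<lambda>p. pe p) H"

lemma He_carrier: "He \<in> carrier_mat m n"
  using H by (simp add: He_def)

context
  fixes r
  assumes r: "r \<in> smith_index_set (ext_field E) H"
    and f0: "pe (f r) = 0"
begin

lemma He_zero_rows:
  assumes "r \<le> k" "k < m" "l < n"
  shows "He $$ (k, l) = 0"
  using stratum_zero_rows[OF partial_hom_pe r f0 assms] H assms by (simp add: He_def)

lemma row_nonzero_inconsistent:
  assumes j: "r \<le> j" "j < m" and bj: "pe (vec_index b j) \<noteq> 0" and w: "w \<in> carrier_vec n"
  shows "He *\<^sub>v w \<noteq> map_vec (\<lambda>p. pe p) b"
proof
  assume eq: "He *\<^sub>v w = map_vec (\<lambda>p. pe p) b"
  have "vec_index (He *\<^sub>v w) j = (\<Sum>k = 0..<n. He $$ (j, k) * vec_index w k)"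
    using He_carrier w j by (simp add: scalar_prod_def)
  also have "\<dots> = 0" using He_zero_rows[OF j] by (intro sum.neutral) simp
  finally show False using eq bj j b_carrier by simp
qed

context
  assumes s_nonzero: "pe (s r) \<noteq> 0"
begin

lemma r_le: "r \<le> r\<^sub>0"
  by (rule rank_le[OF r])

lemma Ns_nonzero: "p \<in> Ns r \<Longrightarrow> at_point a \<xi> p \<noteq> 0"
  using point_nonzero den_nonzero[OF diag_reg[OF r_le]] num_eq_0_iff[OF diag_reg[OF r_le]] s_nonzero
  by (auto simp: Ns_def)

lemma partial_hom_Ns: "partial_hom (Lr r) ev"
  by (rule partial_hom_eval_fract[OF finite_Ns point_compatible Ns_nonzero])

interpretation ph: partial_hom "Lr r" ev
  by (rule partial_hom_Ns)

definition "Li = map_mat ev (leading_inverse H r)"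
definition "Hr = mat r r (\<lambda>(i, j). He $$ (i, j))"
definition "H12 = mat r (n - r) (\<lambda>(i, j). He $$ (i, j + r))"

text \<open>Evaluation is a homomorphism on the fractions regular for \<open>Ns r\<close>, so the
  two identities of the generic inverse can be evaluated: the value of the inverse is the inverse of
  the value.\<close>

lemma Li_inverse: "Li \<in> carrier_mat r r" "Hr * Li = 1\<^sub>m r" "Li * Hr = 1\<^sub>m r"
proof -
  let ?M = "mat r r (\<lambda>(i, j). to_fract (H $$ (i, j)))"
  note li = leading_inverse_regular[OF r_le]
  note rd = rank_dims[OF r_le]
  show "Li \<in> carrier_mat r r" using li(1) by (simp add: Li_def)
  have Mi: "mat_in (Lr r) ?M" using entry_regular regular_Ns rd by (auto simp: mat_in_def)
  have M: "map_mat ev ?M = Hr" by (rule eq_matI) (use H rd in \<open>auto simp: Hr_def He_def\<close>)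
  have one: "map_mat ev (1\<^sub>m r) = 1\<^sub>m r" by (rule eq_matI) (auto simp: ph.ev_0 ph.ev_1)
  have "map_mat ev (?M * leading_inverse H r) = Hr * Li"
    unfolding Li_def M[symmetric] by (rule ph.map_mat_mult[OF Mi li(2)]) (use li(1) in simp)
  then show "Hr * Li = 1\<^sub>m r" unfolding li(3) one ..
  have "map_mat ev (leading_inverse H r * ?M) = Li * Hr"
    unfolding Li_def M[symmetric] by (rule ph.map_mat_mult[OF li(2) Mi]) (use li(1) in simp)
  then show "Li * Hr = 1\<^sub>m r" unfolding li(4) one ..
qed

lemma eval_u: "map_vec ev (u r) = (Li *\<^sub>v vec r (\<lambda>i. pe (vec_index b i))) @\<^sub>v 0\<^sub>v (n - r)"
proof -
  let ?b = "vec r (\<lambda>i. to_fract (vec_index b i))"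
  note li = leading_inverse_regular[OF r_le]
  have n: "dim_col H = n" using H by simp
  have bi: "vec_in (Lr r) ?b" using b_regular regular_Ns rank_dims[OF r_le] by (auto simp: vec_in_def)
  have "map_vec ev (leading_inverse H r *\<^sub>v ?b) = Li *\<^sub>v map_vec ev ?b"
    unfolding Li_def by (rule ph.map_vec_mult[OF li(2) bi]) (use li(1) in simp)
  moreover have "map_vec ev ?b = vec r (\<lambda>i. pe (vec_index b i))" by (rule eq_vecI) simp_all
  moreover have "map_vec ev (v @\<^sub>v w) = map_vec ev v @\<^sub>v map_vec ev w" for v w
    by (rule eq_vecI) auto
  moreover have "map_vec ev (0\<^sub>v (n - r)) = 0\<^sub>v (n - r)" by (rule eq_vecI) (auto simp: ph.ev_0)
  ultimately show ?thesis unfolding particular_solution_def n by simp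
qed

lemma eval_B: "map_mat ev (B r) = (- (Li * H12)) @\<^sub>r 1\<^sub>m (n - r)"
proof -
  let ?H = "mat r (n - r) (\<lambda>(i, j). to_fract (H $$ (i, j + r)))"
  note li = leading_inverse_regular[OF r_le]
  note rd = rank_dims[OF r_le]
  have n: "dim_col H = n" using H by simp
  have Hi: "mat_in (Lr r) ?H" using entry_regular regular_Ns rd by (auto simp: mat_in_def)
  have P: "mat_in (Lr r) (leading_inverse H r * ?H)"
    by (rule mat_in_mult[OF is_subring_regular_fracts li(2) Hi]) (use li(1) in simp)
  have "map_mat ev ?H = H12" by (rule eq_matI) (use H rd in \<open>auto simp: H12_def He_def\<close>)
  then have prod: "map_mat ev (leading_inverse H r * ?H) = Li * H12"
    unfolding Li_def using ph.map_mat_mult[OF li(2) Hi] li(1) by simp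
  have neg: "map_mat ev (- M) = - map_mat ev M" if "mat_in (Lr r) M" for M
    by (rule eq_matI) (use that ph.ev_uminus in \<open>auto simp: mat_in_def\<close>)
  have app: "map_mat ev (M @\<^sub>r M') = map_mat ev M @\<^sub>r map_mat ev M'" if "dim_col M = dim_col M'" for M M'
    by (rule eq_matI) (use that in \<open>auto simp: append_rows_def ph.ev_0\<close>)
  have one: "map_mat ev (1\<^sub>m (n - r)) = 1\<^sub>m (n - r)" by (rule eq_matI) (auto simp: ph.ev_0 ph.ev_1)
  show ?thesis unfolding kernel_matrix_def n
    by (subst app) (simp_all add: neg[OF P] prod one)
qed

lemma eval_particular_solution:
  assumes "\<And>j. r \<le> j \<Longrightarrow> j < m \<Longrightarrow> pe (vec_index b j) = 0"
  shows "He *\<^sub>v map_vec ev (u r) = map_vec (\<lambda>p. pe p) b"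
proof -
  let ?b = "map_vec (\<lambda>p. pe p) b"
  note rd = rank_dims[OF r_le]
  have "He *\<^sub>v ((Li *\<^sub>v vec r (\<lambda>i. vec_index ?b i)) @\<^sub>v 0\<^sub>v (n - r)) = ?b"
    by (rule block_particular_solution[OF He_carrier rd He_zero_rows Hr_def H12_def Li_inverse])
      (use assms b_carrier in simp_all)
  moreover have "vec r (\<lambda>i. vec_index ?b i) = vec r (\<lambda>i. pe (vec_index b i))"
    by (rule eq_vecI) (use b_carrier rd in simp_all)
  ultimately show ?thesis unfolding eval_u by simp
qed

lemmas eval_kernel =
  block_kernel[OF He_carrier rank_dims[OF r_le] He_zero_rows Hr_def H12_def Li_inverse, folded eval_B]

text \<open>In the extension the denominators divide powers of the product of \<open>Ns r\<close>,
  so adjoining their common multiple to the nonvanishing set removes no point of the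
  stratum.\<close>

lemma yx_lcm_den_nonzero:
  assumes "finite Q" "Q \<subseteq> Lr r"
  shows "at_point a \<xi> (yx_lcm ((\<lambda>q. snd (\<rho> E (Ns r) q)) ` Q)) \<noteq> 0"
proof (rule at_point_yx_lcm_nonzero)
  show "finite ((\<lambda>q. snd (\<rho> E (Ns r) q)) ` Q)" using assms(1) by simp
  fix d assume "d \<in> (\<lambda>q. snd (\<rho> E (Ns r) q)) ` Q"
  then obtain q where q: "d = snd (\<rho> E (Ns r) q)" "q \<in> Lr r" using assms(2) by blast
  then show "at_point a \<xi> d \<noteq> 0" unfolding q(1)
    using denominator_from_nonzero[OF finite_Ns point_compatible Ns_nonzero]
      fraction_choice_denominator(2)[OF \<rho> E] by blast
qed

lemma den_u_nonzero: "at_point a \<xi> (yx_lcm ((\<lambda>q. snd (\<rho> E (Ns r) q)) ` set\<^sub>v (u r))) \<noteq> 0"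
  by (rule yx_lcm_den_nonzero) (use u_regular(2)[OF r_le] in \<open>auto simp: vec_set_def vec_in_def\<close>)

lemma den_B_nonzero: "at_point a \<xi> (yx_lcm ((\<lambda>q. snd (\<rho> E (Ns r) q)) ` elements_mat (B r))) \<noteq> 0"
  by (rule yx_lcm_den_nonzero) (use B_regular(2)[OF r_le] in \<open>auto simp: elements_mat_def mat_in_def\<close>)

end

end

text \<open>On the stratum \<open>r\<close> of the point, either some entry of \<open>b\<close> with
  index at least \<open>r\<close>, counted from 0, has nonzero value, giving an inconsistency
  regime, or all of them vanish, giving the solution regime. The adjoined denominators are nonzero
  there.\<close>

lemma triangular_smith_pls_covers_point:
  "\<exists>\<sigma>\<in>triangular_smith_pls \<rho> E H b N Z. (a, \<xi>) \<in> regime_set \<sigma>"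
proof -
  obtain r where r: "r \<in> smith_index_set (ext_field E) H" "pe (s r) \<noteq> 0" "pe (f r) = 0"
    using exists_stratum[OF partial_hom_pe] by blast
  have H_rows: "dim_row H = m" using H by simp
  have Z: "at_point a \<xi> p = 0" if "p \<in> Z" for p using point that by (simp add: mem_constructible)
  have Nf: "at_point a \<xi> (num (f r)) = 0" "at_point a \<xi> (den (f r)) \<noteq> 0"
    using num_eq_0_iff[OF quotient_regular_all] den_nonzero[OF quotient_regular_all] r by blast+
  have Nsz: "at_point a \<xi> p \<noteq> 0" if "p \<in> Ns r" for p using Ns_nonzero[OF r(1,3,2)] that by blast
  show ?thesis
  proof (cases "\<exists>j\<in>{r..<m}. pe (vec_index b j) \<noteq> 0")
    case True
    then obtain j where j: "j \<in> {r..<m}" "pe (vec_index b j) \<noteq> 0" by blast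
    have bj: "at_point a \<xi> (num (vec_index b j)) \<noteq> 0" "at_point a \<xi> (den (vec_index b j)) \<noteq> 0"
      using num_eq_0_iff[OF b_regular] den_nonzero[OF b_regular] j by auto
    let ?\<sigma> = "Inconsistent (N_inconsistent r j) (Z_inconsistent r)"
    have "?\<sigma> \<in> triangular_smith_pls \<rho> E H b N Z"
      unfolding mem_triangular_smith_pls Let_def H_rows Ns_def using r(1) j(1) by blast
    moreover have "(a, \<xi>) \<in> regime_set ?\<sigma>"
      unfolding regime_set.simps mem_constructible using Z Nf Nsz bj by blast
    ultimately show ?thesis by (intro bexI)
  next
    case False
    let ?\<sigma> = "Solution E (u r) (B r) (N_solution r) (Z_solution r)"
    have "?\<sigma> \<in> triangular_smith_pls \<rho> E H b N Z"
      unfolding mem_triangular_smith_pls Let_def H_rows Ns_def using r(1) by blast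
    moreover have "at_point a \<xi> (num (vec_index b j)) = 0" "at_point a \<xi> (den (vec_index b j)) \<noteq> 0"
      if "j \<in> {r..<m}" for j
      using num_eq_0_iff[OF b_regular] den_nonzero[OF b_regular] that False by auto
    then have "(a, \<xi>) \<in> regime_set ?\<sigma>"
      unfolding regime_set.simps mem_constructible
      using Z Nf Nsz den_u_nonzero[OF r(1,3,2)] den_B_nonzero[OF r(1,3,2)] by blast
    ultimately show ?thesis by (intro bexI)
  qed
qed

end

end


section \<open>Correctness of PLSviaCTSNF\<close>

lemma regime_set_change_coordinates [simp]: "regime_set (change_coordinates R \<sigma>) = regime_set \<sigma>"
  by (cases \<sigma>) (simp_all add: Let_def)

text \<open>\<open>c\<close> is the right-hand side of the given problem and \<open>b\<close> the
  transformed one. \<open>unimodular\<close> and \<open>transform\<close> are stated at the points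
  of the constructible set, which is the form in which a Smith regime supplies them.\<close>

locale pls_via_smith =
  smith_regime E H m n N0 \<rho> b N Z
  for E :: "('y::{finite,linorder}, 'a::field) param_ext" and H m n N0 \<rho> b N Z +
  fixes A :: "('y, 'a) yxpoly mat" and c :: "('y, 'a) yxpoly vec"
    and U :: "('y, 'a) univ poly mat" and R :: "'a mat"
  assumes A: "A \<in> carrier_mat m n" and c: "c \<in> carrier_vec m" and U: "U \<in> carrier_mat m m"
    and R: "R \<in> carrier_mat n n" and det_R: "det R \<noteq> 0"
    and U_regular: "\<And>i j. i < m \<Longrightarrow> j < m \<Longrightarrow> U $$ (i, j) \<in> polys_over (regular_coeffs E N0)"
    and b_eq: "b = U *\<^sub>v map_vec (gen_poly E) c"
    and tower: "(\<lambda>p. [:p:]) ` tower_polys E \<subseteq> Z"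
    and unimodular: "\<And>a \<xi>. (a, \<xi>) \<in> constructible N Z \<Longrightarrow> det (map_mat (eval_poly_Y E a) U) dvd 1"
    and transform: "\<And>a \<xi>. (a, \<xi>) \<in> constructible N Z \<Longrightarrow>
      map_mat (eval_poly_Y E a) U * map_mat (at_params_x a) A * map_mat (\<lambda>c. [:to_ac c:]) R
        = map_mat (eval_poly_Y E a) H"
begin

abbreviation "R' \<equiv> map_mat (\<lambda>c. to_fract [:const_univ c :: ('y, 'a) univ:]) R"

lemma R'_regular: "mat_in (regular_fracts E M) R'"
proof -
  have "to_fract [:const_univ c:] \<in> regular_fracts E M" for c
    using gen_poly_regular_fracts[of E "[:Poly_Mapping.single 0 c:]" M] by (simp add: gen_poly_const)
  then show ?thesis using R by (auto simp: mat_in_def)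
qed

context
  fixes a :: "'y \<Rightarrow> 'a alg_closure" and \<xi> :: "'a alg_closure"
  assumes point: "(a, \<xi>) \<in> constructible N Z"
begin

abbreviation "evf \<equiv> eval_fract E a \<xi>"
abbreviation "pev p \<equiv> evf (to_fract p)"
abbreviation "Ae \<equiv> map_mat (at_point a \<xi>) A"
abbreviation "ce \<equiv> map_vec (at_point a \<xi>) c"
abbreviation "Rev \<equiv> map_mat to_ac R"

definition "Ue = map_mat (\<lambda>p. pev p) U"

lemma eval_carriers: "Ae \<in> carrier_mat m n" "Rev \<in> carrier_mat n n" "Ue \<in> carrier_mat m m"
  using A R U by (simp_all add: Ue_def)

lemma Ue_eq: "Ue = map_mat (\<lambda>p. poly p \<xi>) (map_mat (eval_poly_Y E a) U)"
  unfolding Ue_def by (rule eq_matI) (use U pe_eq[OF point U_regular] in auto)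

text \<open>A unit of the polynomial ring keeps a nonzero value under every substitution for
  \<open>x\<close>; a merely nonzero determinant might vanish at \<open>\<xi>\<close>.\<close>

lemma det_Ue: "det Ue \<noteq> 0"
proof -
  obtain d where "1 = det (map_mat (eval_poly_Y E a) U) * d" using unimodular[OF point] by (auto simp: dvd_def)
  from arg_cong[OF this, of "\<lambda>p. poly p \<xi>"]
  have "poly (det (map_mat (eval_poly_Y E a) U)) \<xi> \<noteq> 0" by auto
  then show ?thesis unfolding Ue_eq comm_ring_hom.hom_det[OF comm_ring_hom_poly] .
qed

lemma det_Rev: "det Rev \<noteq> 0"
  unfolding comm_ring_hom.hom_det[OF comm_ring_hom_to_ac] using det_R by simp

lemma transform_eval: "Ue * Ae * Rev = He a \<xi>"
proof -
  interpret p: partial_hom UNIV "\<lambda>p::'a alg_closure poly. poly p \<xi>"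
    by (rule partial_hom_UNIV[OF comm_ring_hom_poly])
  let ?ev = "map_mat (\<lambda>p::'a alg_closure poly. poly p \<xi>)"
  have in_UNIV: "mat_in UNIV M" for M :: "'a alg_closure poly mat" by (simp add: mat_in_def)
  have "?ev (map_mat (eval_poly_Y E a) U * map_mat (at_params_x a) A * map_mat (\<lambda>c. [:to_ac c:]) R) =
    ?ev (map_mat (eval_poly_Y E a) U) * ?ev (map_mat (at_params_x a) A) * ?ev (map_mat (\<lambda>c. [:to_ac c:]) R)"
    by (subst p.map_mat_mult[OF in_UNIV in_UNIV], use U A R in simp)+ simp
  also have "?ev (map_mat (at_params_x a) A) = Ae" by (rule eq_matI) (auto simp: at_point_def)
  also have "?ev (map_mat (\<lambda>c. [:to_ac c:]) R) = Rev" by (rule eq_matI) auto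
  also have "?ev (map_mat (eval_poly_Y E a) U) = Ue" by (rule Ue_eq[symmetric])
  finally have "Ue * Ae * Rev = ?ev (map_mat (eval_poly_Y E a) H)" unfolding transform[OF point] by (rule sym)
  also have "\<dots> = He a \<xi>"
    unfolding He_def[OF point] by (rule eq_matI) (use H pe_eq[OF point entry_regular] in auto)
  finally show ?thesis .
qed

lemma b_eval: "map_vec (\<lambda>p. pev p) b = Ue *\<^sub>v ce"
proof -
  interpret pe: partial_hom reg "\<lambda>p. pev p" by (rule partial_hom_pe[OF point])
  have "map_vec (\<lambda>p. pev p) (U *\<^sub>v map_vec (gen_poly E) c) = Ue *\<^sub>v map_vec (\<lambda>p. pev p) (map_vec (gen_poly E) c)"
    unfolding Ue_def by (rule pe.map_vec_mult)
      (use U c U_regular gen_poly_regular in \<open>auto simp: mat_in_def vec_in_def\<close>)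
  also have "map_vec (\<lambda>p. pev p) (map_vec (gen_poly E) c) = ce"
    by (rule eq_vecI) (simp_all add: eval_fract_image[OF point_compatible[OF point]])
  finally show ?thesis unfolding b_eq .
qed

lemma R'_eval: "map_mat (eval_fract E a \<xi>) R' = Rev"
proof -
  have "eval_fract E a \<xi> (to_fract [:const_univ c:]) = to_ac c" for c
    using eval_fract_image[OF point_compatible[OF point], of \<xi> "[:Poly_Mapping.single 0 c:]"]
    by (simp add: gen_poly_const at_point_single)
  then show ?thesis by (intro eq_matI) auto
qed

text \<open>A solution \<open>x\<close> would yield, through the inverse of \<open>R\<close>, a
  solution of the transformed system; but row \<open>j\<close> of the evaluated \<open>H\<close> is
  zero while entry \<open>j\<close> of its right-hand side is not.\<close>

lemma inconsistent_point:
  assumes r: "r \<in> smith_index_set (ext_field E) H" "pev (f r) = 0"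
    and j: "r \<le> j" "j < m" "pev (vec_index b j) \<noteq> 0" and x: "x \<in> carrier_vec n"
  shows "Ae *\<^sub>v x \<noteq> ce"
proof
  assume eq: "Ae *\<^sub>v x = ce"
  obtain w where w: "w \<in> carrier_vec n" "He a \<xi> *\<^sub>v w = Ue *\<^sub>v (Ae *\<^sub>v x)"
    using solution_transformed[OF eval_carriers(1,3) det_Ue eval_carriers(2) det_Rev transform_eval x] by blast
  then show False
    using row_nonzero_inconsistent[OF point r j w(1)] unfolding b_eval eq by blast
qed

lemma solution_point:
  assumes r: "r \<in> smith_index_set (ext_field E) H" "pev (f r) = 0" "pev (s r) \<noteq> 0"
    and b0: "\<And>j. r \<le> j \<Longrightarrow> j < m \<Longrightarrow> pev (vec_index b j) = 0"
  shows "Ae *\<^sub>v map_vec evf (R' *\<^sub>v u r) = ce"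
    and "nullspace_basis Ae (map_mat evf (R' * B r))"
proof -
  interpret ph: partial_hom "Lr r" evf by (rule partial_hom_Ns[OF point r])
  have r0: "r \<le> r\<^sub>0" by (rule rank_le[OF r(1)])
  note ur = u_regular[OF r0] and Br = B_regular[OF r0]
  have u': "map_vec evf (R' *\<^sub>v u r) = Rev *\<^sub>v map_vec evf (u r)"
    unfolding R'_eval[symmetric] by (rule ph.map_vec_mult[OF R'_regular ur(2)]) (use ur(1) R in simp)
  have B': "map_mat evf (R' * B r) = Rev * map_mat evf (B r)"
    unfolding R'_eval[symmetric] by (rule ph.map_mat_mult[OF R'_regular Br(2)]) (use Br(1) R in simp)
  show "Ae *\<^sub>v map_vec evf (R' *\<^sub>v u r) = ce"
    unfolding u'
  proof (rule transformed_solution[OF eval_carriers(1,3) det_Ue eval_carriers(2) det_Rev transform_eval])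
    show "map_vec evf (u r) \<in> carrier_vec n" using ur(1) by simp
    show "ce \<in> carrier_vec m" using c by simp
    show "He a \<xi> *\<^sub>v map_vec evf (u r) = Ue *\<^sub>v ce"
      unfolding b_eval[symmetric] by (rule eval_particular_solution[OF point r b0])
  qed
  note k = eval_kernel[OF point r]
  show "nullspace_basis Ae (map_mat evf (R' * B r))"
    unfolding B'
    by (rule transformed_nullspace_basis[OF eval_carriers(1,3) det_Ue eval_carriers(2) det_Rev transform_eval k(1)])
      (use k(2-4) in blast)+
qed

end

text \<open>Each regime fixes its own \<open>r\<close>, and its constraints say directly that
  \<open>f r\<close> vanishes and, for a solution, that \<open>s r\<close> does not; maximality of
  \<open>r\<close> enters only in the covering argument.\<close>

lemma regime_valid:
  assumes "\<sigma> \<in> triangular_smith_pls \<rho> E H b N Z"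
  shows "valid_pls_regime A c (change_coordinates R \<sigma>)"
proof -
  have H_rows: "dim_row H = m" using H by simp
  obtain r where r: "r \<in> smith_index_set (ext_field E) H"
    and cases: "\<sigma> = Solution E (u r) (B r) (N_solution r) (Z_solution r) \<or>
      (\<exists>j\<in>{r..<m}. \<sigma> = Inconsistent (N_inconsistent r j) (Z_inconsistent r))"
    using assms unfolding mem_triangular_smith_pls Let_def H_rows Ns_def by blast
  have r0: "r \<le> r\<^sub>0" by (rule rank_le[OF r])
  have NNs: "N \<subseteq> Ns r" by (auto simp: Ns_def)
  from cases show ?thesis
  proof
    let ?N = "N_solution r"
    let ?Z = "Z_solution r"
    assume \<sigma>: "\<sigma> = Solution E (u r) (B r) ?N ?Z"
    have finN: "finite ?N" using finite_Ns by simp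
    have finZ: "finite ?Z" using finite_Z by simp
    have sub: "constructible ?N ?Z \<subseteq> constructible N Z" by (rule constructible_mono) (use NNs in auto)
    \<comment> \<open>Regularity for \<open>Ns r\<close> passes to the larger nonvanishing set of
      the regime, to which \<open>entry_over\<close> refers.\<close>
    have LN: "Lr r \<subseteq> regular_fracts E ?N" by (rule regular_fracts_mono[OF _ finN]) auto
    note ur = u_regular[OF r0] and Br = B_regular[OF r0]
    have R'n: "dim_row R' = n" "dim_col R' = n" using R by simp_all
    have "vec_in (Lr r) (R' *\<^sub>v u r)"
      by (rule vec_in_mult[OF is_subring_regular_fracts R'_regular ur(2)]) (use ur(1) R'n in simp)
    then have eu: "\<forall>i<dim_vec (R' *\<^sub>v u r). entry_over E ?N (vec_index (R' *\<^sub>v u r) i)"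
      using LN regular_fracts_entry_over unfolding vec_in_def by blast
    have "mat_in (Lr r) (R' * B r)"
      by (rule mat_in_mult[OF is_subring_regular_fracts R'_regular Br(2)]) (use Br(1) R'n in simp)
    then have eB: "\<forall>i<dim_row (R' * B r). \<forall>j<dim_col (R' * B r). entry_over E ?N ((R' * B r) $$ (i, j))"
      using LN regular_fracts_entry_over unfolding mat_in_def by blast
    have points: "map_mat (at_point a \<xi>) A *\<^sub>v map_vec (eval_fract E a \<xi>) (R' *\<^sub>v u r) = map_vec (at_point a \<xi>) c \<and>
        nullspace_basis (map_mat (at_point a \<xi>) A) (map_mat (eval_fract E a \<xi>) (R' * B r))"
      if p: "(a, \<xi>) \<in> constructible ?N ?Z" for a \<xi>
    proof -
      have pNZ: "(a, \<xi>) \<in> constructible N Z" using p sub by blast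
      have z: "at_point a \<xi> q = 0" if "q \<in> ?Z" for q using p that unfolding mem_constructible by blast
      have nz: "at_point a \<xi> q \<noteq> 0" if "q \<in> ?N" for q using p that unfolding mem_constructible by blast
      have f0: "pev a \<xi> (f r) = 0"
        using num_eq_0_iff[OF pNZ quotient_regular_all, of r] z[of "num (f r)"] by simp
      have "num (s r) \<in> ?N" by (simp add: Ns_def)
      then have s0: "pev a \<xi> (s r) \<noteq> 0"
        using num_eq_0_iff[OF pNZ diag_reg[OF r0]] nz by blast
      have b0: "pev a \<xi> (vec_index b j) = 0" if "r \<le> j" "j < m" for j
        using num_eq_0_iff[OF pNZ b_regular[OF that(2)]] z[of "num (vec_index b j)"] that by simp
      show ?thesis using solution_point[OF pNZ r f0 s0 b0] by blast
    qed
    have comp: "\<forall>(a, \<xi>)\<in>constructible ?N ?Z. compatible_point E a" using sub compatible by blast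
    have tow: "(\<lambda>p. [:p:]) ` tower_polys E \<subseteq> ?Z" using tower by blast
    have dims: "dim_vec (R' *\<^sub>v u r) = dim_col A" "dim_row (R' * B r) = dim_col A"
      using A R by simp_all
    show ?thesis
      unfolding \<sigma> change_coordinates.simps valid_pls_regime.simps Let_def
      using finN finZ E tow comp dims eu eB points by blast
  next
    assume "\<exists>j\<in>{r..<m}. \<sigma> = Inconsistent (N_inconsistent r j) (Z_inconsistent r)"
    then obtain j where j: "r \<le> j" "j < m" and \<sigma>: "\<sigma> = Inconsistent (N_inconsistent r j) (Z_inconsistent r)" by auto
    let ?N = "N_inconsistent r j"
    let ?Z = "Z_inconsistent r"
    have sub: "constructible ?N ?Z \<subseteq> constructible N Z" by (rule constructible_mono) (use NNs in auto)
    have "\<not> (\<exists>x\<in>carrier_vec (dim_col A). map_mat (at_point a \<xi>) A *\<^sub>v x = map_vec (at_point a \<xi>) c)"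
      if p: "(a, \<xi>) \<in> constructible ?N ?Z" for a \<xi>
    proof -
      have pNZ: "(a, \<xi>) \<in> constructible N Z" using p sub by blast
      have "at_point a \<xi> (num (f r)) = 0" "at_point a \<xi> (num (vec_index b j)) \<noteq> 0"
        using p unfolding mem_constructible by blast+
      then have "pev a \<xi> (f r) = 0" "pev a \<xi> (vec_index b j) \<noteq> 0"
        using num_eq_0_iff[OF pNZ quotient_regular_all, of r] num_eq_0_iff[OF pNZ b_regular[OF j(2)]] by simp_all
      then show ?thesis using inconsistent_point[OF pNZ r _ j] A by auto
    qed
    moreover have "finite ?N" "finite ?Z" using finite_Ns finite_Z by simp_all
    ultimately show ?thesis
      unfolding \<sigma> change_coordinates.simps valid_pls_regime.simps by blast
  qed
qed

end

lemma pls_via_smith_of_ts_regime: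
  fixes A :: "('y::{finite,linorder}, 'a::field) yxpoly mat"
  assumes A: "A \<in> carrier_mat m n" and b: "b \<in> carrier_vec m"
    and fin: "finite N" "finite Z" and \<rho>: "fraction_choice \<rho>"
    and t: "valid_ts_regime A t"
    and quot: "\<not> purely_transcendental (ts_ext t) \<Longrightarrow> quotient_denominators_adjoined t"
  shows "pls_via_smith (ts_ext t) (ts_H t) m n (ts_N t) \<rho>
    (ts_U t *\<^sub>v map_vec (gen_poly (ts_ext t)) b)
    ((\<lambda>p. [:p:]) ` ts_N t \<union> x_part N) ((\<lambda>p. [:p:]) ` ts_Z t \<union> x_part Z) A b (ts_U t) (ts_R t)"
proof -
  define E U H R N0 Z0 where defs: "E = ts_ext t" "U = ts_U t" "H = ts_H t" "R = ts_R t"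
    "N0 = ts_N t" "Z0 = ts_Z t"
  let ?N = "(\<lambda>p. [:p:]) ` N0 \<union> x_part N" and ?Z = "(\<lambda>p. [:p:]) ` Z0 \<union> x_part Z"
  have dims: "dim_row A = m" "dim_col A = n" using A by simp_all
  have v: "finite N0" "finite Z0" "parameterized_extension E" "tower_polys E \<subseteq> Z0"
      "\<forall>a \<in> constructible_Y N0 Z0. compatible_point E a"
      "U \<in> carrier_mat m m" "H \<in> carrier_mat m n" "R \<in> carrier_mat n n" "det R \<noteq> 0"
      "\<forall>i<m. \<forall>j<m. poly_over (ext_field E) (U $$ (i, j)) \<and>
         (\<forall>k. coeff_regular E N0 (coeff (U $$ (i, j)) k))"
      "\<forall>i<m. \<forall>j<n. \<forall>k. coeff_regular E N0 (coeff (H $$ (i, j)) k)"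
      "triangular_smith_form (ext_field E) H"
      "\<forall>a \<in> constructible_Y N0 Z0.
         triangular_smith_form (adjoin to_ac (range a)) (map_mat (eval_poly_Y E a) H) \<and>
         unimodular_over (adjoin to_ac (range a)) (map_mat (eval_poly_Y E a) U) \<and>
         map_mat (eval_poly_Y E a) U * map_mat (at_params_x a) A * map_mat (\<lambda>c. [:to_ac c:]) R
           = map_mat (eval_poly_Y E a) H"
    using t unfolding valid_ts_regime_def Let_def dims defs by blast+
  \<comment> \<open>The constraints of the Smith regime enter as polynomials constant in
    \<open>x\<close>, so forgetting \<open>\<xi>\<close> leads into the parameter set on which that
    regime makes its promises.\<close>
  have proj: "a \<in> constructible_Y N0 Z0" if "(a, \<xi>) \<in> constructible ?N ?Z" for a \<xi>
    using that unfolding mem_constructible constructible_Y_def mem_Collect_eq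
      at_point_const[of a \<xi>, symmetric] by blast
  have U: "U $$ (i, j) \<in> polys_over (regular_coeffs E N0)" if "i < m" "j < m" for i j
    using v(10) that by (simp add: polys_over_def regular_coeffs_def)
  have Hr: "H $$ (i, j) \<in> polys_over (regular_coeffs E N0)" if "i < m" "j < n" for i j
    using v(11) that by (simp add: polys_over_def regular_coeffs_def)
  have sf: "smith_form (ext_field E) H m n"
    by unfold_locales (use v in \<open>simp_all add: ext_field_def is_subfield_adjoin\<close>)
  have br: "vec_in (polys_over (regular_coeffs E N0)) (U *\<^sub>v map_vec (gen_poly E) b)"
    by (rule vec_in_mult[OF is_subring_polys_over[OF is_subring_regular_coeffs]])
      (use U v(6) b gen_poly_regular in \<open>auto simp: mat_in_def vec_in_def\<close>)
  have bc: "U *\<^sub>v map_vec (gen_poly E) b \<in> carrier_vec m"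
    by (rule mult_mat_vec_carrier[OF v(6)]) (use b in simp)
  have "pls_via_smith E H m n N0 \<rho> (U *\<^sub>v map_vec (gen_poly E) b) ?N ?Z A b U R"
  proof (intro pls_via_smith.intro pls_via_smith_axioms.intro smith_regime.intro smith_regime_axioms.intro
      regular_smith_form.intro regular_smith_form_axioms.intro sf A b v(3,6,8,9) \<rho> bc refl U Hr
      is_subring_regular_coeffs)
    show "sqfr_quotient (ext_field E) H i \<in> polys_over (regular_coeffs E N0)" if "i < smith_rank H" for i
    proof (rule regular_sqfr_quotient[OF v(3) sf Hr _ that])
      assume "\<not> purely_transcendental E"
      then show "sqfr_quotient (ext_field E) H i \<in> polys_over (regular_coeffs E N0)"
        using quot that unfolding defs quotient_denominators_adjoined_def
        by (simp add: polys_over_def regular_coeffs_def)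
    qed
    show "finite ?N" "finite ?Z" using v(1,2) fin by (simp_all add: x_part_def)
    show "(\<lambda>p. [:p:]) ` N0 \<subseteq> ?N" "(\<lambda>p. [:p:]) ` tower_polys E \<subseteq> ?Z" using v(4) by blast+
    show "compatible_point E a" if "(a, \<xi>) \<in> constructible ?N ?Z" for a \<xi> using v(5) proj[OF that] by blast
    show "vec_index (U *\<^sub>v map_vec (gen_poly E) b) j \<in> polys_over (regular_coeffs E N0)" if "j < m" for j
      using br carrier_vecD[OF bc] that unfolding vec_in_def by metis
    show "det (map_mat (eval_poly_Y E a) U) dvd 1" if "(a, \<xi>) \<in> constructible ?N ?Z" for a \<xi>
      using v(13) proj[OF that] unfolding unimodular_over_def by blast
    show "map_mat (eval_poly_Y E a) U * map_mat (at_params_x a) A * map_mat (\<lambda>c. [:to_ac c:]) R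
        = map_mat (eval_poly_Y E a) H" if "(a, \<xi>) \<in> constructible ?N ?Z" for a \<xi>
      using v(13) proj[OF that] by blast
  qed
  then show ?thesis unfolding defs .
qed

theorem theorem5p4:
  fixes A :: "('y::{finite,linorder}, 'a::field) yxpoly mat"
    and b :: "('y, 'a) yxpoly vec"
    and N Z :: "('y, 'a) yxpoly set"
    and T :: "('y, 'a) ts_regime list"
    and \<rho> :: "('y, 'a) fraction_choice"
    and m n :: nat
  assumes "A \<in> carrier_mat m n" and "b \<in> carrier_vec m"
    and "finite N" and "finite Z"
    and "fraction_choice \<rho>"
    and "ctsnf_solution A (Y_part N) (Y_part Z) T"
    and "\<And>t. t \<in> set T \<Longrightarrow> \<not> purely_transcendental (ts_ext t) \<Longrightarrow>
           quotient_denominators_adjoined t"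
  shows "pls_solution A b N Z (pls_via_ctsnf \<rho> T b N Z)"
proof -
  let ?b = "\<lambda>t. ts_U t *\<^sub>v map_vec (gen_poly (ts_ext t)) b"
  let ?N = "\<lambda>t. (\<lambda>p. [:p:]) ` ts_N t \<union> x_part N"
  let ?Z = "\<lambda>t. (\<lambda>p. [:p:]) ` ts_Z t \<union> x_part Z"
  have loc: "pls_via_smith (ts_ext t) (ts_H t) m n (ts_N t) \<rho> (?b t) (?N t) (?Z t) A b (ts_U t) (ts_R t)"
    if "t \<in> set T" for t
    by (rule pls_via_smith_of_ts_regime[OF assms(1-5)])
      (use assms(6,7) that in \<open>auto simp: ctsnf_solution_def\<close>)
  show ?thesis unfolding pls_solution_def
  proof (intro conjI ballI subsetI)
    fix \<sigma> assume "\<sigma> \<in> pls_via_ctsnf \<rho> T b N Z"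
    then obtain t \<tau> where "t \<in> set T" "\<tau> \<in> triangular_smith_pls \<rho> (ts_ext t) (ts_H t) (?b t) (?N t) (?Z t)"
      "\<sigma> = change_coordinates (ts_R t) \<tau>"
      unfolding pls_via_ctsnf_def by blast
    then show "valid_pls_regime A b \<sigma>" using pls_via_smith.regime_valid[OF loc] by blast
  next
    fix p assume p: "p \<in> constructible N Z"
    obtain a \<xi> where a: "p = (a, \<xi>)" by (cases p)
    have Z: "at_point a \<xi> q = 0" if "q \<in> Z" for q using p that unfolding a mem_constructible by blast
    have N: "at_point a \<xi> q \<noteq> 0" if "q \<in> N" for q using p that unfolding a mem_constructible by blast
    \<comment> \<open>Elements of \<open>N\<close> and \<open>Z\<close> free of \<open>x\<close>
      constrain \<open>a\<close> alone, so \<open>a\<close> lies in the set covered by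
      \<open>T\<close>.\<close>
    have "a \<in> constructible_Y (Y_part N) (Y_part Z)"
      unfolding constructible_Y_def Y_part_def mem_Collect_eq at_point_const[of a \<xi>, symmetric]
      using Z N by blast
    then obtain t where t: "t \<in> set T" "a \<in> constructible_Y (ts_N t) (ts_Z t)"
      using assms(6) unfolding ctsnf_solution_def by blast
    interpret pls_via_smith "ts_ext t" "ts_H t" m n "ts_N t" \<rho> "?b t" "?N t" "?Z t" A b "ts_U t" "ts_R t"
      by (rule loc[OF t(1)])
    \<comment> \<open>The conditions on the parameters now come from \<open>t\<close>; those that
      involve \<open>x\<close> are inherited from \<open>N\<close> and \<open>Z\<close>.\<close>
    have "(a, \<xi>) \<in> constructible (?N t) (?Z t)"
      unfolding mem_constructible using t(2) Z N
      by (auto simp: at_point_const constructible_Y_def x_part_def)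
    then obtain \<tau> where \<tau>: "\<tau> \<in> triangular_smith_pls \<rho> (ts_ext t) (ts_H t) (?b t) (?N t) (?Z t)"
      "(a, \<xi>) \<in> regime_set \<tau>"
      using triangular_smith_pls_covers_point by blast
    then have "change_coordinates (ts_R t) \<tau> \<in> pls_via_ctsnf \<rho> T b N Z"
      unfolding pls_via_ctsnf_def using t(1) by blast
    moreover have "p \<in> regime_set (change_coordinates (ts_R t) \<tau>)" using \<tau>(2) a by simp
    ultimately show "p \<in> (\<Union>\<sigma>\<in>pls_via_ctsnf \<rho> T b N Z. regime_set \<sigma>)" by blast
  qed
qed

end
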